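(* Let $m\ge2$, let $\Theta\in M_m(\mathbb R)$ be skew-symmetric, let $S$ be a finite-dimensional Hilbert space, and let $F\colon\mathbb Z^m\to\mathrm{End}(S)_{\mathrm{sa}}$ be a selfadjoint matrix-valued function. Let $D_F$ be the Fourier-multiplier operator on $H_\Theta:=L^2(A_\Theta,\tau_\Theta)\otimes S$ given by $D_F(\delta_x\otimes\xi)=\delta_x\otimes F(x)\xi$ for $x\in\mathbb Z^m$, $\xi\in S$. Assume that: (a) (finite spectral multiplicity in bounded intervals) for every $R>0$, the vector space $\bigoplus_{x\in\mathbb Z^m,\ \mathrm{Spec}(F(x))\cap[-R,R]\ne\varnothing}S$ is finite-dimensional; (b) (bounded translation increments) for every $a\in\mathbb Z^m$, $\sup_{x\in\mathbb Z^m}\|F(x+a)-F(x)\|<\infty$. Then $(A_\Theta,H_\Theta,D_F)$ is a spectral triple.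
   Context: $A_\Theta$ is the universal unital $C^*$-algebra generated by unitaries $U_1,\dots,U_m$ with $U_kU_j=e^{2\pi i\Theta_{j,k}}U_jU_k$; $U^x:=U_1^{x_1}\cdots U_m^{x_m}$ for $x\in\mathbb Z^m$; $\tau_\Theta$ is the canonical trace ($\tau_\Theta(U^x)=0$ for $x\ne0$, $\tau_\Theta(1)=1$). The GNS space $L^2(A_\Theta,\tau_\Theta)$ is identified with $\ell^2(\mathbb Z^m)$, $\delta_x$ being the basis vector of the monomial $U^x$. $A_\Theta$ acts on $H_\Theta$ by $\pi_\Theta$, left multiplication on the first factor (tensored with $1_S$). $D_F$ has domain $\{(\xi_x)_x\in\bigoplus_{x\in\mathbb Z^m}S:\sum_x\|F(x)\xi_x\|^2<\infty\}$. A spectral triple $(A,H,D)$ on a unital $C^*$-algebra $A$ consists of a faithful unital representation $\pi\colon A\to\mathcal B(H)$ and a selfadjoint operator $D$ on $H$ such that $D$ has compact resolvent and $A^\infty(D):=\{a\in A:[D,\pi(a)]\text{ is densely defined and extends to a bounded operator}\}$ is dense in $A$. *)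

theory Defs
  imports "HOL-Analysis.Analysis" "HOL-Algebra.Ring"
begin

section \<open>Complex Hilbert spaces\<close>

class scaleC =
  fixes scaleC :: "complex \<Rightarrow> 'a \<Rightarrow> 'a" (infixr \<open>*\<^sub>C\<close> 75)

class complex_vector = real_vector + scaleC +
  assumes scaleC_add_right: "c *\<^sub>C (x + y) = c *\<^sub>C x + c *\<^sub>C y"
    and scaleC_add_left: "(c + d) *\<^sub>C x = c *\<^sub>C x + d *\<^sub>C x"
    and scaleC_scaleC: "c *\<^sub>C d *\<^sub>C x = (c * d) *\<^sub>C x"
    and scaleR_scaleC: "r *\<^sub>R x = complex_of_real r *\<^sub>C x"
begin

lemma scaleC_one [simp]: "1 *\<^sub>C x = x"
  using scaleR_scaleC[of 1 x] by (simp add: scaleR_one)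

end

class complex_normed_vector = complex_vector + real_normed_vector +
  assumes norm_scaleC: "norm (c *\<^sub>C x) = cmod c * norm x"

text \<open>The inner product is linear in the second argument.\<close>

class complex_inner = complex_normed_vector +
  fixes cinner :: "'a \<Rightarrow> 'a \<Rightarrow> complex"
  assumes cinner_commute: "cinner x y = cnj (cinner y x)"
    and cinner_add_right: "cinner x (y + z) = cinner x y + cinner x z"
    and cinner_scaleC_right: "cinner x (c *\<^sub>C y) = c * cinner x y"
    and cinner_self: "cinner x x = complex_of_real ((norm x)\<^sup>2)"

class chilbert_space = complex_inner + complete_space

global_interpretation complex_vector: vector_space "scaleC :: complex \<Rightarrow> 'a \<Rightarrow> 'a::complex_vector"
  by standard (simp_all add: scaleC_add_right scaleC_add_left scaleC_scaleC)

definition finite_dimensional :: "'a::complex_vector set \<Rightarrow> bool" where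
  "finite_dimensional V \<longleftrightarrow> (\<exists>B. finite B \<and> V \<subseteq> module.span scaleC B)"

abbreviation clinear :: "('a::complex_vector \<Rightarrow> 'b::complex_vector) \<Rightarrow> bool" where
  "clinear \<equiv> Vector_Spaces.linear scaleC scaleC"

definition bounded_clinear :: "('a::complex_normed_vector \<Rightarrow> 'b::complex_normed_vector) \<Rightarrow> bool" where
  "bounded_clinear T \<longleftrightarrow> clinear T \<and> bounded_linear T"

lemma cinner_add_left: "cinner (x + y) z = cinner x z + cinner y z"
  for x y z :: "'a::complex_inner"
  by (metis cinner_add_right cinner_commute complex_cnj_add)

lemma cinner_scaleC_left: "cinner (c *\<^sub>C x) y = cnj c * cinner x y"
  for x y :: "'a::complex_inner"
  by (metis cinner_commute cinner_scaleC_right complex_cnj_mult)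

lemma Re_cinner_le: "Re (cinner x y) \<le> norm x * norm y"
  for x y :: "'a::complex_inner"
proof -
  have eq: "complex_of_real ((norm (x + y))\<^sup>2) =
      complex_of_real ((norm x)\<^sup>2) + cinner x y + cinner y x + complex_of_real ((norm y)\<^sup>2)"
    using cinner_self[of "x + y"]
    by (simp only: cinner_self[symmetric] cinner_add_left cinner_add_right add_ac)
  have "Re (cinner y x) = Re (cinner x y)"
    by (metis cinner_commute complex_cnj(1) complex.collapse complex.sel(1))
  with arg_cong[OF eq, of Re]
  have "(norm (x + y))\<^sup>2 = (norm x)\<^sup>2 + 2 * Re (cinner x y) + (norm y)\<^sup>2"
    by (simp del: of_real_power)
  moreover have "(norm (x + y))\<^sup>2 \<le> (norm x + norm y)\<^sup>2"
    by (intro power_mono norm_triangle_ineq norm_ge_zero)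
  ultimately show ?thesis by (simp add: power2_sum)
qed

lemma cinner_Cauchy_Schwarz: "cmod (cinner x y) \<le> norm x * norm y"
  for x y :: "'a::complex_inner"
proof (cases "cinner x y = 0")
  case False
  define c where "c = cnj (cinner x y) / complex_of_real (cmod (cinner x y))"
  have "cmod c = 1" using False by (simp add: c_def norm_divide)
  moreover have "cinner x (c *\<^sub>C y) = complex_of_real (cmod (cinner x y))"
    using False
    by (simp add: cinner_scaleC_right c_def field_simps complex_norm_square[symmetric]
        power2_eq_square[symmetric] mult.commute[of "cnj _"])
  ultimately show ?thesis
    using Re_cinner_le[of x "c *\<^sub>C y"] by (simp add: norm_scaleC)
qed auto

instantiation complex :: chilbert_space
begin
definition scaleC_complex :: "complex \<Rightarrow> complex \<Rightarrow> complex" where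
  "scaleC_complex c x = c * x"
definition cinner_complex :: "complex \<Rightarrow> complex \<Rightarrow> complex" where
  "cinner_complex x y = cnj x * y"
instance
  by standard (auto simp: scaleC_complex_def cinner_complex_def algebra_simps norm_mult
      scaleR_conv_of_real complex_norm_square[unfolded mult.commute[of _ "cnj _"]] simp del: of_real_power)
end

text \<open>The sort \<open>{chilbert_space, euclidean_space}\<close> stands for the nonzero finite-dimensional complex
  Hilbert spaces. Both classes refer to the same norm, hence the real inner product of the second is
  the real part of \<open>cinner\<close>. By the next instance every \<open>complex ^ 'n\<close> is of this sort.\<close>

instantiation vec :: (chilbert_space, finite) chilbert_space
begin
definition scaleC_vec :: "complex \<Rightarrow> 'a ^ 'b \<Rightarrow> 'a ^ 'b" where
  "scaleC_vec c x = (\<chi> i. c *\<^sub>C x $ i)"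
definition cinner_vec :: "'a ^ 'b \<Rightarrow> 'a ^ 'b \<Rightarrow> complex" where
  "cinner_vec x y = (\<Sum>i\<in>UNIV. cinner (x $ i) (y $ i))"
instance
proof
  fix x y z :: "'a ^ 'b" and c d :: complex and r :: real
  show "c *\<^sub>C (x + y) = c *\<^sub>C x + c *\<^sub>C y"
    by (simp add: scaleC_vec_def vec_eq_iff scaleC_add_right)
  show "(c + d) *\<^sub>C x = c *\<^sub>C x + d *\<^sub>C x"
    by (simp add: scaleC_vec_def vec_eq_iff scaleC_add_left)
  show "c *\<^sub>C d *\<^sub>C x = (c * d) *\<^sub>C x"
    by (simp add: scaleC_vec_def vec_eq_iff scaleC_scaleC)
  show "r *\<^sub>R x = complex_of_real r *\<^sub>C x"
    by (simp add: scaleC_vec_def vec_eq_iff scaleR_scaleC)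
  show "norm (c *\<^sub>C x) = cmod c * norm x"
    by (simp add: norm_vec_def scaleC_vec_def norm_scaleC L2_set_right_distrib)
  show "cinner x y = cnj (cinner y x)"
    unfolding cinner_vec_def cnj_sum by (intro sum.cong refl cinner_commute)
  show "cinner x (y + z) = cinner x y + cinner x z"
    by (simp add: cinner_vec_def cinner_add_right sum.distrib)
  show "cinner x (c *\<^sub>C y) = c * cinner x y"
    by (simp add: cinner_vec_def scaleC_vec_def cinner_scaleC_right sum_distrib_left)
  show "cinner x x = complex_of_real ((norm x)\<^sup>2)"
    by (simp add: cinner_vec_def norm_vec_def L2_set_def sum_nonneg cinner_self)
qed
end

section \<open>The Hilbert direct sum of copies of a Hilbert space\<close>

text \<open>The Hilbert space direct sum of copies of \<open>'s\<close> indexed by \<open>'i\<close>, which is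
  \<open>\<ell>\<^sup>2('i) \<otimes> 's\<close>.\<close>

typedef (overloaded) ('i, 's) l2 =
  "{f :: 'i \<Rightarrow> 's::real_normed_vector. (\<lambda>i. (norm (f i))\<^sup>2) summable_on UNIV}"
  morphisms l2_fun Abs_l2
  by (rule exI[of _ "\<lambda>_. 0"]) simp

setup_lifting type_definition_l2

lemma l2_bound_iff:
  fixes f :: "'i \<Rightarrow> 's::real_normed_vector"
  shows "(\<lambda>i. (norm (f i))\<^sup>2) summable_on UNIV \<longleftrightarrow>
    (\<exists>C. \<forall>F. finite F \<longrightarrow> L2_set (\<lambda>i. norm (f i)) F \<le> C)"
proof
  assume s: "(\<lambda>i. (norm (f i))\<^sup>2) summable_on UNIV"
  have "L2_set (\<lambda>i. norm (f i)) F \<le> sqrt (\<Sum>\<^sub>\<infinity>i. (norm (f i))\<^sup>2)" if "finite F" for F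
    unfolding L2_set_def
    by (intro real_sqrt_le_mono finite_sum_le_infsum s that) auto
  then show "\<exists>C. \<forall>F. finite F \<longrightarrow> L2_set (\<lambda>i. norm (f i)) F \<le> C" by blast
next
  assume "\<exists>C. \<forall>F. finite F \<longrightarrow> L2_set (\<lambda>i. norm (f i)) F \<le> C"
  then obtain C where C: "\<And>F. finite F \<Longrightarrow> L2_set (\<lambda>i. norm (f i)) F \<le> C" by blast
  have "(\<Sum>i\<in>F. (norm (f i))\<^sup>2) \<le> C\<^sup>2" if "finite F" for F
    using C[OF that] power_mono[OF C[OF that], of 2]
    by (simp add: L2_set_def sum_nonneg)
  then show "(\<lambda>i. (norm (f i))\<^sup>2) summable_on UNIV"
    by (intro nonneg_bdd_above_summable_on bdd_aboveI2) auto
qed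

instantiation l2 :: (type, real_normed_vector) real_vector
begin

lift_definition zero_l2 :: "('a, 'b) l2" is "\<lambda>_. 0" by simp

lift_definition plus_l2 :: "('a, 'b) l2 \<Rightarrow> ('a, 'b) l2 \<Rightarrow> ('a, 'b) l2"
  is "\<lambda>f g i. f i + g i"
proof -
  fix f g :: "'a \<Rightarrow> 'b"
  assume "(\<lambda>i. (norm (f i))\<^sup>2) summable_on UNIV" "(\<lambda>i. (norm (g i))\<^sup>2) summable_on UNIV"
  then obtain C D where
    CD: "\<And>F. finite F \<Longrightarrow> L2_set (\<lambda>i. norm (f i)) F \<le> C"
        "\<And>F. finite F \<Longrightarrow> L2_set (\<lambda>i. norm (g i)) F \<le> D"
    unfolding l2_bound_iff by blast
  have "L2_set (\<lambda>i. norm (f i + g i)) F \<le> C + D" if "finite F" for F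
  proof -
    have "L2_set (\<lambda>i. norm (f i + g i)) F \<le> L2_set (\<lambda>i. norm (f i) + norm (g i)) F"
      by (intro L2_set_mono norm_triangle_ineq) auto
    also have "\<dots> \<le> L2_set (\<lambda>i. norm (f i)) F + L2_set (\<lambda>i. norm (g i)) F"
      by (rule L2_set_triangle_ineq)
    also have "\<dots> \<le> C + D" using CD that by (intro add_mono) auto
    finally show ?thesis .
  qed
  then show "(\<lambda>i. (norm (f i + g i))\<^sup>2) summable_on UNIV" unfolding l2_bound_iff by blast
qed

lift_definition uminus_l2 :: "('a, 'b) l2 \<Rightarrow> ('a, 'b) l2" is "\<lambda>f i. - f i" by simp

definition minus_l2 :: "('a, 'b) l2 \<Rightarrow> ('a, 'b) l2 \<Rightarrow> ('a, 'b) l2" where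
  "minus_l2 f g = f + - g"

lift_definition scaleR_l2 :: "real \<Rightarrow> ('a, 'b) l2 \<Rightarrow> ('a, 'b) l2" is "\<lambda>r f i. r *\<^sub>R f i"
  by (simp add: power_mult_distrib summable_on_cmult_right)

instance
  by standard
    (unfold minus_l2_def, (transfer, force simp: fun_eq_iff algebra_simps)+)

end

lemma l2_fun_simps [simp]:
  "l2_fun 0 i = 0" "l2_fun (f + g) i = l2_fun f i + l2_fun g i"
  "l2_fun (- f) i = - l2_fun f i" "l2_fun (f - g) i = l2_fun f i - l2_fun g i"
  "l2_fun (r *\<^sub>R f) i = r *\<^sub>R l2_fun f i"
  unfolding minus_l2_def zero_l2.rep_eq plus_l2.rep_eq uminus_l2.rep_eq scaleR_l2.rep_eq
  by simp_all

lemma l2_eqI: "(\<And>i. l2_fun f i = l2_fun g i) \<Longrightarrow> f = g"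
  by (rule l2_fun_inject[THEN iffD1], rule ext)

lemma l2_fun_summable: "(\<lambda>i. (norm (l2_fun f i))\<^sup>2) summable_on UNIV"
  using l2_fun[of f] by (rule CollectD)

instantiation l2 :: (type, real_normed_vector) real_normed_vector
begin

definition norm_l2 :: "('a, 'b) l2 \<Rightarrow> real" where
  "norm_l2 f = sqrt (\<Sum>\<^sub>\<infinity>i. (norm (l2_fun f i))\<^sup>2)"
definition dist_l2 :: "('a, 'b) l2 \<Rightarrow> ('a, 'b) l2 \<Rightarrow> real" where
  "dist_l2 f g = norm (f - g)"
definition sgn_l2 :: "('a, 'b) l2 \<Rightarrow> ('a, 'b) l2" where
  "sgn_l2 f = inverse (norm f) *\<^sub>R f"
definition uniformity_l2 :: "(('a, 'b) l2 \<times> ('a, 'b) l2) filter" where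
  "uniformity_l2 = (INF e\<in>{0<..}. principal {(x, y). dist x y < e})"
definition open_l2 :: "('a, 'b) l2 set \<Rightarrow> bool" where
  "open_l2 S = (\<forall>x\<in>S. \<forall>\<^sub>F (x', y) in uniformity. x' = x \<longrightarrow> y \<in> S)"

lemma L2_set_le_norm_l2:
  "finite F \<Longrightarrow> L2_set (\<lambda>i. norm (l2_fun f i)) F \<le> norm f" for f :: "('a, 'b) l2"
  unfolding norm_l2_def L2_set_def
  by (intro real_sqrt_le_mono finite_sum_le_infsum l2_fun_summable) auto

lemma norm_l2_le:
  fixes f :: "('a, 'b) l2"
  assumes "\<And>F. finite F \<Longrightarrow> L2_set (\<lambda>i. norm (l2_fun f i)) F \<le> C"
  shows "norm f \<le> C"
proof -
  have C: "0 \<le> C" using assms[of "{}"] by simp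
  have "(\<Sum>\<^sub>\<infinity>i. (norm (l2_fun f i))\<^sup>2) \<le> C\<^sup>2"
  proof (rule infsum_le_finite_sums[OF l2_fun_summable])
    fix F :: "'a set" assume "finite F"
    from power_mono[OF assms[OF this], of 2]
    show "(\<Sum>i\<in>F. (norm (l2_fun f i))\<^sup>2) \<le> C\<^sup>2" by (simp add: L2_set_def sum_nonneg)
  qed
  then show ?thesis
    unfolding norm_l2_def using C real_le_lsqrt real_sqrt_le_iff by fastforce
qed

lemma norm_l2_fun_le: "norm (l2_fun f i) \<le> norm f" for f :: "('a, 'b) l2"
  using L2_set_le_norm_l2[of "{i}" f] by simp

instance
proof
  fix x y :: "('a, 'b) l2" and r :: real and S :: "('a, 'b) l2 set"
  show "dist x y = norm (x - y)" by (rule dist_l2_def)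
  show "sgn x = inverse (norm x) *\<^sub>R x" by (rule sgn_l2_def)
  show "uniformity = (INF e\<in>{0<..}. principal {(x, y). dist x y < (e::real)} :: (('a, 'b) l2 \<times> ('a, 'b) l2) filter)"
    by (rule uniformity_l2_def)
  show "open S \<longleftrightarrow> (\<forall>x\<in>S. \<forall>\<^sub>F (x', y) in uniformity. x' = x \<longrightarrow> y \<in> S)"
    by (rule open_l2_def)
  show "norm x = 0 \<longleftrightarrow> x = 0"
  proof
    assume "norm x = 0"
    then show "x = 0" using norm_l2_fun_le[of x] by (intro l2_eqI) simp
  qed (simp add: norm_l2_def)
  show "norm (x + y) \<le> norm x + norm y"
  proof (rule norm_l2_le)
    fix F :: "'a set" assume F: "finite F"
    have "L2_set (\<lambda>i. norm (l2_fun (x + y) i)) F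
        \<le> L2_set (\<lambda>i. norm (l2_fun x i) + norm (l2_fun y i)) F"
      by (intro L2_set_mono) (auto simp: norm_triangle_ineq)
    also have "\<dots> \<le> L2_set (\<lambda>i. norm (l2_fun x i)) F + L2_set (\<lambda>i. norm (l2_fun y i)) F"
      by (rule L2_set_triangle_ineq)
    also have "\<dots> \<le> norm x + norm y" by (intro add_mono L2_set_le_norm_l2 F)
    finally show "L2_set (\<lambda>i. norm (l2_fun (x + y) i)) F \<le> norm x + norm y" .
  qed
  show "norm (r *\<^sub>R x) = \<bar>r\<bar> * norm x"
    by (simp add: norm_l2_def power_mult_distrib infsum_cmult_right l2_fun_summable real_sqrt_mult)
qed

end

instantiation l2 :: (type, complex_inner) complex_inner
begin

lift_definition scaleC_l2 :: "complex \<Rightarrow> ('a, 'b) l2 \<Rightarrow> ('a, 'b) l2" is "\<lambda>c f i. c *\<^sub>C f i"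
  by (simp add: norm_scaleC power_mult_distrib summable_on_cmult_right)

definition cinner_l2 :: "('a, 'b) l2 \<Rightarrow> ('a, 'b) l2 \<Rightarrow> complex" where
  "cinner_l2 f g = (\<Sum>\<^sub>\<infinity>i. cinner (l2_fun f i) (l2_fun g i))"

lemma l2_fun_scaleC [simp]: "l2_fun (c *\<^sub>C f) i = c *\<^sub>C l2_fun f i"
  for f :: "('a, 'b) l2"
  by (simp add: scaleC_l2.rep_eq)

lemma cinner_l2_summable: "(\<lambda>i. cinner (l2_fun f i) (l2_fun g i)) summable_on UNIV"
  for f g :: "('a, 'b) l2"
proof (rule abs_summable_summable, rule Infinite_Sum.abs_summable_on_comparison_test')
  show "(\<lambda>i. (norm (l2_fun f i))\<^sup>2 + (norm (l2_fun g i))\<^sup>2) summable_on UNIV"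
    by (intro summable_on_add l2_fun_summable)
  fix i
  have "cmod (cinner (l2_fun f i) (l2_fun g i)) \<le> norm (l2_fun f i) * norm (l2_fun g i)"
    by (rule cinner_Cauchy_Schwarz)
  also have "\<dots> \<le> (norm (l2_fun f i))\<^sup>2 + (norm (l2_fun g i))\<^sup>2"
    using sum_squares_bound[of "norm (l2_fun f i)" "norm (l2_fun g i)"]
      mult_nonneg_nonneg[OF norm_ge_zero[of "l2_fun f i"] norm_ge_zero[of "l2_fun g i"]]
    by linarith
  finally show "cmod (cinner (l2_fun f i) (l2_fun g i)) \<le> (norm (l2_fun f i))\<^sup>2 + (norm (l2_fun g i))\<^sup>2" .
qed

instance
proof
  fix x y z :: "('a, 'b) l2" and c d :: complex and r :: real
  show "c *\<^sub>C (x + y) = c *\<^sub>C x + c *\<^sub>C y"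
    by (rule l2_eqI) (simp add: scaleC_add_right)
  show "(c + d) *\<^sub>C x = c *\<^sub>C x + d *\<^sub>C x"
    by (rule l2_eqI) (simp add: scaleC_add_left)
  show "c *\<^sub>C d *\<^sub>C x = (c * d) *\<^sub>C x"
    by (rule l2_eqI) (simp add: scaleC_scaleC)
  show "r *\<^sub>R x = complex_of_real r *\<^sub>C x"
    by (rule l2_eqI) (simp add: scaleR_scaleC)
  show "norm (c *\<^sub>C x) = cmod c * norm x"
    by (simp add: norm_l2_def norm_scaleC power_mult_distrib infsum_cmult_right l2_fun_summable
        real_sqrt_mult)
  show "cinner x y = cnj (cinner y x)"
    unfolding cinner_l2_def infsum_cnj[symmetric] by (intro infsum_cong cinner_commute)
  show "cinner x (y + z) = cinner x y + cinner x z"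
    by (simp add: cinner_l2_def cinner_add_right infsum_add cinner_l2_summable)
  show "cinner x (c *\<^sub>C y) = c * cinner x y"
    by (simp add: cinner_l2_def cinner_scaleC_right infsum_cmult_right cinner_l2_summable)
  have "((\<lambda>i. complex_of_real ((norm (l2_fun x i))\<^sup>2)) has_sum
      complex_of_real (\<Sum>\<^sub>\<infinity>i. (norm (l2_fun x i))\<^sup>2)) UNIV"
    by (intro has_sum_of_real has_sum_infsum l2_fun_summable)
  then show "cinner x x = complex_of_real ((norm x)\<^sup>2)"
    by (simp add: cinner_l2_def cinner_self norm_l2_def infsumI infsum_nonneg del: of_real_power)
qed

end

instance l2 :: (type, chilbert_space) chilbert_space
proof
  fix X :: "nat \<Rightarrow> ('a, 'b) l2"
  assume X: "Cauchy X"
  have "Cauchy (\<lambda>n. l2_fun (X n) i)" for i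
  proof (rule metric_CauchyI)
    fix e :: real assume "0 < e"
    with X obtain M where M: "\<And>m n. m \<ge> M \<Longrightarrow> n \<ge> M \<Longrightarrow> dist (X m) (X n) < e"
      by (meson metric_CauchyD)
    have "dist (l2_fun (X m) i) (l2_fun (X n) i) < e" if "m \<ge> M" "n \<ge> M" for m n
      using M[OF that] norm_l2_fun_le[of "X m - X n" i] by (simp add: dist_norm)
    then show "\<exists>M. \<forall>m\<ge>M. \<forall>n\<ge>M. dist (l2_fun (X m) i) (l2_fun (X n) i) < e" by blast
  qed
  then have "\<exists>l. (\<lambda>n. l2_fun (X n) i) \<longlonglongrightarrow> l" for i
    using Cauchy_convergent convergent_def by blast
  then obtain L where L: "\<And>i. (\<lambda>n. l2_fun (X n) i) \<longlonglongrightarrow> L i" by metis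
  have tail: "\<exists>M. \<forall>m\<ge>M. \<forall>F. finite F \<longrightarrow> L2_set (\<lambda>i. norm (l2_fun (X m) i - L i)) F \<le> e"
    if "0 < e" for e
  proof -
    from X that obtain M where M: "\<And>m n. m \<ge> M \<Longrightarrow> n \<ge> M \<Longrightarrow> dist (X m) (X n) < e"
      by (meson metric_CauchyD)
    have "L2_set (\<lambda>i. norm (l2_fun (X m) i - L i)) F \<le> e" if m: "m \<ge> M" and F: "finite F" for m F
    proof (rule tendsto_upperbound)
      show "(\<lambda>n. L2_set (\<lambda>i. norm (l2_fun (X m) i - l2_fun (X n) i)) F)
          \<longlonglongrightarrow> L2_set (\<lambda>i. norm (l2_fun (X m) i - L i)) F"
        unfolding L2_set_def by (intro tendsto_intros L)
      have "L2_set (\<lambda>i. norm (l2_fun (X m) i - l2_fun (X n) i)) F \<le> e" if "n \<ge> M" for n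
        using L2_set_le_norm_l2[OF F, of "X m - X n"] M[OF m that] by (simp add: dist_norm)
      then show "\<forall>\<^sub>F n in sequentially. L2_set (\<lambda>i. norm (l2_fun (X m) i - l2_fun (X n) i)) F \<le> e"
        using eventually_sequentially by blast
    qed simp
    then show ?thesis by blast
  qed
  obtain M where M: "\<And>F. finite F \<Longrightarrow> L2_set (\<lambda>i. norm (l2_fun (X M) i - L i)) F \<le> 1"
    using tail[of 1] by auto
  have "(\<lambda>i. (norm (l2_fun (X M) i - L i))\<^sup>2) summable_on UNIV"
    unfolding l2_bound_iff using M by blast
  then have "l2_fun (Abs_l2 (\<lambda>i. l2_fun (X M) i - L i)) = (\<lambda>i. l2_fun (X M) i - L i)"
    by (intro Abs_l2_inverse) simp
  then have lim: "l2_fun (X M - Abs_l2 (\<lambda>i. l2_fun (X M) i - L i)) = L"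
    by (intro ext) simp
  define Y where "Y = X M - Abs_l2 (\<lambda>i. l2_fun (X M) i - L i)"
  have "X \<longlonglongrightarrow> Y"
  proof (rule metric_LIMSEQ_I)
    fix e :: real assume "0 < e"
    then obtain N where N: "\<And>m F. m \<ge> N \<Longrightarrow> finite F \<Longrightarrow>
        L2_set (\<lambda>i. norm (l2_fun (X m) i - L i)) F \<le> e / 2"
      using tail[of "e / 2"] by auto
    have "dist (X m) Y < e" if "m \<ge> N" for m
    proof -
      have "norm (X m - Y) \<le> e / 2"
        by (rule norm_l2_le) (use N[OF that] lim in \<open>simp add: Y_def[symmetric]\<close>)
      then show ?thesis using \<open>0 < e\<close> by (simp add: dist_norm)
    qed
    then show "\<exists>N. \<forall>m\<ge>N. dist (X m) Y < e" by blast
  qed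
  then show "convergent X" by (auto simp: convergent_def)
qed

text \<open>\<open>l2_tensor f \<xi>\<close> is the elementary tensor \<open>f \<otimes> \<xi>\<close> of a square-summable
  \<open>f :: 'i \<Rightarrow> complex\<close> with \<open>\<xi>\<close>.\<close>

definition l2_tensor :: "('i \<Rightarrow> complex) \<Rightarrow> 's \<Rightarrow> ('i, 's::complex_inner) l2" where
  "l2_tensor f \<xi> = Abs_l2 (\<lambda>x. f x *\<^sub>C \<xi>)"

text \<open>The direct sum of the copies of \<open>'s\<close> indexed by \<open>X\<close>, as a subspace of the full one.\<close>

definition l2_subsum :: "'i set \<Rightarrow> ('i, 's::complex_inner) l2 set" where
  "l2_subsum X = {\<psi>. \<forall>x. x \<notin> X \<longrightarrow> l2_fun \<psi> x = 0}"

section \<open>Operators and spectral triples\<close>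

text \<open>A possibly unbounded operator: its values outside the domain are irrelevant.\<close>

record 'h operator =
  op_dom :: "'h set"
  op_app :: "'h \<Rightarrow> 'h"

definition densely_defined :: "'h::complex_inner operator \<Rightarrow> bool" where
  "densely_defined T \<longleftrightarrow> closure (op_dom T) = UNIV"

definition linear_operator :: "'h::complex_inner operator \<Rightarrow> bool" where
  "linear_operator T \<longleftrightarrow> module.subspace scaleC (op_dom T) \<and>
    (\<forall>\<xi>\<in>op_dom T. \<forall>\<eta>\<in>op_dom T. op_app T (\<xi> + \<eta>) = op_app T \<xi> + op_app T \<eta>) \<and>
    (\<forall>c. \<forall>\<xi>\<in>op_dom T. op_app T (c *\<^sub>C \<xi>) = c *\<^sub>C op_app T \<xi>)"

definition op_graph :: "'h operator \<Rightarrow> ('h \<times> 'h) set" where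
  "op_graph T = {(\<xi>, op_app T \<xi>) | \<xi>. \<xi> \<in> op_dom T}"

definition adjoint_graph :: "'h::complex_inner operator \<Rightarrow> ('h \<times> 'h) set" where
  "adjoint_graph T = {(\<eta>, \<zeta>). \<forall>\<xi>\<in>op_dom T. cinner \<eta> (op_app T \<xi>) = cinner \<zeta> \<xi>}"

definition selfadjoint_operator :: "'h::complex_inner operator \<Rightarrow> bool" where
  "selfadjoint_operator T \<longleftrightarrow>
    linear_operator T \<and> densely_defined T \<and> adjoint_graph T = op_graph T"

definition compact_operator :: "('h::complex_normed_vector \<Rightarrow> 'h) \<Rightarrow> bool" where
  "compact_operator K \<longleftrightarrow> bounded_clinear K \<and> compact (closure (K ` cball 0 1))"

definition is_resolvent :: "'h::complex_inner operator \<Rightarrow> complex \<Rightarrow> ('h \<Rightarrow> 'h) \<Rightarrow> bool" where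
  "is_resolvent T z R \<longleftrightarrow> bounded_clinear R \<and>
    (\<forall>\<eta>. R \<eta> \<in> op_dom T \<and> op_app T (R \<eta>) - z *\<^sub>C R \<eta> = \<eta>) \<and>
    (\<forall>\<xi>\<in>op_dom T. R (op_app T \<xi> - z *\<^sub>C \<xi>) = \<xi>)"

definition has_compact_resolvent :: "'h::complex_inner operator \<Rightarrow> bool" where
  "has_compact_resolvent T \<longleftrightarrow> (\<exists>z R. is_resolvent T z R) \<and>
    (\<forall>z R. is_resolvent T z R \<longrightarrow> compact_operator R)"

text \<open>\<open>DB - BD\<close> for an everywhere defined \<open>B\<close>, on its natural domain.\<close>

definition commutator :: "'h::complex_inner operator \<Rightarrow> ('h \<Rightarrow> 'h) \<Rightarrow> 'h operator" where
  "commutator D B = \<lparr>op_dom = {\<xi> \<in> op_dom D. B \<xi> \<in> op_dom D},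
    op_app = (\<lambda>\<xi>. op_app D (B \<xi>) - B (op_app D \<xi>))\<rparr>"

definition extends_to_bounded :: "'h::complex_inner operator \<Rightarrow> bool" where
  "extends_to_bounded T \<longleftrightarrow> (\<exists>B. bounded_clinear B \<and> (\<forall>\<xi>\<in>op_dom T. B \<xi> = op_app T \<xi>))"

class unital_cstar_algebra = complex_normed_vector + real_normed_algebra_1 + complete_space +
  fixes star :: "'a \<Rightarrow> 'a"
  assumes scaleC_mult_left: "(c *\<^sub>C x) * y = c *\<^sub>C (x * y)"
    and scaleC_mult_right: "x * (c *\<^sub>C y) = c *\<^sub>C (x * y)"
    and star_add: "star (x + y) = star x + star y"
    and star_scaleC: "star (c *\<^sub>C x) = cnj c *\<^sub>C star x"
    and star_mult: "star (x * y) = star y * star x"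
    and star_star: "star (star x) = x"
    and cstar_identity: "norm (star x * x) = (norm x)\<^sup>2"

definition faithful_unital_rep ::
    "('a::unital_cstar_algebra \<Rightarrow> 'h::chilbert_space \<Rightarrow> 'h) \<Rightarrow> bool" where
  "faithful_unital_rep \<pi> \<longleftrightarrow>
    (\<forall>a. bounded_clinear (\<pi> a)) \<and>
    (\<forall>a b \<xi>. \<pi> (a + b) \<xi> = \<pi> a \<xi> + \<pi> b \<xi>) \<and>
    (\<forall>c a \<xi>. \<pi> (c *\<^sub>C a) \<xi> = c *\<^sub>C \<pi> a \<xi>) \<and>
    (\<forall>a b \<xi>. \<pi> (a * b) \<xi> = \<pi> a (\<pi> b \<xi>)) \<and>
    (\<forall>a \<xi> \<eta>. cinner \<xi> (\<pi> (star a) \<eta>) = cinner (\<pi> a \<xi>) \<eta>) \<and>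
    (\<forall>\<xi>. \<pi> 1 \<xi> = \<xi>) \<and>
    inj \<pi>"

definition smooth_elements ::
    "('a::unital_cstar_algebra \<Rightarrow> 'h::chilbert_space \<Rightarrow> 'h) \<Rightarrow> 'h operator \<Rightarrow> 'a set" where
  "smooth_elements \<pi> D =
    {a. densely_defined (commutator D (\<pi> a)) \<and> extends_to_bounded (commutator D (\<pi> a))}"

text \<open>The algebra and the Hilbert space of the triple are the types \<open>'a\<close> and \<open>'h\<close>.\<close>

definition spectral_triple ::
    "('a::unital_cstar_algebra \<Rightarrow> 'h::chilbert_space \<Rightarrow> 'h) \<Rightarrow> 'h operator \<Rightarrow> bool" where
  "spectral_triple \<pi> D \<longleftrightarrow> faithful_unital_rep \<pi> \<and> selfadjoint_operator D \<and>
    has_compact_resolvent D \<and> closure (smooth_elements \<pi> D) = UNIV"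

section \<open>The noncommutative torus\<close>

text \<open>Unital C*-algebras with an explicit carrier, over which the universal property quantifies;
  \<open>cstar_of\<close> below turns a type of class \<open>unital_cstar_algebra\<close> into one.\<close>

record 'b cstar = "'b ring" +
  cscale :: "complex \<Rightarrow> 'b \<Rightarrow> 'b"
  adj :: "'b \<Rightarrow> 'b"
  cnorm :: "'b \<Rightarrow> real"

locale unital_cstar = ring B for B :: "'b cstar" (structure) +
  assumes cscale_closed: "x \<in> carrier B \<Longrightarrow> cscale B c x \<in> carrier B"
    and adj_closed: "x \<in> carrier B \<Longrightarrow> adj B x \<in> carrier B"
    and cscale_add_right: "\<lbrakk>x \<in> carrier B; y \<in> carrier B\<rbrakk> \<Longrightarrow>
      cscale B c (x \<oplus> y) = cscale B c x \<oplus> cscale B c y"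
    and cscale_add_left: "x \<in> carrier B \<Longrightarrow> cscale B (c + d) x = cscale B c x \<oplus> cscale B d x"
    and cscale_cscale: "x \<in> carrier B \<Longrightarrow> cscale B c (cscale B d x) = cscale B (c * d) x"
    and cscale_one: "x \<in> carrier B \<Longrightarrow> cscale B 1 x = x"
    and cscale_mult_left: "\<lbrakk>x \<in> carrier B; y \<in> carrier B\<rbrakk> \<Longrightarrow>
      cscale B c x \<otimes> y = cscale B c (x \<otimes> y)"
    and cscale_mult_right: "\<lbrakk>x \<in> carrier B; y \<in> carrier B\<rbrakk> \<Longrightarrow>
      x \<otimes> cscale B c y = cscale B c (x \<otimes> y)"
    and adj_add: "\<lbrakk>x \<in> carrier B; y \<in> carrier B\<rbrakk> \<Longrightarrow> adj B (x \<oplus> y) = adj B x \<oplus> adj B y"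
    and adj_cscale: "x \<in> carrier B \<Longrightarrow> adj B (cscale B c x) = cscale B (cnj c) (adj B x)"
    and adj_mult: "\<lbrakk>x \<in> carrier B; y \<in> carrier B\<rbrakk> \<Longrightarrow> adj B (x \<otimes> y) = adj B y \<otimes> adj B x"
    and adj_adj: "x \<in> carrier B \<Longrightarrow> adj B (adj B x) = x"
    and cnorm_eq_zero: "x \<in> carrier B \<Longrightarrow> cnorm B x = 0 \<longleftrightarrow> x = \<zero>"
    and cnorm_triangle: "\<lbrakk>x \<in> carrier B; y \<in> carrier B\<rbrakk> \<Longrightarrow>
      cnorm B (x \<oplus> y) \<le> cnorm B x + cnorm B y"
    and cnorm_cscale: "x \<in> carrier B \<Longrightarrow> cnorm B (cscale B c x) = cmod c * cnorm B x"
    and cnorm_mult: "\<lbrakk>x \<in> carrier B; y \<in> carrier B\<rbrakk> \<Longrightarrow>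
      cnorm B (x \<otimes> y) \<le> cnorm B x * cnorm B y"
    and cnorm_cstar: "x \<in> carrier B \<Longrightarrow> cnorm B (adj B x \<otimes> x) = (cnorm B x)\<^sup>2"
    and cnorm_complete: "\<lbrakk>\<And>n. X n \<in> carrier B;
        \<And>e. 0 < e \<Longrightarrow> \<exists>N. \<forall>m\<ge>N. \<forall>n\<ge>N. cnorm B (X m \<ominus> X n) < e\<rbrakk> \<Longrightarrow>
      \<exists>l\<in>carrier B. (\<lambda>n. cnorm B (X n \<ominus> l)) \<longlonglongrightarrow> 0"

definition cstar_of :: "'a::unital_cstar_algebra itself \<Rightarrow> 'a cstar" where
  "cstar_of _ = \<lparr>carrier = UNIV, mult = (*), one = 1, zero = 0, add = (+),
    cscale = scaleC, adj = star, cnorm = norm\<rparr>"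

lemma cstar_of_simps [simp]:
  fixes t :: "'a::unital_cstar_algebra itself"
  shows "carrier (cstar_of t) = UNIV" "mult (cstar_of t) = (*)" "one (cstar_of t) = 1"
    "zero (cstar_of t) = 0" "add (cstar_of t) = (+)" "cscale (cstar_of t) = scaleC"
    "adj (cstar_of t) = star" "cnorm (cstar_of t) = norm"
  by (simp_all add: cstar_of_def)

lemma ring_cstar_of: "ring (cstar_of TYPE('a::unital_cstar_algebra))"
proof (rule ringI)
  show "abelian_group (cstar_of TYPE('a))"
  proof (rule abelian_groupI)
    fix x assume "x \<in> carrier (cstar_of TYPE('a))"
    show "\<exists>y\<in>carrier (cstar_of TYPE('a)). y \<oplus>\<^bsub>cstar_of TYPE('a)\<^esub> x = \<zero>\<^bsub>cstar_of TYPE('a)\<^esub>"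
      by (rule bexI[of _ "- x"]) auto
  qed (auto simp: algebra_simps)
  show "Group.monoid (cstar_of TYPE('a))"
    by unfold_locales (auto simp: algebra_simps)
qed (auto simp: algebra_simps)

lemma a_minus_cstar_of [simp]:
  "x \<ominus>\<^bsub>cstar_of TYPE('a::unital_cstar_algebra)\<^esub> y = x - y"
proof -
  interpret ring "cstar_of TYPE('a)" by (rule ring_cstar_of)
  have "\<ominus>\<^bsub>cstar_of TYPE('a)\<^esub> y = - y"
    using minus_equality[of "- y" y] by simp
  then show ?thesis by (simp add: a_minus_def)
qed

lemma unital_cstar_cstar_of: "unital_cstar (cstar_of TYPE('a::unital_cstar_algebra))"
proof (intro unital_cstar.intro ring_cstar_of unital_cstar_axioms.intro)
  fix X :: "nat \<Rightarrow> 'a"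
  assume "\<And>e::real. 0 < e \<Longrightarrow> \<exists>N. \<forall>m\<ge>N. \<forall>n\<ge>N.
      cnorm (cstar_of TYPE('a)) (X m \<ominus>\<^bsub>cstar_of TYPE('a)\<^esub> X n) < e"
  then have "Cauchy X" by (simp add: Cauchy_def dist_norm)
  then obtain l where "X \<longlonglongrightarrow> l" using Cauchy_convergent convergent_def by blast
  then have "(\<lambda>n. norm (X n - l)) \<longlonglongrightarrow> 0"
    by (intro tendsto_norm_zero LIM_zero)
  then show "\<exists>l\<in>carrier (cstar_of TYPE('a)).
      (\<lambda>n. cnorm (cstar_of TYPE('a)) (X n \<ominus>\<^bsub>cstar_of TYPE('a)\<^esub> l)) \<longlonglongrightarrow> 0"
    unfolding a_minus_cstar_of cstar_of_simps by (intro bexI[of _ l]) simp_all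
qed (simp_all add: scaleC_add_right scaleC_add_left scaleC_scaleC scaleC_mult_left scaleC_mult_right
    star_add star_scaleC star_mult star_star norm_triangle_ineq norm_scaleC norm_mult_ineq
    cstar_identity)

definition unital_star_hom :: "'a cstar \<Rightarrow> 'b cstar \<Rightarrow> ('a \<Rightarrow> 'b) \<Rightarrow> bool" where
  "unital_star_hom A B \<phi> \<longleftrightarrow> \<phi> \<in> ring_hom A B \<and>
    (\<forall>c. \<forall>x\<in>carrier A. \<phi> (cscale A c x) = cscale B c (\<phi> x)) \<and>
    (\<forall>x\<in>carrier A. \<phi> (adj A x) = adj B (\<phi> x))"

text \<open>Unitaries with \<open>V\<^sub>k V\<^sub>j = exp (2 \<pi> \<i> \<Theta>\<^sub>j\<^sub>k) V\<^sub>j V\<^sub>k\<close>.\<close>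

definition nc_torus_relations :: "'b cstar \<Rightarrow> real ^ 'm ^ 'm::finite \<Rightarrow> ('m \<Rightarrow> 'b) \<Rightarrow> bool" where
  "nc_torus_relations B \<Theta> V \<longleftrightarrow>
    (\<forall>j. V j \<in> carrier B \<and> adj B (V j) \<otimes>\<^bsub>B\<^esub> V j = \<one>\<^bsub>B\<^esub> \<and> V j \<otimes>\<^bsub>B\<^esub> adj B (V j) = \<one>\<^bsub>B\<^esub>) \<and>
    (\<forall>j k. V k \<otimes>\<^bsub>B\<^esub> V j =
      cscale B (exp (2 * complex_of_real pi * \<i> * complex_of_real (\<Theta> $ j $ k))) (V j \<otimes>\<^bsub>B\<^esub> V k))"

definition generates :: "'a::unital_cstar_algebra set \<Rightarrow> bool" where
  "generates G \<longleftrightarrow> (\<forall>C. G \<subseteq> C \<and> closed C \<and> 1 \<in> C \<and> module.subspace scaleC C \<and>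
      (\<forall>x\<in>C. \<forall>y\<in>C. x * y \<in> C) \<and> (\<forall>x\<in>C. star x \<in> C) \<longrightarrow> C = UNIV)"

text \<open>\<open>universal_nc_torus \<Theta> U\<close>: the C*-algebra \<open>'a\<close> is \<open>A\<^sub>\<Theta>\<close> with canonical generators \<open>U\<close>.
  The test algebras \<open>B\<close> have an arbitrary subset of \<open>'a\<close> as carrier. This is no restriction: the
  C*-subalgebra generated by finitely many elements of any C*-algebra has at most the cardinality of
  the continuum, and \<open>'a\<close> has at least that cardinality, so it is isomorphic to one whose carrier
  is a subset of \<open>'a\<close>.\<close>

definition universal_nc_torus ::
    "real ^ 'm ^ 'm::finite \<Rightarrow> ('m \<Rightarrow> 'a::unital_cstar_algebra) \<Rightarrow> bool" where
  "universal_nc_torus \<Theta> U \<longleftrightarrow>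
    nc_torus_relations (cstar_of TYPE('a)) \<Theta> U \<and> generates (range U) \<and>
    (\<forall>(B :: 'a cstar) V. unital_cstar B \<and> nc_torus_relations B \<Theta> V \<longrightarrow>
      (\<exists>!\<phi>. unital_star_hom (cstar_of TYPE('a)) B \<phi> \<and> (\<forall>j. \<phi> (U j) = V j)))"

text \<open>For unitary \<open>u\<close>.\<close>

definition unitary_power :: "'a::unital_cstar_algebra \<Rightarrow> int \<Rightarrow> 'a" where
  "unitary_power u n = (if 0 \<le> n then u ^ nat n else star u ^ nat (- n))"

text \<open>\<open>U\<^sup>x\<close>: the product of the \<open>U\<^sub>j\<close> to the powers \<open>x\<^sub>j\<close>, in increasing order of the indices.\<close>

definition monomial ::
    "('m::{finite, linorder} \<Rightarrow> 'a::unital_cstar_algebra) \<Rightarrow> (int, 'm) vec \<Rightarrow> 'a" where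
  "monomial U x = prod_list (map (\<lambda>j. unitary_power (U j) (x $ j)) (sorted_list_of_set UNIV))"

definition canonical_trace ::
    "('m::{finite, linorder} \<Rightarrow> 'a::unital_cstar_algebra) \<Rightarrow> 'a \<Rightarrow> complex" where
  "canonical_trace U = (THE \<tau>. bounded_clinear \<tau> \<and>
    (\<forall>x. \<tau> (monomial U x) = (if x = 0 then 1 else 0)))"

text \<open>The vector of \<open>b\<close> in the GNS space of the canonical trace. In the orthonormal basis
  of monomials its coordinates are the GNS inner products \<open>\<tau> ((U\<^sup>x)\<^sup>* b)\<close>.\<close>

definition gns_vector ::
    "('m::{finite, linorder} \<Rightarrow> 'a::unital_cstar_algebra) \<Rightarrow> 'a \<Rightarrow> (int, 'm) vec \<Rightarrow> complex" where
  "gns_vector U b = (\<lambda>x. canonical_trace U (star (monomial U x) * b))"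

text \<open>Left multiplication on the GNS space, tensored with the identity.\<close>

definition nc_torus_rep ::
    "('m::{finite, linorder} \<Rightarrow> 'a::unital_cstar_algebra) \<Rightarrow> 'a \<Rightarrow>
      ((int, 'm) vec, 's::chilbert_space) l2 \<Rightarrow> ((int, 'm) vec, 's) l2" where
  "nc_torus_rep U a = (THE T. bounded_clinear T \<and>
    (\<forall>b \<xi>. T (l2_tensor (gns_vector U b) \<xi>) = l2_tensor (gns_vector U (a * b)) \<xi>))"

section \<open>Fourier multipliers\<close>

definition selfadjoint_endo :: "('s::complex_inner \<Rightarrow> 's) \<Rightarrow> bool" where
  "selfadjoint_endo T \<longleftrightarrow> clinear T \<and> (\<forall>\<xi> \<eta>. cinner \<xi> (T \<eta>) = cinner (T \<xi>) \<eta>)"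

text \<open>Only used on finite-dimensional spaces, where a bijective linear map has a bounded inverse.\<close>

definition spectrum :: "('s::complex_vector \<Rightarrow> 's) \<Rightarrow> complex set" where
  "spectrum T = {z. \<not> bij (\<lambda>\<xi>. T \<xi> - z *\<^sub>C \<xi>)}"

definition fourier_multiplier :: "('i \<Rightarrow> 's \<Rightarrow> 's) \<Rightarrow> ('i, 's::chilbert_space) l2 operator" where
  "fourier_multiplier F = \<lparr>op_dom = {\<psi>. (\<lambda>x. (norm (F x (l2_fun \<psi> x)))\<^sup>2) summable_on UNIV},
    op_app = (\<lambda>\<psi>. Abs_l2 (\<lambda>x. F x (l2_fun \<psi> x)))\<rparr>"

text \<open>The defining formula \<open>D\<^sub>F (\<delta>\<^sub>x \<otimes> \<xi>) = \<delta>\<^sub>x \<otimes> F(x) \<xi>\<close>.\<close>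

lemma l2_fun_tensor_delta:
  "l2_fun (l2_tensor (\<lambda>y. if y = x then 1 else 0) \<xi>) y = (if y = x then \<xi> else 0)"
proof -
  have eq: "(\<lambda>y. (if y = x then 1 else 0) *\<^sub>C \<xi>) = (\<lambda>y. if y = x then \<xi> else 0)"
    by (auto simp: fun_eq_iff)
  have "(\<lambda>y. (norm (if y = x then \<xi> else 0))\<^sup>2) summable_on UNIV \<longleftrightarrow>
      (\<lambda>y. (norm \<xi>)\<^sup>2) summable_on {x}"
    by (rule summable_on_cong_neutral) auto
  then have "(\<lambda>y. if y = x then \<xi> else 0) \<in>
      {f. (\<lambda>i. (norm (f i))\<^sup>2) summable_on UNIV}"
    by simp
  from Abs_l2_inverse[OF this] show ?thesis
    unfolding l2_tensor_def eq by (rule fun_cong)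
qed

lemma fourier_multiplier_delta:
  fixes F :: "'i \<Rightarrow> 's::chilbert_space \<Rightarrow> 's"
  assumes "\<And>x. clinear (F x)"
  shows "l2_tensor (\<lambda>y. if y = x then 1 else 0) \<xi> \<in> op_dom (fourier_multiplier F)"
    and "op_app (fourier_multiplier F) (l2_tensor (\<lambda>y. if y = x then 1 else 0) \<xi>) =
      l2_tensor (\<lambda>y. if y = x then 1 else 0) (F x \<xi>)"
proof -
  have "F y 0 = 0" for y
  proof -
    interpret Vector_Spaces.linear scaleC scaleC "F y" by (rule assms)
    show ?thesis by (rule zero)
  qed
  then have eq: "F y (l2_fun (l2_tensor (\<lambda>y. if y = x then 1 else 0) \<xi>) y) =
      l2_fun (l2_tensor (\<lambda>y. if y = x then 1 else 0) (F x \<xi>)) y" for y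
    by (simp add: l2_fun_tensor_delta)
  show "l2_tensor (\<lambda>y. if y = x then 1 else 0) \<xi> \<in> op_dom (fourier_multiplier F)"
    unfolding fourier_multiplier_def by (simp add: eq l2_fun_summable)
  show "op_app (fourier_multiplier F) (l2_tensor (\<lambda>y. if y = x then 1 else 0) \<xi>) =
      l2_tensor (\<lambda>y. if y = x then 1 else 0) (F x \<xi>)"
    unfolding fourier_multiplier_def by (simp add: eq l2_fun_inverse)
qed

end

theory Submission
  imports Defs
begin

text \<open>Two norms on noncommutative polynomials \<open>\<Sum> p\<^sub>x U\<^sup>x\<close> are compared: that of \<open>A\<^sub>\<Theta>\<close> and that of
  the twisted shifts on \<open>\<ell>\<^sup>2(\<int>\<^sup>m) \<otimes> S\<close>. Both lie between the supremum and the sum of the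
  coefficients; for \<open>A\<^sub>\<Theta>\<close> the lower bound is obtained by averaging over gauge automorphisms, which
  exist by the universal property and are contractive. The supports of the powers of a polynomial grow
  polynomially, so by the C*-identity the two norms agree. Hence the twisted shifts extend to an isometric
  representation of \<open>A\<^sub>\<Theta>\<close>; the trace is a vector state of this representation, which is therefore the
  GNS representation. The commutator of \<open>D\<^sub>F\<close> with a monomial is a twisted shift with
  coefficients \<open>F(x) - F(x - z)\<close>, and the resolvents of \<open>D\<^sub>F\<close> are norm limits of finite rank operators because
  a selfadjoint matrix without spectrum in \<open>[-R, R]\<close> is bounded below by \<open>R\<close>.\<close>

\<comment> \<open>The obstacle is that \<open>universal_nc_torus\<close> only supplies homomorphisms
  into algebras carried by subsets of \<open>'a\<close>, while operators on the Hilbert space form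
  another type. So the universal property is applied with \<open>'a\<close> itself as target, and
  the representation is built upwards from polynomials. Its boundedness must then come from an
  estimate; proving equality of norms rather than an inequality gives faithfulness in the same
  stroke. Equality is within reach because selfadjoint elements satisfy norm (h ^ 2 ^ n) = norm h ^
  2 ^ n in both norms, so any comparison that loses only a factor polynomial in 2 ^ n improves
  itself to an exact one.

  \<open>canonical_trace\<close> and \<open>nc_torus_rep\<close> are definite descriptions, so each
  needs existence and uniqueness. Uniqueness is a density argument both times: polynomials are dense
  in the algebra, and finitely supported vectors in the Hilbert space.\<close>
subclass (in chilbert_space) banach ..
subclass (in unital_cstar_algebra) banach ..

section \<open>Contractivity of star homomorphisms\<close>

lemma star_zero [simp]: "star (0::'a::unital_cstar_algebra) = 0"
  using star_add[of "0::'a" 0] by simp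

lemma star_one [simp]: "star (1::'a::unital_cstar_algebra) = 1"
  using star_mult[of "star (1::'a)" 1] by (simp add: star_star)

lemma star_scaleR: "star (r *\<^sub>R x) = r *\<^sub>R star x" for x :: "'a::unital_cstar_algebra"
  by (simp add: scaleR_scaleC star_scaleC)

lemma star_minus: "star (- x) = - star x" for x :: "'a::unital_cstar_algebra"
  using star_scaleR[of "-1" x] by simp

lemma star_power: "star (x ^ n) = star x ^ n" for x :: "'a::unital_cstar_algebra"
  by (induction n) (simp_all add: star_mult power_commutes)

lemma norm_star [simp]: "norm (star x) = norm x" for x :: "'a::unital_cstar_algebra"
proof -
  have le: "norm y \<le> norm (star y)" for y :: 'a
  proof (cases "y = 0")
    case False
    have "norm y * norm y \<le> norm (star y) * norm y"
      using norm_mult_ineq[of "star y" y] by (simp add: cstar_identity power2_eq_square)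
    with False show ?thesis by simp
  qed simp
  show ?thesis using le[of x] le[of "star x"] by (simp add: star_star)
qed

lemma bounded_linear_star: "bounded_linear (star :: 'a::unital_cstar_algebra \<Rightarrow> 'a)"
  by (rule bounded_linear_intro[of _ 1]) (simp_all add: star_add star_scaleR)

lemma norm_unitary: "norm u = 1" if "star u * u = 1" for u :: "'a::unital_cstar_algebra"
  using cstar_identity[of u] norm_ge_zero[of u] that by (auto simp: power2_eq_1_iff)

text \<open>Consecutive coefficients have ratio (1/2 - n) / (n + 1), of modulus at most one. The
  bound lets a geometric series dominate the binomial series of the square root.\<close>

lemma abs_half_gbinomial_le: "\<bar>(1/2::real) gchoose n\<bar> \<le> 1"
proof (induction n)
  case (Suc n)
  have "(1/2::real) gchoose Suc n = ((1/2) gchoose n) * ((1/2 - real n) / (real n + 1))"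
    by (simp add: gbinomial_absorption' gbinomial_prod_rev field_simps)
  moreover have "\<bar>(1/2 - real n) / (real n + 1)\<bar> \<le> 1" by (simp add: abs_le_iff field_simps)
  ultimately show ?case using Suc by (simp only: abs_mult) (rule mult_le_one, simp_all)
qed simp

text \<open>The root is the binomial series of \<open>sqrt (1 - h\<^sup>2)\<close>, which converges because \<open>norm h < 1\<close>.\<close>

lemma selfadjoint_sqrt:
  fixes h :: "'a::unital_cstar_algebra"
  assumes h: "star h = h" and less: "norm h < 1"
  obtains s where "star s = s" "s * h = h * s" "s * s = 1 - h * h"
proof -
  define f where "f n = ((1/2::real) gchoose n) *\<^sub>R (- (h * h)) ^ n" for n
  have n2: "norm (h * h) < 1"
    using norm_mult_ineq[of h h] less mult_strict_mono[of "norm h" 1 "norm h" 1] by simp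
  have sn: "summable (\<lambda>n. norm (f n))"
  proof (rule summable_comparison_test'[of "\<lambda>n. norm (h * h) ^ n" 0])
    show "summable (\<lambda>n. norm (h * h) ^ n)" using n2 by (intro summable_geometric) simp
    fix n
    have "norm (f n) \<le> 1 * norm (- (h * h)) ^ n"
      unfolding f_def norm_scaleR
      by (intro mult_mono norm_power_ineq) (simp_all add: abs_half_gbinomial_le)
    then show "norm (norm (f n)) \<le> norm (h * h) ^ n" by simp
  qed
  then have sm: "summable f" by (rule summable_norm_cancel)
  define s where "s = suminf f"
  have "(\<lambda>k. \<Sum>i\<le>k. f i * f (k - i)) sums (s * s)"
    unfolding s_def by (rule Cauchy_product_sums[OF sn sn])
  \<comment> \<open>By Vandermonde the squared series has the coefficients of (1 + t) ^ 1 at t = - h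
    * h, so only the terms k = 0 and k = 1 survive.\<close>
  moreover have "(\<Sum>i\<le>k. f i * f (k - i)) = ((1::real) gchoose k) *\<^sub>R (- (h * h)) ^ k" for k
  proof -
    have "(\<Sum>i\<le>k. f i * f (k - i)) =
        (\<Sum>i\<le>k. ((1/2 gchoose i) * (1/2 gchoose (k - i))) *\<^sub>R (- (h * h)) ^ k)"
      unfolding f_def by (intro sum.cong refl) (simp add: power_add[symmetric])
    also have "\<dots> = ((1::real) gchoose k) *\<^sub>R (- (h * h)) ^ k"
      using gbinomial_Vandermonde[of "1/2::real" "1/2" k]
      by (simp add: scaleR_sum_left[symmetric] atMost_atLeast0)
    finally show ?thesis .
  qed
  ultimately have "(\<lambda>k. ((1::real) gchoose k) *\<^sub>R (- (h * h)) ^ k) sums (s * s)" by simp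
  moreover have "(\<lambda>k. ((1::real) gchoose k) *\<^sub>R (- (h * h)) ^ k) sums
      (\<Sum>k\<in>{0,1}. ((1::real) gchoose k) *\<^sub>R (- (h * h)) ^ k)"
  proof (rule sums_finite)
    fix k :: nat assume "k \<notin> {0,1}"
    then have "(1::real) gchoose k = 0"
      using binomial_gbinomial[of 1 k, where 'a = real] by (simp add: binomial_eq_0)
    then show "((1::real) gchoose k) *\<^sub>R (- (h * h)) ^ k = 0" by simp
  qed simp
  ultimately have "s * s = 1 - h * h" by (auto dest: sums_unique2)
  moreover have "star s = s"
  proof -
    have "star s = (\<Sum>n. star (f n))"
      unfolding s_def by (rule bounded_linear.suminf[OF bounded_linear_star sm])
    also have "(\<lambda>n. star (f n)) = f"
      by (simp add: f_def fun_eq_iff star_scaleR star_power star_minus star_mult h)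
    finally show ?thesis by (simp add: s_def)
  qed
  moreover have "s * h = h * s"
  proof -
    have "s * h = (\<Sum>n. f n * h)" unfolding s_def by (rule suminf_mult2[OF sm])
    also have "(\<lambda>n. f n * h) = (\<lambda>n. h * f n)"
    proof
      fix n
      have "(- (h * h)) ^ n * h = h * (- (h * h)) ^ n"
        by (rule power_commuting_commutes) (simp add: mult.assoc)
      then show "f n * h = h * f n" by (simp add: f_def)
    qed
    also have "(\<Sum>n. h * f n) = h * s" unfolding s_def by (rule suminf_mult[OF sm])
    finally show ?thesis .
  qed
  ultimately show ?thesis by (intro that)
qed

lemma unital_star_homD:
  fixes \<phi> :: "'a::unital_cstar_algebra \<Rightarrow> 'b::unital_cstar_algebra"
  assumes "unital_star_hom (cstar_of TYPE('a)) (cstar_of TYPE('b)) \<phi>"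
  shows "\<phi> (x + y) = \<phi> x + \<phi> y" "\<phi> (x * y) = \<phi> x * \<phi> y" "\<phi> 1 = 1"
    "\<phi> (c *\<^sub>C x) = c *\<^sub>C \<phi> x" "\<phi> (star x) = star (\<phi> x)"
  using assms by (simp_all add: unital_star_hom_def ring_hom_def)

text \<open>A selfadjoint \<open>h\<close> of norm less than one is the real part of the unitary
  \<open>h + \<i> sqrt (1 - h\<^sup>2)\<close>, and homomorphisms map unitaries to unitaries.\<close>

lemma unital_star_hom_norm_le:
  fixes \<phi> :: "'a::unital_cstar_algebra \<Rightarrow> 'b::unital_cstar_algebra"
  assumes hom: "unital_star_hom (cstar_of TYPE('a)) (cstar_of TYPE('b)) \<phi>"
  shows "norm (\<phi> a) \<le> norm a"
proof -
  note D = unital_star_homD[OF hom]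
  have scaleR: "\<phi> (r *\<^sub>R x) = r *\<^sub>R \<phi> x" for r x by (simp add: scaleR_scaleC D)
  have one: "norm (\<phi> h) \<le> 1" if h: "star h = h" and less: "norm h < 1" for h
  proof -
    obtain s where s: "star s = s" "s * h = h * s" "s * s = 1 - h * h"
      using selfadjoint_sqrt[OF h less] .
    define u where "u = h + \<i> *\<^sub>C s"
    have su: "star u = h - \<i> *\<^sub>C s"
      by (simp add: u_def star_add star_scaleC h s complex_vector.scale_minus_left)
    have "star u * u = h * h + s * s"
      unfolding su unfolding u_def
      by (simp add: algebra_simps scaleC_mult_left scaleC_mult_right scaleC_scaleC s(2)
          complex_vector.scale_minus_left)
    then have "star u * u = 1" by (simp add: s)
    then have "star (\<phi> u) * \<phi> u = 1" using D by metis
    then have nu: "norm (\<phi> u) = 1" by (rule norm_unitary)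
    have "h = (1/2) *\<^sub>R (u + star u)"
      unfolding su unfolding u_def by (simp add: scaleR_add_right[symmetric] scaleR_2[symmetric])
    then have "\<phi> h = (1/2) *\<^sub>R (\<phi> u + star (\<phi> u))" using D scaleR by metis
    then show ?thesis using norm_triangle_ineq[of "\<phi> u" "star (\<phi> u)"] nu by simp
  qed
  \<comment> \<open>The root needs a norm strictly below one, so h is scaled by every r > norm h and
    r then decreases to norm h.\<close>
  have sa: "norm (\<phi> h) \<le> norm h" if h: "star h = h" for h
  proof (rule dense_ge)
    fix r assume r: "norm h < r"
    then have r0: "0 < r" by (meson norm_ge_zero le_less_trans)
    have "norm (\<phi> (inverse r *\<^sub>R h)) \<le> 1"
      by (rule one) (use h r r0 in \<open>simp_all add: star_scaleR field_simps\<close>)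
    then show "norm (\<phi> h) \<le> r" using r0 by (simp add: scaleR field_simps)
  qed
  have "(norm (\<phi> a))\<^sup>2 = norm (\<phi> (star a * a))" by (simp add: D cstar_identity)
  also have "\<dots> \<le> norm (star a * a)" by (rule sa) (simp add: star_mult star_star)
  also have "\<dots> = (norm a)\<^sup>2" by (rule cstar_identity)
  finally show ?thesis by (rule power2_le_imp_le) simp
qed

section \<open>Monomials\<close>

lemma scaleC_mult_scaleC:
  "(c *\<^sub>C x) * (d *\<^sub>C y) = (c * d) *\<^sub>C (x * y)" for x y :: "'a::unital_cstar_algebra"
  by (simp add: scaleC_mult_left scaleC_mult_right scaleC_scaleC mult.commute)

text \<open>Only the modulus of the scalars produced by reordering generators matters for the norm
  estimates, so the bookkeeping is done modulo phases.\<close>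

definition phase_eq :: "'a::complex_vector \<Rightarrow> 'a \<Rightarrow> bool" where
  "phase_eq a b \<longleftrightarrow> (\<exists>c. cmod c = 1 \<and> a = c *\<^sub>C b)"

lemma phase_eq_refl [simp]: "phase_eq a a"
  unfolding phase_eq_def by (rule exI[of _ 1]) simp

lemma phase_eq_sym: assumes "phase_eq a b" shows "phase_eq b a"
proof -
  obtain c where c: "cmod c = 1" "a = c *\<^sub>C b" using assms by (auto simp: phase_eq_def)
  then have "c \<noteq> 0" by auto
  then have "b = inverse c *\<^sub>C a" "cmod (inverse c) = 1"
    by (simp_all add: c scaleC_scaleC norm_inverse)
  then show ?thesis unfolding phase_eq_def by blast
qed

lemma phase_eq_trans [trans]: assumes "phase_eq a b" "phase_eq b c" shows "phase_eq a c"
proof -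
  obtain d e where "cmod d = 1" "a = d *\<^sub>C b" "cmod e = 1" "b = e *\<^sub>C c"
    using assms by (auto simp: phase_eq_def)
  then show ?thesis unfolding phase_eq_def
    by (intro exI[of _ "d * e"]) (simp add: norm_mult scaleC_scaleC)
qed

lemma phase_eq_mult:
  fixes a b a' b' :: "'a::unital_cstar_algebra"
  assumes "phase_eq a b" "phase_eq a' b'" shows "phase_eq (a * a') (b * b')"
proof -
  obtain d e where "cmod d = 1" "a = d *\<^sub>C b" "cmod e = 1" "a' = e *\<^sub>C b'"
    using assms by (auto simp: phase_eq_def)
  then show ?thesis unfolding phase_eq_def
    by (intro exI[of _ "d * e"]) (simp add: norm_mult scaleC_mult_scaleC)
qed

lemma phase_eq_mult_left: "phase_eq b c \<Longrightarrow> phase_eq (a * b) (a * c)"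
  for a b c :: "'a::unital_cstar_algebra"
  by (rule phase_eq_mult[OF phase_eq_refl])

lemma phase_eq_mult_right: "phase_eq a b \<Longrightarrow> phase_eq (a * c) (b * c)"
  for a b c :: "'a::unital_cstar_algebra"
  by (rule phase_eq_mult[OF _ phase_eq_refl])

definition phase_commute :: "'a::unital_cstar_algebra \<Rightarrow> 'a \<Rightarrow> bool" where
  "phase_commute a b \<longleftrightarrow> phase_eq (a * b) (b * a)"

lemma phase_commute_sym: "phase_commute a b \<Longrightarrow> phase_commute b a"
  unfolding phase_commute_def by (rule phase_eq_sym)

lemma phase_commute_one [simp]: "phase_commute 1 b" "phase_commute b 1"
  by (simp_all add: phase_commute_def)

lemma phase_commute_mult_left:
  assumes "phase_commute a c" "phase_commute b c" shows "phase_commute (a * b) c"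
proof -
  have "phase_eq (a * (b * c)) (a * (c * b))"
    using assms by (intro phase_eq_mult_left) (simp add: phase_commute_def)
  also have "a * (c * b) = (a * c) * b" by (simp add: mult.assoc)
  also have "phase_eq ((a * c) * b) ((c * a) * b)"
    using assms by (intro phase_eq_mult_right) (simp add: phase_commute_def)
  finally show ?thesis by (simp add: phase_commute_def mult.assoc)
qed

section \<open>Integer powers of unitaries\<close>

definition unitary :: "'a::unital_cstar_algebra \<Rightarrow> bool" where
  "unitary u \<longleftrightarrow> star u * u = 1 \<and> u * star u = 1"

lemma unitaryD:
  assumes "unitary u"
  shows "star u * u = 1" "u * star u = 1" "star u * (u * x) = x" "u * (star u * x) = x"
  using assms by (simp_all add: unitary_def mult.assoc[symmetric])

lemma unitary_one [simp]: "unitary 1"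
  by (simp add: unitary_def)

lemma unitary_star: "unitary u \<Longrightarrow> unitary (star u)"
  by (simp add: unitary_def star_star)

lemma unitary_mult: assumes "unitary u" "unitary v" shows "unitary (u * v)"
  unfolding unitary_def star_mult mult.assoc using unitaryD[OF assms(1)] unitaryD[OF assms(2)] by simp

lemma unitary_pow: "unitary u \<Longrightarrow> unitary (u ^ n)"
  by (induction n) (simp_all add: unitary_mult)

lemma unitary_unitary_power: "unitary u \<Longrightarrow> unitary (unitary_power u n)"
  by (simp add: unitary_power_def unitary_pow unitary_star)

lemma unitary_prod_list: "(\<And>u. u \<in> set us \<Longrightarrow> unitary u) \<Longrightarrow> unitary (prod_list us)"
  by (induction us) (simp_all add: unitary_mult)

lemma unitary_power_Suc:
  assumes u: "unitary u"
  shows "unitary_power u (n + 1) = unitary_power u n * u"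
proof (cases "0 \<le> n")
  case True
  then have "nat (n + 1) = Suc (nat n)" by simp
  then show ?thesis using True by (simp add: unitary_power_def power_commutes)
next
  case False
  define k where "k = nat (- n - 1)"
  have k: "nat (- n) = Suc k" "nat (- (n + 1)) = k" using False by (simp_all add: k_def)
  have "unitary_power u n * u = star u ^ k * (star u * u)"
    using False by (simp add: unitary_power_def k power_Suc2 mult.assoc del: power_Suc)
  also have "\<dots> = star u ^ k" by (simp add: unitaryD[OF u])
  also have "\<dots> = unitary_power u (n + 1)"
  \<comment> \<open>At n = -1 the exponent n + 1 moves to the nonnegative branch of
    \<open>unitary_power\<close>; there k = 0 and both sides are 1.\<close>
  proof (cases "n + 1 = 0")
    case True
    then show ?thesis using k by (simp add: unitary_power_def)
  next
    case n1: False
    then show ?thesis using False k by (simp add: unitary_power_def)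
  qed
  finally show ?thesis by simp
qed

lemma unitary_power_add:
  assumes u: "unitary u"
  shows "unitary_power u (m + n) = unitary_power u m * unitary_power u n"
proof (induction n rule: int_induct[where k = 0])
  case base
  show ?case by (simp add: unitary_power_def)
next
  case (step1 i)
  have "unitary_power u (m + (i + 1)) = unitary_power u (m + i) * u"
    using unitary_power_Suc[OF u, of "m + i"] by (simp add: add.assoc)
  then show ?case
    unfolding step1 unitary_power_Suc[OF u, of i] by (simp add: mult.assoc)
next
  case (step2 i)
  have dec: "unitary_power u (k - 1) = unitary_power u k * star u" for k
    using unitary_power_Suc[OF u, of "k - 1"] unitaryD[OF u] by (simp add: mult.assoc)
  have "unitary_power u (m + (i - 1)) = unitary_power u (m + i) * star u"
    using dec[of "m + i"] by (simp add: algebra_simps)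
  then show ?case unfolding step2 dec[of i] by (simp add: mult.assoc)
qed

text \<open>Multiplying the relation between u v and v u by \<open>star u\<close> on both sides
  cancels one u in each product and leaves v \<open>star u\<close> and \<open>star u\<close>
  v.\<close>

lemma phase_commute_star_left:
  assumes u: "unitary u" and c: "phase_commute u v" shows "phase_commute (star u) v"
proof -
  have "phase_eq (star u * (u * v) * star u) (star u * (v * u) * star u)"
    using c by (intro phase_eq_mult_right phase_eq_mult_left) (simp add: phase_commute_def)
  then have "phase_eq (v * star u) (star u * v)"
    by (simp add: mult.assoc unitaryD[OF u])
  then show ?thesis unfolding phase_commute_def by (rule phase_eq_sym)
qed

lemma phase_commute_pow_left: "phase_commute u v \<Longrightarrow> phase_commute (u ^ n) v"
  by (induction n) (simp_all add: phase_commute_mult_left)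

lemma phase_commute_unitary_power_left:
  "unitary u \<Longrightarrow> phase_commute u v \<Longrightarrow> phase_commute (unitary_power u n) v"
  by (simp add: unitary_power_def phase_commute_pow_left phase_commute_star_left)

lemma phase_commute_prod_list_left:
  "(\<And>u. u \<in> set us \<Longrightarrow> phase_commute u v) \<Longrightarrow> phase_commute (prod_list us) v"
  by (induction us) (simp_all add: phase_commute_mult_left)

context
  fixes U :: "'m::{finite, linorder} \<Rightarrow> 'a::unital_cstar_algebra"
  assumes unitary_gen: "\<And>j. unitary (U j)"
    and commute_gen: "\<And>j k. phase_commute (U j) (U k)"
begin

lemma unitary_monomial: "unitary (monomial U x)"
  unfolding monomial_def by (rule unitary_prod_list) (auto intro: unitary_unitary_power unitary_gen)

lemma monomial_zero: "monomial U 0 = 1"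
proof -
  have "prod_list (map (\<lambda>j. unitary_power (U j) 0) js) = 1" for js :: "'m list"
    by (induction js) (simp_all add: unitary_power_def)
  then show ?thesis by (simp add: monomial_def)
qed

lemma phase_commute_powers: "phase_commute (unitary_power (U j) m) (unitary_power (U k) n)"
  by (intro phase_commute_unitary_power_left unitary_gen phase_commute_sym[of "unitary_power (U k) n"] commute_gen)

text \<open>Along the list of generators, the leading power of the second monomial is moved left
  through the tail of the first at the cost of a phase; there it meets a power of the same unitary
  and the exponents add.\<close>

lemma monomial_mult: "phase_eq (monomial U x * monomial U y) (monomial U (x + y))"
proof -
  define P where "P x js = prod_list (map (\<lambda>j. unitary_power (U j) (x $ j)) js)"
    for x and js :: "'m list"
  have "phase_eq (P x js * P y js) (P (x + y) js)" for js
  proof (induction js)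
    case (Cons j js)
    let ?a = "unitary_power (U j) (x $ j)" and ?b = "unitary_power (U j) (y $ j)"
    have "phase_commute (P x js) ?b"
      unfolding P_def by (rule phase_commute_prod_list_left) (auto intro: phase_commute_powers)
    then have "phase_eq (?a * (P x js * ?b) * P y js) (?a * (?b * P x js) * P y js)"
      by (intro phase_eq_mult_right phase_eq_mult_left) (simp add: phase_commute_def)
    also have "?a * (?b * P x js) * P y js = (?a * ?b) * (P x js * P y js)"
      by (simp add: mult.assoc)
    also have "phase_eq \<dots> ((?a * ?b) * P (x + y) js)"
      by (intro phase_eq_mult_left Cons.IH)
    also have "(?a * ?b) * P (x + y) js = P (x + y) (j # js)"
      by (simp add: P_def unitary_power_add[OF unitary_gen])
    finally show ?case by (simp add: P_def mult.assoc)
  qed (simp add: P_def)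
  then show ?thesis by (simp add: P_def monomial_def)
qed

end

section \<open>Gauge automorphisms and the coefficients of a polynomial\<close>

lemma nc_torus_relationsD:
  fixes U :: "'m::finite \<Rightarrow> 'a::unital_cstar_algebra"
  assumes "nc_torus_relations (cstar_of TYPE('a)) \<Theta> U"
  shows "unitary (U j)" "phase_commute (U j) (U k)"
proof -
  note R = assms[unfolded nc_torus_relations_def cstar_of_simps]
  show "unitary (U j)" using R unfolding unitary_def by blast
  have "U j * U k = exp (2 * complex_of_real pi * \<i> * complex_of_real (\<Theta> $ k $ j)) *\<^sub>C (U k * U j)"
    using R by blast
  moreover have "cmod (exp (2 * complex_of_real pi * \<i> * complex_of_real (\<Theta> $ k $ j))) = 1"
    by simp
  ultimately show "phase_commute (U j) (U k)"
    unfolding phase_commute_def phase_eq_def by blast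
qed

text \<open>Rescaling the generators by unimodular scalars keeps them unitary and multiplies both
  sides of each commutation relation by the same number. The rescaled family is therefore
  admissible, with the algebra itself as test algebra.\<close>

lemma universal_nc_torus_gauge:
  fixes U :: "'m::finite \<Rightarrow> 'a::unital_cstar_algebra"
  assumes univ: "universal_nc_torus \<Theta> U" and t: "\<And>j. cmod (t j) = 1"
  obtains \<alpha> where "unital_star_hom (cstar_of TYPE('a)) (cstar_of TYPE('a)) \<alpha>"
    "\<And>j. \<alpha> (U j) = t j *\<^sub>C U j"
proof -
  have ct: "cnj (t j) * t j = 1" for j
    using t[of j] complex_norm_square[of "t j"] by (simp add: mult.commute)
  let ?e = "\<lambda>j k. exp (2 * complex_of_real pi * \<i> * complex_of_real (\<Theta> $ j $ k))"
  have R: "nc_torus_relations (cstar_of TYPE('a)) \<Theta> U"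
    using univ by (simp add: universal_nc_torus_def)
  have "unitary (t j *\<^sub>C U j)" for j
    using nc_torus_relationsD(1)[OF R, of j] ct[of j]
    by (simp add: unitary_def star_scaleC scaleC_mult_scaleC mult.commute)
  moreover have "t k *\<^sub>C U k * t j *\<^sub>C U j = ?e j k *\<^sub>C (t j *\<^sub>C U j * t k *\<^sub>C U k)" for j k
  proof -
    have c: "U k * U j = ?e j k *\<^sub>C (U j * U k)"
      using R unfolding nc_torus_relations_def cstar_of_simps by blast
    have "t k * t j * ?e j k = ?e j k * (t j * t k)" by (simp only: mult_ac)
    then show ?thesis unfolding scaleC_mult_scaleC c scaleC_scaleC by (rule arg_cong)
  qed
  ultimately have "nc_torus_relations (cstar_of TYPE('a)) \<Theta> (\<lambda>j. t j *\<^sub>C U j)"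
    unfolding nc_torus_relations_def cstar_of_simps unitary_def by blast
  then have "\<exists>\<alpha>. unital_star_hom (cstar_of TYPE('a)) (cstar_of TYPE('a)) \<alpha> \<and>
      (\<forall>j. \<alpha> (U j) = t j *\<^sub>C U j)"
    using univ unital_cstar_cstar_of unfolding universal_nc_torus_def by blast
  then show ?thesis using that by blast
qed

lemma gauge_monomial:
  fixes U :: "'m::{finite, linorder} \<Rightarrow> 'a::unital_cstar_algebra"
  assumes hom: "unital_star_hom (cstar_of TYPE('a)) (cstar_of TYPE('a)) \<alpha>"
    and \<alpha>: "\<And>j. \<alpha> (U j) = t j *\<^sub>C U j" and t: "\<And>j. cmod (t j) = 1"
  shows "\<alpha> (monomial U x) = (\<Prod>j\<in>UNIV. t j powi (x $ j)) *\<^sub>C monomial U x"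
proof -
  note D = unital_star_homD[OF hom]
  have pow: "\<alpha> (u ^ n) = c ^ n *\<^sub>C u ^ n" if "\<alpha> u = c *\<^sub>C u" for u c n
    by (induction n) (simp_all add: D that scaleC_mult_scaleC)
  \<comment> \<open>Negative exponents are powers of the adjoint, on which the scalar acts by its
    conjugate; for a unimodular scalar this is the inverse.\<close>
  have inv: "inverse (t j) = cnj (t j)" for j
    using t[of j] by (simp add: inverse_complex_def complex_eq_iff cmod_def)
  have upow: "\<alpha> (unitary_power (U j) n) = (t j powi n) *\<^sub>C unitary_power (U j) n" for j n
  proof (cases "0 \<le> n")
    case True
    then show ?thesis by (simp add: unitary_power_def power_int_def pow[OF \<alpha>])
  next
    case False
    have "\<alpha> (star (U j)) = cnj (t j) *\<^sub>C star (U j)" by (simp add: D \<alpha> star_scaleC)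
    from pow[OF this] False show ?thesis by (simp add: unitary_power_def power_int_def inv)
  qed
  have "\<alpha> (prod_list (map (\<lambda>j. unitary_power (U j) (x $ j)) js)) =
      prod_list (map (\<lambda>j. t j powi (x $ j)) js) *\<^sub>C
        prod_list (map (\<lambda>j. unitary_power (U j) (x $ j)) js)" for js
    by (induction js) (simp_all add: D upow scaleC_mult_scaleC)
  moreover have "prod_list (map (\<lambda>j. t j powi (x $ j)) (sorted_list_of_set UNIV)) =
      (\<Prod>j\<in>UNIV. t j powi (x $ j))"
    using prod.distinct_set_conv_list[of "sorted_list_of_set (UNIV :: 'm set)" "\<lambda>j. t j powi (x $ j)"]
    by simp
  ultimately show ?thesis by (simp add: monomial_def)
qed

text \<open>For a gauge automorphism \<open>\<alpha>\<close> with eigenvalue \<open>1\<close> at \<open>z\<close> (after rescaling) and \<open>-1\<close> at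
  \<open>y\<close>, the contraction \<open>(id + \<alpha>) / 2\<close> keeps the coefficient at \<open>z\<close> and removes the one at \<open>y\<close>.\<close>

lemma coefficient_le_norm:
  fixes U :: "'m::{finite, linorder} \<Rightarrow> 'a::unital_cstar_algebra"
  assumes univ: "universal_nc_torus \<Theta> U" and fin: "finite X" and zX: "z \<notin> X"
  shows "cmod (p z) \<le> norm (\<Sum>x\<in>insert z X. p x *\<^sub>C monomial U x)"
  using fin zX
proof (induction X arbitrary: p rule: finite_induct)
  case empty
  have "nc_torus_relations (cstar_of TYPE('a)) \<Theta> U"
    using univ by (simp add: universal_nc_torus_def)
  note R = nc_torus_relationsD[OF this]
  have "norm (monomial U z) = 1"
    using unitary_monomial[of U z] R by (intro norm_unitary) (simp add: unitary_def)
  then show ?case by (simp add: norm_scaleC)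
next
  case (insert y X)
  then have yz: "y \<noteq> z" by auto
  then obtain i where i: "y $ i \<noteq> z $ i" by (auto simp: vec_eq_iff)
  \<comment> \<open>Only generator i is rotated, by the angle for which the eigenvalues at y and z
    have quotient exp (\<i> pi) = -1.\<close>
  define w where "w = cis (pi / of_int (y $ i - z $ i))"
  define t where "t j = (if j = i then w else 1)" for j
  have w1: "cmod w = 1" by (simp add: w_def)
  then have w0: "w \<noteq> 0" by auto
  have t: "cmod (t j) = 1" for j by (simp add: t_def w1)
  obtain \<alpha> where hom: "unital_star_hom (cstar_of TYPE('a)) (cstar_of TYPE('a)) \<alpha>"
    and \<alpha>: "\<And>j. \<alpha> (U j) = t j *\<^sub>C U j"
    using universal_nc_torus_gauge[OF univ, of t] t by blast
  note D = unital_star_homD[OF hom]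
  have mon: "\<alpha> (monomial U x) = (w powi (x $ i)) *\<^sub>C monomial U x" for x
  proof -
    have "(\<Prod>j\<in>UNIV. t j powi (x $ j)) = (\<Prod>j\<in>UNIV. if j = i then w powi (x $ j) else 1)"
      by (intro prod.cong) (auto simp: t_def)
    then show ?thesis using gauge_monomial[of \<alpha> U t, OF hom \<alpha> t, of x] by simp
  qed
  have \<alpha>0: "\<alpha> 0 = 0" using D(4)[of 0 0] by simp
  have sum: "\<alpha> (\<Sum>x\<in>A. f x) = (\<Sum>x\<in>A. \<alpha> (f x))" for f and A :: "(int, 'm) vec set"
    by (induction A rule: infinite_finite_induct) (simp_all add: \<alpha>0 D)
  define e where "e x = w powi (x $ i - z $ i)" for x
  have ey: "e y = -1"
  proof -
    have "e y = cis (of_int (y $ i - z $ i) * (pi / of_int (y $ i - z $ i)))"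
      by (simp only: e_def w_def cis_power_int)
    also have "\<dots> = cis pi" using i by simp
    finally show ?thesis by simp
  qed
  have ez: "e z = 1" by (simp add: e_def)
  \<comment> \<open>These are the coefficients after averaging: unchanged at z, zero at y, modified
    elsewhere. This is why the induction runs over arbitrary p.\<close>
  define q where "q x = (1 + e x) / 2 * p x" for x
  define P where "P = (\<Sum>x\<in>insert z (insert y X). p x *\<^sub>C monomial U x)"
  \<comment> \<open>The rescaling that turns the eigenvalue of \<alpha> at z into 1; it is
    unimodular, so k \<alpha> is still contractive.\<close>
  define k where "k = w powi (- (z $ i))"
  have k1: "cmod k = 1" by (simp add: k_def norm_power_int w1)
  have ek: "k * w powi (x $ i) = e x" for x
    using w0 by (simp add: k_def e_def power_int_add[symmetric])
  have "(\<Sum>x\<in>insert z X. q x *\<^sub>C monomial U x) = (\<Sum>x\<in>insert z (insert y X). q x *\<^sub>C monomial U x)"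
    by (rule sum.mono_neutral_left) (use insert in \<open>auto simp: q_def ey\<close>)
  also have "\<dots> = (1/2) *\<^sub>R (P + k *\<^sub>C \<alpha> P)"
    unfolding P_def sum scaleR_scaleC complex_vector.scale_sum_right sum.distrib[symmetric]
  proof (intro sum.cong refl)
    fix x
    have qx: "q x = complex_of_real (1/2) * (p x + k * (p x * w powi (x $ i)))"
      by (simp add: q_def ek[symmetric] algebra_simps)
    show "q x *\<^sub>C monomial U x =
        complex_of_real (1/2) *\<^sub>C (p x *\<^sub>C monomial U x + k *\<^sub>C \<alpha> (p x *\<^sub>C monomial U x))"
      unfolding qx D(4) mon scaleC_scaleC scaleC_add_left[symmetric] ..
  qed
  finally have eq: "(\<Sum>x\<in>insert z X. q x *\<^sub>C monomial U x) = (1/2) *\<^sub>R (P + k *\<^sub>C \<alpha> P)" .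
  have "cmod (p z) = cmod (q z)" by (simp add: q_def ez)
  also have "\<dots> \<le> norm ((1/2) *\<^sub>R (P + k *\<^sub>C \<alpha> P))"
    using insert.IH[of q] insert.prems by (simp add: eq)
  also have "\<dots> \<le> (norm P + norm (\<alpha> P)) / 2"
    using norm_triangle_ineq[of P "k *\<^sub>C \<alpha> P"] by (simp add: norm_scaleC k1)
  also have "\<dots> \<le> norm P" using unital_star_hom_norm_le[OF hom, of P] by simp
  finally show ?case by (simp add: P_def)
qed

section \<open>Operators on the Hilbert direct sum\<close>

lemma bounded_clinearI:
  assumes "\<And>x y. f (x + y) = f x + f y" "\<And>c x. f (c *\<^sub>C x) = c *\<^sub>C f x"
    and "\<And>x. norm (f x) \<le> K * norm x"
  shows "bounded_clinear f"
  unfolding bounded_clinear_def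
proof
  show "clinear f"
    by (simp add: Vector_Spaces.linear_iff assms(1,2) complex_vector.vector_space_axioms)
  show "bounded_linear f"
    by (rule bounded_linear_intro[of _ K]) (simp_all add: assms scaleR_scaleC mult.commute)
qed

lemma bounded_clinearD:
  assumes "bounded_clinear f"
  shows "bounded_linear f" "f (x + y) = f x + f y" "f (c *\<^sub>C x) = c *\<^sub>C f x"
  using assms unfolding bounded_clinear_def Vector_Spaces.linear_iff by blast+

lemma clinearD:
  assumes "clinear f"
  shows "f (x + y) = f x + f y" "f (c *\<^sub>C x) = c *\<^sub>C f x" "f 0 = 0"
proof -
  show "f (x + y) = f x + f y" "f (c *\<^sub>C x) = c *\<^sub>C f x" for x y c
    using assms unfolding Vector_Spaces.linear_iff by blast+
  from this(2)[of 0 0] show "f 0 = 0" by simp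
qed

lemma clinear_imp_linear: "clinear f \<Longrightarrow> linear f"
  by (rule linearI) (simp_all add: clinearD scaleR_scaleC)

lemma bounded_bilinear_cinner:
  "bounded_bilinear (cinner :: 'a::complex_inner \<Rightarrow> 'a \<Rightarrow> complex)"
  by (rule bounded_bilinear.intro)
    (auto simp: cinner_add_left cinner_add_right scaleR_scaleC cinner_scaleC_left
      cinner_scaleC_right scaleC_complex_def intro!: exI[of _ 1] cinner_Cauchy_Schwarz)

lemmas continuous_on_cinner = bounded_bilinear.continuous_on[OF bounded_bilinear_cinner]

lemma cinner_zero [simp]: "cinner 0 x = 0" "cinner x 0 = 0" for x :: "'a::complex_inner"
  using cinner_scaleC_left[of 0 0 x] cinner_scaleC_right[of x 0 0] by simp_all

lemma cinner_diff_right: "cinner x (y - z) = cinner x y - cinner x z" for x :: "'a::complex_inner"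
  using cinner_add_right[of x "y - z" z] by simp

lemma cinner_diff_left: "cinner (x - y) z = cinner x z - cinner y z" for x :: "'a::complex_inner"
  using cinner_add_left[of "x - y" y z] by simp

lemma cinner_eqI: "x = y" if "\<And>z. cinner z x = cinner z y" for x y :: "'a::complex_inner"
proof -
  have "cinner (x - y) (x - y) = 0" by (simp add: cinner_diff_right that)
  then show ?thesis by (simp add: cinner_self)
qed

lemma bounded_linear_scaleC: "bounded_linear ((*\<^sub>C) c :: 'a::complex_normed_vector \<Rightarrow> 'a)"
  by (rule bounded_linear_intro[of _ "cmod c"])
    (simp_all add: scaleC_add_right scaleR_scaleC scaleC_scaleC norm_scaleC mult.commute)

lemma bounded_bilinear_scaleC:
  "bounded_bilinear (scaleC :: complex \<Rightarrow> 'a::complex_normed_vector \<Rightarrow> 'a)"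
  by (rule bounded_bilinear.intro)
    (auto simp: scaleC_add_left scaleC_add_right scaleR_scaleC scaleC_scaleC norm_scaleC
      scaleC_complex_def mult.commute intro!: exI[of _ 1])

lemma l2_fun_Abs:
  "(\<lambda>i. (norm (f i))\<^sup>2) summable_on UNIV \<Longrightarrow> l2_fun (Abs_l2 f) i = f i"
  by (simp add: Abs_l2_inverse)

lemma l2_norm_sq: "(norm f)\<^sup>2 = (\<Sum>\<^sub>\<infinity>i. (norm (l2_fun f i))\<^sup>2)" for f :: "('i, 's::real_normed_vector) l2"
  by (simp add: norm_l2_def infsum_nonneg)

lemma bounded_linear_l2_fun:
  "bounded_linear (\<lambda>f :: ('i, 's::real_normed_vector) l2. l2_fun f i)"
  by (rule bounded_linear_intro[of _ 1]) (simp_all add: norm_l2_fun_le)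

lemma l2_fun_sum: "l2_fun (\<Sum>a\<in>A. f a) i = (\<Sum>a\<in>A. l2_fun (f a) i)"
  by (induction A rule: infinite_finite_induct) simp_all

abbreviation l2_delta :: "'i \<Rightarrow> 's::complex_inner \<Rightarrow> ('i, 's) l2" where
  "l2_delta x \<equiv> l2_tensor (\<lambda>y. if y = x then 1 else 0)"

lemma norm_l2_delta [simp]: "norm (l2_delta x \<xi>) = norm \<xi>"
proof -
  have "(norm (l2_delta x \<xi>))\<^sup>2 = (\<Sum>\<^sub>\<infinity>y. if y = x then (norm \<xi>)\<^sup>2 else 0)"
    unfolding l2_norm_sq by (intro infsum_cong) (simp add: l2_fun_tensor_delta)
  also have "\<dots> = (\<Sum>\<^sub>\<infinity>y\<in>{x}. (norm \<xi>)\<^sup>2)" by (rule infsum_cong_neutral) auto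
  finally show ?thesis by simp
qed

lemma l2_delta_add: "l2_delta x (\<xi> + \<eta>) = l2_delta x \<xi> + l2_delta x \<eta>"
  by (rule l2_eqI) (simp add: l2_fun_tensor_delta)

lemma l2_delta_scaleC: "l2_delta x (c *\<^sub>C \<xi>) = c *\<^sub>C l2_delta x \<xi>"
  by (rule l2_eqI) (simp add: l2_fun_tensor_delta)

lemma bounded_linear_l2_delta: "bounded_linear (l2_delta x)"
  by (rule bounded_linear_intro[of _ 1]) (simp_all add: l2_delta_add l2_delta_scaleC scaleR_scaleC)

lemma cinner_l2_delta: "cinner (l2_delta x \<xi>) \<psi> = cinner \<xi> (l2_fun \<psi> x)"
proof -
  have "cinner (l2_delta x \<xi>) \<psi> = (\<Sum>\<^sub>\<infinity>y\<in>{x}. cinner \<xi> (l2_fun \<psi> x))"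
    unfolding cinner_l2_def by (rule infsum_cong_neutral) (auto simp: l2_fun_tensor_delta)
  then show ?thesis by simp
qed

section \<open>Approximation by finitely supported vectors\<close>

definition l2_truncate :: "'i set \<Rightarrow> ('i, 's::complex_inner) l2 \<Rightarrow> ('i, 's) l2" where
  "l2_truncate X \<psi> = (\<Sum>x\<in>X. l2_delta x (l2_fun \<psi> x))"

lemma l2_fun_truncate:
  "finite X \<Longrightarrow> l2_fun (l2_truncate X \<psi>) y = (if y \<in> X then l2_fun \<psi> y else 0)"
  unfolding l2_truncate_def l2_fun_sum by (auto simp: l2_fun_tensor_delta)

lemma l2_truncate_approx:
  fixes \<psi> :: "('i, 's::complex_inner) l2"
  assumes e: "0 < e"
  obtains X where "finite X" "norm (\<psi> - l2_truncate X \<psi>) < e"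
proof -
  let ?f = "\<lambda>i. (norm (l2_fun \<psi> i))\<^sup>2"
  have "(?f has_sum infsum ?f UNIV) UNIV" by (rule has_sum_infsum[OF l2_fun_summable])
  then have "(sum ?f \<longlongrightarrow> infsum ?f UNIV) (finite_subsets_at_top UNIV)" by (simp add: has_sum_def)
  then have "\<forall>\<^sub>F X in finite_subsets_at_top UNIV. dist (sum ?f X) (infsum ?f UNIV) < (e/2)\<^sup>2"
    using e by (intro tendstoD) simp_all
  then obtain X where X: "finite X" "dist (sum ?f X) (infsum ?f UNIV) < (e/2)\<^sup>2"
    unfolding eventually_finite_subsets_at_top by blast
  have "norm (\<psi> - l2_truncate X \<psi>) \<le> e/2"
  proof (rule norm_l2_le)
    fix F :: "'i set" assume F: "finite F"
    have "(\<Sum>i\<in>F. (norm (l2_fun (\<psi> - l2_truncate X \<psi>) i))\<^sup>2) = (\<Sum>i\<in>F. if i \<in> X then 0 else ?f i)"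
      by (intro sum.cong) (simp_all add: l2_fun_truncate X)
    also have "\<dots> = sum ?f (F - X)"
      using F by (intro sum.mono_neutral_cong_right) auto
    also have "\<dots> = sum ?f (F \<union> X) - sum ?f X"
      using sum.subset_diff[of X "F \<union> X" ?f] F X by (simp add: Un_Diff)
    also have "sum ?f (F \<union> X) \<le> infsum ?f UNIV"
      using F X by (intro finite_sum_le_infsum l2_fun_summable) auto
    finally have "(\<Sum>i\<in>F. (norm (l2_fun (\<psi> - l2_truncate X \<psi>) i))\<^sup>2) \<le> (e/2)\<^sup>2"
      using X by (simp add: dist_real_def abs_less_iff)
    then show "L2_set (\<lambda>i. norm (l2_fun (\<psi> - l2_truncate X \<psi>) i)) F \<le> e/2"
      unfolding L2_set_def using e by (intro real_le_lsqrt) (simp_all add: sum_nonneg)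
  qed
  with e X show ?thesis by (intro that[of X]) simp_all
qed

lemma closure_UNIV_if_truncations:
  fixes V :: "('i, 's::complex_inner) l2 set"
  assumes "\<And>X \<psi>. finite X \<Longrightarrow> l2_truncate X \<psi> \<in> V"
  shows "closure V = UNIV"
proof -
  have "\<psi> \<in> closure V" for \<psi>
    unfolding closure_approachable
  proof (intro allI impI)
    fix e :: real assume "0 < e"
    then obtain X where "finite X" "norm (\<psi> - l2_truncate X \<psi>) < e" by (rule l2_truncate_approx)
    then show "\<exists>y\<in>V. dist y \<psi> < e"
      by (intro bexI[of _ "l2_truncate X \<psi>"] assms) (simp add: dist_norm norm_minus_commute)
  qed
  then show ?thesis by auto
qed

lemma bounded_linear_eq_if_deltas:
  fixes S T :: "('i, 's::complex_inner) l2 \<Rightarrow> 'b::real_normed_vector"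
  assumes S: "bounded_linear S" and T: "bounded_linear T"
    and eq: "\<And>x \<xi>. S (l2_delta x \<xi>) = T (l2_delta x \<xi>)"
  shows "S = T"
proof -
  interpret S: bounded_linear S by (rule S)
  interpret T: bounded_linear T by (rule T)
  have "closure {\<psi>. S \<psi> = T \<psi>} = UNIV"
    by (rule closure_UNIV_if_truncations) (simp add: l2_truncate_def S.sum T.sum eq)
  moreover have "closed {\<psi>. S \<psi> = T \<psi>}"
    by (intro closed_Collect_eq S.continuous_on T.continuous_on continuous_on_id)
  ultimately show ?thesis by (auto simp: closure_closed)
qed

text \<open>Translation by z with operator weights. It serves three times: as twisted shift, with
  unimodular scalar weights; as commutator with the multiplier, with increments of F in the weights;
  and, for z = 0, as the fibrewise resolvent.\<close>

definition shift_op ::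
    "'i::ab_group_add \<Rightarrow> ('i \<Rightarrow> 's \<Rightarrow> 's) \<Rightarrow> ('i, 's::complex_inner) l2 \<Rightarrow> ('i, 's) l2" where
  "shift_op z A \<psi> = Abs_l2 (\<lambda>x. A x (l2_fun \<psi> (x - z)))"

lemma bij_diff: "bij (\<lambda>x. x - z)" for z :: "'i::ab_group_add"
  by (rule bij_betw_byWitness[where f' = "\<lambda>x. x + z"]) auto

context
  fixes A :: "'i::ab_group_add \<Rightarrow> 's::complex_inner \<Rightarrow> 's" and M :: real
  assumes M: "0 \<le> M" and A: "\<And>x v. norm (A x v) \<le> M * norm v"
begin

lemma shift_summable: "(\<lambda>x. (norm (A x (l2_fun \<psi> (x - z))))\<^sup>2) summable_on UNIV"
  and shift_infsum_le: "(\<Sum>\<^sub>\<infinity>x. (norm (A x (l2_fun \<psi> (x - z))))\<^sup>2) \<le> M\<^sup>2 * (norm \<psi>)\<^sup>2"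
proof -
  let ?f = "\<lambda>x. (norm (l2_fun \<psi> x))\<^sup>2"
  have s: "(\<lambda>x. ?f (x - z)) summable_on UNIV"
    using summable_on_reindex_bij_betw[OF bij_diff[of z], of ?f] l2_fun_summable[of \<psi>] by simp
  have i: "(\<Sum>\<^sub>\<infinity>x. ?f (x - z)) = (norm \<psi>)\<^sup>2"
    using infsum_reindex_bij_betw[OF bij_diff[of z], of ?f] by (simp add: l2_norm_sq)
  have le: "(norm (A x (l2_fun \<psi> (x - z))))\<^sup>2 \<le> M\<^sup>2 * ?f (x - z)" for x
    using power_mono[OF A norm_ge_zero, of x "l2_fun \<psi> (x - z)" 2] by (simp add: power_mult_distrib)
  have s2: "(\<lambda>x. M\<^sup>2 * ?f (x - z)) summable_on UNIV" by (intro summable_on_cmult_right s)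
  show s3: "(\<lambda>x. (norm (A x (l2_fun \<psi> (x - z))))\<^sup>2) summable_on UNIV"
    by (rule summable_on_comparison_test[OF s2 le]) simp
  have "(\<Sum>\<^sub>\<infinity>x. (norm (A x (l2_fun \<psi> (x - z))))\<^sup>2) \<le> (\<Sum>\<^sub>\<infinity>x. M\<^sup>2 * ?f (x - z))"
    by (rule infsum_mono[OF s3 s2 le])
  also have "\<dots> = M\<^sup>2 * (norm \<psi>)\<^sup>2" by (simp add: infsum_cmult_right s i)
  finally show "(\<Sum>\<^sub>\<infinity>x. (norm (A x (l2_fun \<psi> (x - z))))\<^sup>2) \<le> M\<^sup>2 * (norm \<psi>)\<^sup>2" .
qed

lemma l2_fun_shift_op: "l2_fun (shift_op z A \<psi>) x = A x (l2_fun \<psi> (x - z))"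
  unfolding shift_op_def by (rule l2_fun_Abs[OF shift_summable])

lemma norm_shift_op_le: "norm (shift_op z A \<psi>) \<le> M * norm \<psi>"
proof (rule power2_le_imp_le)
  show "(norm (shift_op z A \<psi>))\<^sup>2 \<le> (M * norm \<psi>)\<^sup>2"
    unfolding l2_norm_sq[of "shift_op z A \<psi>"] l2_fun_shift_op power_mult_distrib
    by (rule shift_infsum_le)
qed (simp add: M)

lemma bounded_clinear_shift_op:
  assumes lin: "\<And>x. clinear (A x)"
  shows "bounded_clinear (shift_op z A)"
  by (rule bounded_clinearI[of _ M])
    (auto intro!: l2_eqI norm_shift_op_le simp: l2_fun_shift_op clinearD[OF lin])

end

section \<open>Twisted shifts and their algebra\<close>

text \<open>The boxes filter the lattice: sums from boxes n and k lie in box n + k, negation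
  preserves each box, and the cardinality is polynomial in n. These properties control the supports
  of products, adjoints and powers.\<close>

definition lattice_box :: "nat \<Rightarrow> (int, 'm::finite) vec set" where
  "lattice_box n = {x. \<forall>j. \<bar>x $ j\<bar> \<le> int n}"

lemma lattice_box_subset_PiE: "vec_nth ` lattice_box n \<subseteq> UNIV \<rightarrow>\<^sub>E {- int n..int n}"
  by (auto simp: lattice_box_def abs_le_iff PiE_iff minus_le_iff)

lemma inj_vec_nth: "inj vec_nth"
  by (rule injI) (simp add: vec_nth_inject)

lemma finite_lattice_box [simp]: "finite (lattice_box n :: (int, 'm::finite) vec set)"
proof (rule finite_imageD)
  show "finite (vec_nth ` (lattice_box n :: (int, 'm) vec set))"
    by (rule finite_subset[OF lattice_box_subset_PiE]) (auto intro: finite_PiE)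
  show "inj_on vec_nth (lattice_box n :: (int, 'm) vec set)" by (rule inj_on_subset[OF inj_vec_nth]) simp
qed

lemma card_lattice_box_le: "card (lattice_box n :: (int, 'm::finite) vec set) \<le> (2 * n + 1) ^ CARD('m)"
proof -
  have "card (lattice_box n :: (int, 'm) vec set) = card (vec_nth ` (lattice_box n :: (int, 'm) vec set))"
    by (rule card_image[symmetric], rule inj_on_subset[OF inj_vec_nth]) simp
  also have "\<dots> \<le> card ((UNIV :: 'm set) \<rightarrow>\<^sub>E {- int n..int n})"
    by (rule card_mono[OF _ lattice_box_subset_PiE]) (auto intro: finite_PiE)
  also have "\<dots> = (2 * n + 1) ^ CARD('m)" by (simp add: card_PiE nat_add_distrib nat_mult_distrib)
  finally show ?thesis .
qed

lemma lattice_box_add: "x \<in> lattice_box n \<Longrightarrow> y \<in> lattice_box k \<Longrightarrow> x + y \<in> lattice_box (n + k)"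
  unfolding lattice_box_def by (auto intro: order_trans[OF abs_triangle_ineq add_mono])

lemma lattice_box_uminus: "- x \<in> lattice_box n \<longleftrightarrow> x \<in> lattice_box n"
  by (simp add: lattice_box_def)

lemma lattice_box_mono: "n \<le> k \<Longrightarrow> lattice_box n \<subseteq> lattice_box k"
  unfolding lattice_box_def by (auto intro: order_trans)

lemma finite_subset_lattice_box:
  assumes "finite X" obtains n where "X \<subseteq> (lattice_box n :: (int, 'm::finite) vec set)"
proof -
  have "\<exists>n. X \<subseteq> (lattice_box n :: (int, 'm) vec set)"
    using assms
  proof (induction X rule: finite_induct)
    case (insert x X)
    then obtain n where n: "X \<subseteq> (lattice_box n :: (int, 'm) vec set)" by blast
    have "\<bar>x $ j\<bar> \<le> int (\<Sum>j\<in>UNIV. nat \<bar>x $ j\<bar>)" for j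
      using member_le_sum[of j UNIV "\<lambda>j. \<bar>x $ j\<bar>"] by simp
    then have "x \<in> lattice_box (\<Sum>j\<in>UNIV. nat \<bar>x $ j\<bar>)" unfolding lattice_box_def by blast
    then have "x \<in> lattice_box (n + (\<Sum>j\<in>UNIV. nat \<bar>x $ j\<bar>))" by (rule subsetD[OF lattice_box_mono, rotated]) simp
    moreover have "X \<subseteq> lattice_box (n + (\<Sum>j\<in>UNIV. nat \<bar>x $ j\<bar>))"
      using n by (rule order_trans[OF _ lattice_box_mono]) simp
    ultimately show ?case by (meson insert_subset)
  qed simp
  then show ?thesis using that by blast
qed

text \<open>If Y < X, dividing by X ^ k with k = 2 ^ n sets exponential decay of (Y / X) ^ k against
  a polynomial of degree m. Passing to the m-th root s of Y / X makes the polynomial linear, and k s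
  ^ k tends to 0.\<close>

lemma le_if_powers_le_polynomial:
  fixes X Y :: real
  assumes X: "0 \<le> X" and Y: "0 \<le> Y"
    and le: "\<And>n. X ^ (2 ^ n) \<le> (real (2 * (2 ^ n * d) + 1)) ^ m * Y ^ (2 ^ n)"
  shows "X \<le> Y"
proof (rule ccontr)
  assume "\<not> X \<le> Y"
  then have XY: "Y < X" by simp
  show False
  \<comment> \<open>The root s needs m > 0 and has to be positive; in the excluded cases the
    hypothesis for n = 0 already contradicts Y < X.\<close>
  proof (cases "Y = 0 \<or> m = 0")
    case True
    then show False using le[of 0] XY X by auto
  next
    case False
    define s where "s = root m (Y / X)"
    have s: "0 < s" "s < 1" "s ^ m = Y / X"
      using False XY Y by (simp_all add: s_def real_root_lt_1_iff)
    have "(\<lambda>k. (2 * real d) * (real k * s ^ k) + s ^ k) \<longlonglongrightarrow> (2 * real d) * 0 + 0"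
      using s by (intro tendsto_intros powser_times_n_limit_0 LIMSEQ_power_zero) simp_all
    moreover have "filterlim (\<lambda>n::nat. (2::nat) ^ n) at_top sequentially"
      by (rule filterlim_subseq) (simp add: strict_mono_def)
    ultimately have "(\<lambda>n. (2 * real d) * (real (2 ^ n) * s ^ (2 ^ n)) + s ^ (2 ^ n)) \<longlonglongrightarrow> 0"
      using filterlim_compose[of "\<lambda>k. (2 * real d) * (real k * s ^ k) + s ^ k" _ _ "\<lambda>n::nat. (2::nat) ^ n"]
      by simp
    then have "\<forall>\<^sub>F n in sequentially. (2 * real d) * (real (2 ^ n) * s ^ (2 ^ n)) + s ^ (2 ^ n) < 1"
      by (rule order_tendstoD) simp
    then obtain n where n: "(2 * real d) * (real (2 ^ n) * s ^ (2 ^ n)) + s ^ (2 ^ n) < 1"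
      using eventually_happens by fastforce
    let ?k = "2 ^ n :: nat"
    have "real (2 * (?k * d) + 1) * s ^ ?k < 1"
      using n by (simp add: algebra_simps)
    then have "(real (2 * (?k * d) + 1) * s ^ ?k) ^ m < 1"
      using False s by (intro power_less_one_iff[THEN iffD2]) auto
    moreover have "(s ^ ?k) ^ m = (Y / X) ^ ?k" by (metis s(3) power_mult mult.commute)
    ultimately have "real (2 * (?k * d) + 1) ^ m * (Y ^ ?k / X ^ ?k) < 1"
      by (simp only: power_mult_distrib power_divide)
    then have "real (2 * (?k * d) + 1) ^ m * Y ^ ?k < X ^ ?k"
      using XY Y by (simp add: field_simps)
    then show False using le[of n] by simp
  qed
qed

text \<open>A projective unitary family indexed by the lattice. It abstracts the monomials, with
  their phases gathered in c.\<close>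

locale twisted_torus =
  fixes u :: "(int, 'm::finite) vec \<Rightarrow> 'a::unital_cstar_algebra"
    and c :: "(int, 'm) vec \<Rightarrow> (int, 'm) vec \<Rightarrow> complex"
  assumes unitary_u: "unitary (u x)" and u_zero: "u 0 = 1"
    and u_mult: "u x * u y = c x y *\<^sub>C u (x + y)" and norm_c: "cmod (c x y) = 1"
begin

lemma cnj_c_mult [simp]: "cnj (c x y) * c x y = 1"
  using complex_norm_square[of "c x y"] by (simp add: norm_c mult.commute)

lemma norm_u [simp]: "norm (u x) = 1"
  using unitary_u[of x] by (intro norm_unitary) (simp add: unitary_def)

lemma scaleC_u_cancel: "d *\<^sub>C u x = e *\<^sub>C u x \<longleftrightarrow> d = e"
proof -
  have "u x \<noteq> 0" using norm_u[of x] by (metis norm_zero zero_neq_one)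
  then show ?thesis by simp
qed

text \<open>Associativity of a product of three unitaries, compared coefficientwise. This 2-cocycle
  identity is what makes the twisted shifts multiply with the same phases as the unitaries.\<close>

lemma c_cocycle: "c x y * c (x + y) z = c y z * c x (y + z)"
proof -
  have "(c x y * c (x + y) z) *\<^sub>C u (x + y + z) = (u x * u y) * u z"
    by (simp add: u_mult scaleC_mult_left scaleC_scaleC)
  also have "(u x * u y) * u z = u x * (u y * u z)" by (rule mult.assoc)
  also have "\<dots> = (c y z * c x (y + z)) *\<^sub>C u (x + y + z)"
    by (simp add: u_mult scaleC_mult_right scaleC_scaleC add.assoc)
  finally show ?thesis by (simp only: scaleC_u_cancel)
qed

lemma c_zero [simp]: "c 0 x = 1" "c x 0 = 1"
  using u_mult[of 0 x] u_mult[of x 0] scaleC_u_cancel[of 1 x] by (simp_all add: u_zero)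

lemma star_u: "star (u x) = cnj (c x (- x)) *\<^sub>C u (- x)"
proof -
  have "u x * u (- x) = c x (- x) *\<^sub>C 1" by (simp add: u_mult u_zero)
  then have "star (u x) * (u x * u (- x)) = c x (- x) *\<^sub>C star (u x)"
    by (simp add: scaleC_mult_right)
  then have "u (- x) = c x (- x) *\<^sub>C star (u x)" using unitaryD[OF unitary_u] by simp
  then show ?thesis by (simp add: scaleC_scaleC)
qed

text \<open>Left multiplication by \<open>u z\<close> in the basis of monomials: the vector at x
  comes from u z * u (x - z), which carries the phase c z (x - z).\<close>

definition W :: "(int, 'm) vec \<Rightarrow> ((int, 'm) vec, 's::chilbert_space) l2 \<Rightarrow> ((int, 'm) vec, 's) l2" where
  "W z = shift_op z (\<lambda>x. scaleC (c z (x - z)))"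

lemma norm_scaleC_c: "norm (c z y *\<^sub>C v) = norm v" for v :: "'b::complex_normed_vector"
  by (simp add: norm_scaleC norm_c)

lemma l2_fun_W: "l2_fun (W z \<psi>) x = c z (x - z) *\<^sub>C l2_fun \<psi> (x - z)"
  unfolding W_def by (rule l2_fun_shift_op[of 1]) (simp_all add: norm_scaleC_c)

lemma bounded_clinear_W: "bounded_clinear (W z)"
  unfolding W_def
  by (rule bounded_clinear_shift_op[of 1])
    (simp_all add: norm_scaleC_c complex_vector.linear_scale_self)

lemma norm_W_le: "norm (W z \<psi>) \<le> norm \<psi>"
  unfolding W_def
  using norm_shift_op_le[of 1 "\<lambda>x. scaleC (c z (x - z))" z \<psi>] by (simp add: norm_scaleC_c)

lemma W_mult: "W x (W y \<psi>) = c x y *\<^sub>C W (x + y) \<psi>"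
proof (rule l2_eqI)
  fix w
  have "c x y * c (x + y) (w - x - y) = c y (w - x - y) * c x (w - x)"
    using c_cocycle[of x y "w - x - y"] by simp
  then show "l2_fun (W x (W y \<psi>)) w = l2_fun (c x y *\<^sub>C W (x + y) \<psi>) w"
    by (simp add: l2_fun_W scaleC_scaleC diff_diff_eq mult.commute)
qed

lemma W_zero [simp]: "W 0 \<psi> = \<psi>"
  by (rule l2_eqI) (simp add: l2_fun_W)

lemma W_delta: "W z (l2_delta x \<xi>) = c z x *\<^sub>C l2_delta (z + x) \<xi>"
  by (rule l2_eqI) (auto simp: l2_fun_W l2_fun_tensor_delta algebra_simps)

lemma cinner_W_W: "cinner (W z \<phi>) (W z \<psi>) = cinner \<phi> \<psi>"
  for \<phi> \<psi> :: "((int, 'm) vec, 's::chilbert_space) l2"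
proof -
  have iso: "cinner (c x y *\<^sub>C v) (c x y *\<^sub>C w) = cinner v w" for x y and v w :: 's
  proof -
    have "cinner (c x y *\<^sub>C v) (c x y *\<^sub>C w) = (cnj (c x y) * c x y) * cinner v w"
      by (simp only: cinner_scaleC_left cinner_scaleC_right mult_ac)
    then show ?thesis by simp
  qed
  have "cinner (W z \<phi>) (W z \<psi>) = (\<Sum>\<^sub>\<infinity>x. cinner (l2_fun \<phi> (x - z)) (l2_fun \<psi> (x - z)))"
    unfolding cinner_l2_def l2_fun_W iso ..
  also have "\<dots> = cinner \<phi> \<psi>"
    unfolding cinner_l2_def
    by (rule infsum_reindex_bij_betw[OF bij_diff[of z], of "\<lambda>x. cinner (l2_fun \<phi> x) (l2_fun \<psi> x)"])
  finally show ?thesis .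
qed

text \<open>\<open>W x\<close> preserves inner products and sends the second argument on the left
  back to \<psi>. The scalar is the one of \<open>star_u\<close>, so adjoints of shifts match
  adjoints of unitaries.\<close>

lemma cinner_W_right: "cinner \<phi> (cnj (c x (- x)) *\<^sub>C W (- x) \<psi>) = cinner (W x \<phi>) \<psi>"
proof -
  have "W x (cnj (c x (- x)) *\<^sub>C W (- x) \<psi>) = \<psi>"
    by (simp add: bounded_clinearD[OF bounded_clinear_W] W_mult scaleC_scaleC)
  then show ?thesis using cinner_W_W[of x \<phi> "cnj (c x (- x)) *\<^sub>C W (- x) \<psi>"] by simp
qed

text \<open>A relation rather than a map, because without a lower bound on the norm the element a
  need not determine its coefficients. The box size n is recorded since the norm comparison depends
  on it.\<close>

definition poly_pair ::
    "nat \<Rightarrow> 'a \<Rightarrow> (((int, 'm) vec, 's::chilbert_space) l2 \<Rightarrow>\<^sub>L ((int, 'm) vec, 's) l2) \<Rightarrow> bool" where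
  "poly_pair n a T \<longleftrightarrow> (\<exists>p. a = (\<Sum>x\<in>lattice_box n. p x *\<^sub>C u x) \<and>
    (\<forall>\<psi>. blinfun_apply T \<psi> = (\<Sum>x\<in>lattice_box n. p x *\<^sub>C W x \<psi>)))"

lemma bounded_linear_sum_W: "bounded_linear (\<lambda>\<psi>. \<Sum>x\<in>X. p x *\<^sub>C W x \<psi>)"
  by (intro bounded_linear_sum bounded_linear_compose[OF bounded_linear_scaleC]
      bounded_clinearD(1)[OF bounded_clinear_W])

lemma poly_pairI: "poly_pair n (\<Sum>x\<in>lattice_box n. p x *\<^sub>C u x) (Blinfun (\<lambda>\<psi>. \<Sum>x\<in>lattice_box n. p x *\<^sub>C W x \<psi>))"
  unfolding poly_pair_def
  by (intro exI[of _ p] conjI refl allI) (simp add: bounded_linear_Blinfun_apply bounded_linear_sum_W)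

lemma poly_pair_add: "poly_pair n a T \<Longrightarrow> poly_pair n b S \<Longrightarrow> poly_pair n (a + b) (T + S)"
  unfolding poly_pair_def
  by (elim exE conjE, rule_tac x = "\<lambda>x. p x + pa x" in exI)
    (simp add: scaleC_add_left sum.distrib blinfun.add_left)

lemma poly_pair_scale:
  assumes "poly_pair n a T" "\<And>\<psi>. blinfun_apply S \<psi> = d *\<^sub>C blinfun_apply T \<psi>"
  shows "poly_pair n (d *\<^sub>C a) S"
proof -
  obtain p where "a = (\<Sum>x\<in>lattice_box n. p x *\<^sub>C u x)"
    "\<And>\<psi>. blinfun_apply T \<psi> = (\<Sum>x\<in>lattice_box n. p x *\<^sub>C W x \<psi>)"
    using assms(1) by (auto simp: poly_pair_def)
  then show ?thesis
    unfolding poly_pair_def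
    by (intro exI[of _ "\<lambda>x. d * p x"]) (simp add: assms(2) complex_vector.scale_sum_right scaleC_scaleC)
qed

lemma poly_pair_mono:
  fixes T :: "((int, 'm) vec, 's::chilbert_space) l2 \<Rightarrow>\<^sub>L ((int, 'm) vec, 's) l2"
  assumes "poly_pair n a T" "n \<le> k" shows "poly_pair k a T"
proof -
  obtain p where p: "a = (\<Sum>x\<in>lattice_box n. p x *\<^sub>C u x)"
    "\<And>\<psi>. blinfun_apply T \<psi> = (\<Sum>x\<in>lattice_box n. p x *\<^sub>C W x \<psi>)"
    using assms(1) by (auto simp: poly_pair_def)
  have ext: "(\<Sum>x\<in>lattice_box n. p x *\<^sub>C f x) = (\<Sum>x\<in>lattice_box k. (if x \<in> lattice_box n then p x else 0) *\<^sub>C f x)"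
    for f :: "_ \<Rightarrow> 'v::complex_vector"
    by (rule sum.mono_neutral_cong_left) (use lattice_box_mono[OF assms(2)] in auto)
  show ?thesis
    unfolding poly_pair_def p ext
    by (intro exI[of _ "\<lambda>x. if x \<in> lattice_box n then p x else 0"] conjI allI refl)
qed

text \<open>\<open>r\<close> is the twisted convolution of p and q. With an arbitrary family f, the
  same coefficients describe the product of the algebra elements and the composition of the
  operators.\<close>

lemma sum_twisted_convolution:
  fixes f :: "(int, 'm) vec \<Rightarrow> 'b::complex_vector" and p q :: "(int, 'm) vec \<Rightarrow> complex" and n k :: nat
  defines "r \<equiv> \<lambda>z. \<Sum>x\<in>lattice_box n. if z - x \<in> lattice_box k then p x * q (z - x) * c x (z - x) else 0"
  shows "(\<Sum>z\<in>lattice_box (n + k). r z *\<^sub>C f z) =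
    (\<Sum>x\<in>lattice_box n. \<Sum>y\<in>lattice_box k. (p x * q y * c x y) *\<^sub>C f (x + y))"
proof -
  have "(\<Sum>z\<in>lattice_box (n + k). r z *\<^sub>C f z) = (\<Sum>z\<in>lattice_box (n + k). \<Sum>x\<in>lattice_box n.
      (if z - x \<in> lattice_box k then p x * q (z - x) * c x (z - x) else 0) *\<^sub>C f z)"
    unfolding r_def complex_vector.scale_sum_left ..
  also have "\<dots> = (\<Sum>x\<in>lattice_box n. \<Sum>z\<in>lattice_box (n + k).
      (if z - x \<in> lattice_box k then p x * q (z - x) * c x (z - x) else 0) *\<^sub>C f z)"
    by (rule sum.swap)
  also have "\<dots> = (\<Sum>x\<in>lattice_box n. \<Sum>y\<in>lattice_box k. (p x * q y * c x y) *\<^sub>C f (x + y))"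
  proof (rule sum.cong[OF refl])
    fix x :: "(int, 'm) vec" assume x: "x \<in> lattice_box n"
    have "(\<Sum>y\<in>lattice_box k. (p x * q y * c x y) *\<^sub>C f (x + y)) =
        (\<Sum>z\<in>(+) x ` lattice_box k. (p x * q (z - x) * c x (z - x)) *\<^sub>C f z)"
      by (subst sum.reindex) simp_all
    also have "\<dots> = (\<Sum>z\<in>lattice_box (n + k).
        (if z - x \<in> lattice_box k then p x * q (z - x) * c x (z - x) else 0) *\<^sub>C f z)"
    proof (rule sum.mono_neutral_cong_left)
      show "(+) x ` lattice_box k \<subseteq> lattice_box (n + k)" using x by (auto intro: lattice_box_add)
      have "z \<in> (+) x ` lattice_box k" if "z - x \<in> lattice_box k" for z
        using that by (intro image_eqI[of _ _ "z - x"]) simp_all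
      then show "\<forall>z\<in>lattice_box (n + k) - (+) x ` lattice_box k.
          (if z - x \<in> lattice_box k then p x * q (z - x) * c x (z - x) else 0) *\<^sub>C f z = 0" by auto
    qed auto
    finally show "(\<Sum>z\<in>lattice_box (n + k). (if z - x \<in> lattice_box k then p x * q (z - x) * c x (z - x) else 0) *\<^sub>C f z) =
        (\<Sum>y\<in>lattice_box k. (p x * q y * c x y) *\<^sub>C f (x + y))" ..
  qed
  finally show ?thesis .
qed

lemma poly_pair_mult:
  fixes T S :: "((int, 'm) vec, 's::chilbert_space) l2 \<Rightarrow>\<^sub>L ((int, 'm) vec, 's) l2"
  assumes "poly_pair n a T" "poly_pair k b S"
  shows "poly_pair (n + k) (a * b) (T o\<^sub>L S)"
proof -
  obtain p where p: "a = (\<Sum>x\<in>lattice_box n. p x *\<^sub>C u x)"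
    "\<And>\<psi>. blinfun_apply T \<psi> = (\<Sum>x\<in>lattice_box n. p x *\<^sub>C W x \<psi>)"
    using assms(1) by (auto simp: poly_pair_def)
  obtain q where q: "b = (\<Sum>x\<in>lattice_box k. q x *\<^sub>C u x)"
    "\<And>\<psi>. blinfun_apply S \<psi> = (\<Sum>x\<in>lattice_box k. q x *\<^sub>C W x \<psi>)"
    using assms(2) by (auto simp: poly_pair_def)
  have W: "W x (\<Sum>y\<in>lattice_box k. q y *\<^sub>C W y \<psi>) = (\<Sum>y\<in>lattice_box k. (q y * c x y) *\<^sub>C W (x + y) \<psi>)"
    for x and \<psi> :: "((int, 'm) vec, 's) l2"
    by (simp add: linear_sum[OF bounded_linear.linear[OF bounded_clinearD(1)[OF bounded_clinear_W]]]
        bounded_clinearD[OF bounded_clinear_W] W_mult scaleC_scaleC)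
  show ?thesis
    unfolding poly_pair_def
  proof (intro exI conjI allI)
    show "a * b = (\<Sum>z\<in>lattice_box (n + k).
        (\<Sum>x\<in>lattice_box n. if z - x \<in> lattice_box k then p x * q (z - x) * c x (z - x) else 0) *\<^sub>C u z)"
      unfolding sum_twisted_convolution p q sum_product
      by (intro sum.cong refl) (simp add: scaleC_mult_scaleC u_mult scaleC_scaleC)
    show "blinfun_apply (T o\<^sub>L S) \<psi> = (\<Sum>z\<in>lattice_box (n + k).
        (\<Sum>x\<in>lattice_box n. if z - x \<in> lattice_box k then p x * q (z - x) * c x (z - x) else 0) *\<^sub>C W z \<psi>)" for \<psi>
      unfolding sum_twisted_convolution[where f = "\<lambda>z. W z \<psi>"] blinfun_apply_blinfun_compose p q W
      by (simp add: complex_vector.scale_sum_right scaleC_scaleC mult.assoc)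
  qed
qed

lemma poly_pair_adjoint:
  fixes T :: "((int, 'm) vec, 's::chilbert_space) l2 \<Rightarrow>\<^sub>L ((int, 'm) vec, 's) l2"
  assumes "poly_pair n a T"
  obtains S where "poly_pair n (star a) S"
    "\<And>\<phi> \<psi> :: ((int, 'm) vec, 's) l2. cinner \<phi> (blinfun_apply S \<psi>) = cinner (blinfun_apply T \<phi>) \<psi>"
proof -
  obtain p where p: "a = (\<Sum>x\<in>lattice_box n. p x *\<^sub>C u x)"
    "\<And>\<psi>. blinfun_apply T \<psi> = (\<Sum>x\<in>lattice_box n. p x *\<^sub>C W x \<psi>)"
    using assms(1) by (auto simp: poly_pair_def)
  \<comment> \<open>The coefficient of u x in the adjoint: it comes from the term at - x, whose
    adjoint contributes the phase of \<open>star_u\<close>.\<close>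
  define q where "q x = cnj (p (- x)) * cnj (c (- x) x)" for x
  have neg: "(\<Sum>x\<in>lattice_box n. f (- x)) = (\<Sum>x\<in>lattice_box n. f x)" for f :: "_ \<Rightarrow> 'v::comm_monoid_add"
    by (rule sum.reindex_bij_witness[of _ uminus uminus]) (simp_all add: lattice_box_uminus)
  define S :: "((int, 'm) vec, 's) l2 \<Rightarrow>\<^sub>L ((int, 'm) vec, 's) l2"
    where "S = Blinfun (\<lambda>\<psi>. \<Sum>x\<in>lattice_box n. q x *\<^sub>C W x \<psi>)"
  have "star (\<Sum>x\<in>X. f x) = (\<Sum>x\<in>X. star (f x))" for f :: "_ \<Rightarrow> 'a" and X :: "(int, 'm) vec set"
    by (induction X rule: infinite_finite_induct) (simp_all add: star_add)
  then have "star a = (\<Sum>x\<in>lattice_box n. q (- x) *\<^sub>C u (- x))"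
    by (simp add: p q_def star_scaleC star_u scaleC_scaleC)
  then have a: "star a = (\<Sum>x\<in>lattice_box n. q x *\<^sub>C u x)" using neg[of "\<lambda>x. q x *\<^sub>C u x"] by simp
  have S: "blinfun_apply S \<psi> = (\<Sum>x\<in>lattice_box n. q (- x) *\<^sub>C W (- x) \<psi>)" for \<psi>
    using neg[of "\<lambda>x. q x *\<^sub>C W x \<psi>"]
    by (simp add: S_def bounded_linear_Blinfun_apply bounded_linear_sum_W)
  have sr: "cinner \<phi> (\<Sum>x\<in>X. f x) = (\<Sum>x\<in>X. cinner \<phi> (f x))"
    and sl: "cinner (\<Sum>x\<in>X. f x) \<phi> = (\<Sum>x\<in>X. cinner (f x) \<phi>)"
    for \<phi> :: "((int, 'm) vec, 's) l2" and f and X :: "(int, 'm) vec set"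
    by (induction X rule: infinite_finite_induct) (simp_all add: cinner_add_right cinner_add_left)
  show ?thesis
  proof (rule that[of S])
    show "poly_pair n (star a) S" unfolding a S_def by (rule poly_pairI)
    fix \<phi> \<psi> :: "((int, 'm) vec, 's) l2"
    have "cinner \<phi> (q (- x) *\<^sub>C W (- x) \<psi>) = cinner (p x *\<^sub>C W x \<phi>) \<psi>" for x
      using cinner_W_right[of \<phi> x \<psi>]
      by (simp add: q_def cinner_scaleC_left cinner_scaleC_right mult.assoc)
    then show "cinner \<phi> (blinfun_apply S \<psi>) = cinner (blinfun_apply T \<phi>) \<psi>"
      unfolding S p sr sl by simp
  qed
qed

lemma poly_pair_W: assumes "x \<in> lattice_box n" shows "poly_pair n (u x) (Blinfun (W x))"
proof -
  have single: "(\<Sum>y\<in>lattice_box n. (if y = x then 1 else 0) *\<^sub>C f y) = f x" for f :: "_ \<Rightarrow> 'v::complex_vector"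
    using assms by (simp add: if_distrib[of "\<lambda>d. d *\<^sub>C _"] cong: if_cong)
  show ?thesis
    unfolding poly_pair_def
    by (rule exI[of _ "\<lambda>y. if y = x then 1 else 0"])
      (simp add: single bounded_linear_Blinfun_apply bounded_clinearD(1)[OF bounded_clinear_W])
qed

end

section \<open>The left regular representation\<close>

type_synonym ('m, 's) l2_blinfun = "((int, 'm) vec, 's) l2 \<Rightarrow>\<^sub>L ((int, 'm) vec, 's) l2"

lemma ex_unit_vector: "\<exists>e :: 's::{chilbert_space, euclidean_space}. norm e = 1"
  using norm_Basis nonempty_Basis by blast

text \<open>Cauchy-Schwarz applied to the inner product of \<psi> with S (T \<psi>), which equals
  the square of norm (T \<psi>). It is the nontrivial half of the C*-identity for operators, with
  the adjoint given explicitly.\<close>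

lemma blinfun_cstar_le:
  fixes S T :: "'h::complex_inner \<Rightarrow>\<^sub>L 'h"
  assumes adj: "\<And>\<phi> \<psi>. cinner \<phi> (blinfun_apply S \<psi>) = cinner (blinfun_apply T \<phi>) \<psi>"
  shows "(norm T)\<^sup>2 \<le> norm (S o\<^sub>L T)"
proof -
  have "norm T \<le> sqrt (norm (S o\<^sub>L T))"
  proof (rule norm_blinfun_bound)
    fix \<psi>
    have "complex_of_real ((norm (T \<psi>))\<^sup>2) = cinner \<psi> (S (T \<psi>))"
      by (simp only: cinner_self[symmetric] adj)
    then have "(norm (T \<psi>))\<^sup>2 = cmod (cinner \<psi> ((S o\<^sub>L T) \<psi>))"
      by (metis abs_of_nonneg blinfun_apply_blinfun_compose norm_of_real zero_le_power2)
    also have "\<dots> \<le> norm \<psi> * norm ((S o\<^sub>L T) \<psi>)" by (rule cinner_Cauchy_Schwarz)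
    also have "\<dots> \<le> norm \<psi> * (norm (S o\<^sub>L T) * norm \<psi>)"
      by (intro mult_left_mono norm_blinfun) simp
    also have "\<dots> = (sqrt (norm (S o\<^sub>L T)) * norm \<psi>)\<^sup>2" by (simp add: power2_eq_square)
    finally show "norm (T \<psi>) \<le> sqrt (norm (S o\<^sub>L T)) * norm \<psi>"
      by (rule power2_le_imp_le) simp
  qed simp
  then show ?thesis by (metis norm_ge_zero power_mono real_sqrt_pow2)
qed

text \<open>The two facts through which universality and generation enter. The lower bound makes the
  unitaries linearly independent, so a polynomial now determines its coefficients.\<close>

locale free_twisted_torus = twisted_torus u c
  for u :: "(int, 'm::finite) vec \<Rightarrow> 'a::unital_cstar_algebra" and c +
  assumes coefficient_le: "finite X \<Longrightarrow> z \<in> X \<Longrightarrow> cmod (p z) \<le> norm (\<Sum>x\<in>X. p x *\<^sub>C u x)"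
    and dense: "closure {a. \<exists>p X. finite X \<and> a = (\<Sum>x\<in>X. p x *\<^sub>C u x)} = UNIV"
begin

section \<open>Comparison of the two norms on polynomials\<close>

lemma norm_sum_lattice_box_le:
  fixes f :: "(int, 'm) vec \<Rightarrow> 'v::complex_normed_vector"
  assumes p: "\<And>x. x \<in> lattice_box n \<Longrightarrow> cmod (p x) \<le> B" and f: "\<And>x. norm (f x) \<le> V" and B: "0 \<le> B"
  shows "norm (\<Sum>x\<in>lattice_box n. p x *\<^sub>C f x) \<le> real (2 * n + 1) ^ CARD('m) * B * V"
proof -
  have V: "0 \<le> V" using f norm_ge_zero order_trans by blast
  have "norm (\<Sum>x\<in>lattice_box n. p x *\<^sub>C f x) \<le> of_nat (card (lattice_box n :: (int, 'm) vec set)) * (B * V)"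
    by (rule order_trans[OF norm_sum sum_bounded_above])
      (auto simp: norm_scaleC intro!: mult_mono p f B)
  also have "\<dots> \<le> real (2 * n + 1) ^ CARD('m) * (B * V)"
    using card_lattice_box_le[of n, where 'm = 'm] B V
    by (intro mult_right_mono) (simp_all only: of_nat_power[symmetric] of_nat_le_iff mult_nonneg_nonneg)
  finally show ?thesis by (simp add: mult.assoc)
qed

lemma poly_pair_norm_bounds:
  fixes T :: "('m, 's::{chilbert_space, euclidean_space}) l2_blinfun"
  assumes "poly_pair n a T"
  shows "norm T \<le> real (2 * n + 1) ^ CARD('m) * norm a" "norm a \<le> real (2 * n + 1) ^ CARD('m) * norm T"
proof -
  obtain p where p: "a = (\<Sum>x\<in>lattice_box n. p x *\<^sub>C u x)"
    "\<And>\<psi>. blinfun_apply T \<psi> = (\<Sum>x\<in>lattice_box n. p x *\<^sub>C W x \<psi>)"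
    using assms(1) by (auto simp: poly_pair_def)
  show "norm T \<le> real (2 * n + 1) ^ CARD('m) * norm a"
  proof (rule norm_blinfun_bound)
    show "norm (T \<psi>) \<le> real (2 * n + 1) ^ CARD('m) * norm a * norm \<psi>" for \<psi>
      unfolding p(2) by (rule norm_sum_lattice_box_le) (auto simp: p(1) norm_W_le intro: coefficient_le)
  qed simp
  obtain e :: 's where e: "norm e = 1" using ex_unit_vector by blast
  have "cmod (p z) \<le> norm T" if z: "z \<in> lattice_box n" for z
  proof -
    \<comment> \<open>Since c x 0 = 1, applying T to a unit vector at the origin displays the
      coefficients of the polynomial as coordinates.\<close>
    have "l2_fun (T (l2_delta 0 e)) z = (\<Sum>x\<in>lattice_box n. (if x = z then p x *\<^sub>C e else 0))"
      unfolding p(2) l2_fun_sum by (intro sum.cong) (auto simp: W_delta l2_fun_tensor_delta)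
    also have "\<dots> = p z *\<^sub>C e" using z by simp
    finally have "cmod (p z) = norm (l2_fun (T (l2_delta 0 e)) z)" by (simp add: norm_scaleC e)
    also have "\<dots> \<le> norm (T (l2_delta 0 e))" by (rule norm_l2_fun_le)
    also have "\<dots> \<le> norm T * norm (l2_delta (0::(int, 'm) vec) e)" by (rule norm_blinfun)
    finally show ?thesis by (simp add: e)
  qed
  then show "norm a \<le> real (2 * n + 1) ^ CARD('m) * norm T"
    using norm_sum_lattice_box_le[of n p "norm T" u 1] by (simp add: p(1))
qed

text \<open>Exponents are powers of two because repeated squaring of a selfadjoint element keeps the
  norm exact by the C*-identity. Each squaring doubles the box.\<close>

lemma selfadjoint_poly_pair_dyadic_power:
  fixes T :: "('m, 's::{chilbert_space, euclidean_space}) l2_blinfun"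
  assumes pp: "poly_pair d h T" and h: "star h = h"
    and T: "\<And>\<phi> \<psi>. cinner \<phi> (blinfun_apply T \<psi>) = cinner (blinfun_apply T \<phi>) \<psi>"
  shows "\<exists>S :: ('m, 's) l2_blinfun. poly_pair (2 ^ n * d) (h ^ 2 ^ n) S \<and>
    (\<forall>\<phi> \<psi>. cinner \<phi> (blinfun_apply S \<psi>) = cinner (blinfun_apply S \<phi>) \<psi>) \<and>
    norm S = norm T ^ 2 ^ n \<and> norm (h ^ 2 ^ n) = norm h ^ 2 ^ n"
proof (induction n)
  case 0
  show ?case by (intro exI[of _ T]) (simp add: pp T)
next
  case (Suc n)
  then obtain S :: "('m, 's) l2_blinfun" where S: "poly_pair (2 ^ n * d) (h ^ 2 ^ n) S"
    "\<And>\<phi> \<psi>. cinner \<phi> (blinfun_apply S \<psi>) = cinner (blinfun_apply S \<phi>) \<psi>"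
    "norm S = norm T ^ 2 ^ n" "norm (h ^ 2 ^ n) = norm h ^ 2 ^ n" by blast
  have p: "x ^ 2 ^ Suc n = x ^ 2 ^ n * x ^ 2 ^ n" for x :: "'c::monoid_mult"
    by (simp add: power_add[symmetric] mult_2)
  have "norm (S o\<^sub>L S) = norm S * norm S"
    using blinfun_cstar_le[of S S] S(2) norm_blinfun_compose[of S S] by (simp add: power2_eq_square)
  moreover have "norm (h ^ 2 ^ n * h ^ 2 ^ n) = norm (h ^ 2 ^ n) * norm (h ^ 2 ^ n)"
    using cstar_identity[of "h ^ 2 ^ n"] by (simp add: star_power h power2_eq_square)
  moreover have "poly_pair (2 ^ Suc n * d) (h ^ 2 ^ Suc n) (S o\<^sub>L S)"
    unfolding p[of h] using poly_pair_mult[OF S(1) S(1)] by (simp add: mult_2 distrib_right)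
  ultimately show ?case
    unfolding p[of h] p[of "norm T"] p[of "norm h"]
    by (intro exI[of _ "S o\<^sub>L S"]) (simp add: S p)
qed

text \<open>Powers of a polynomial have polynomially growing support, so the two norms of \<open>h ^ 2 ^ n\<close>
  differ by at most a factor whose \<open>2 ^ n\<close>-th root tends to one.\<close>

lemma selfadjoint_poly_pair_isometric:
  fixes T :: "('m, 's::{chilbert_space, euclidean_space}) l2_blinfun"
  assumes pp: "poly_pair d h T" and h: "star h = h"
    and T: "\<And>\<phi> \<psi>. cinner \<phi> (blinfun_apply T \<psi>) = cinner (blinfun_apply T \<phi>) \<psi>"
  shows "norm T = norm h"
proof -
  have *: "norm T ^ 2 ^ n \<le> real (2 * (2 ^ n * d) + 1) ^ CARD('m) * norm h ^ 2 ^ n \<and>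
      norm h ^ 2 ^ n \<le> real (2 * (2 ^ n * d) + 1) ^ CARD('m) * norm T ^ 2 ^ n" for n
    using selfadjoint_poly_pair_dyadic_power[OF pp h T, of n] poly_pair_norm_bounds by metis
  show ?thesis
    by (rule antisym; rule le_if_powers_le_polynomial[OF norm_ge_zero norm_ge_zero])
      (rule conjunct1[OF *], rule conjunct2[OF *])
qed

lemma poly_pair_isometric:
  fixes T :: "('m, 's::{chilbert_space, euclidean_space}) l2_blinfun"
  assumes pp: "poly_pair n a T"
  shows "norm T = norm a"
proof -
  have *: "norm R \<le> norm b \<and> (norm b)\<^sup>2 \<le> norm S * norm R"
    if R: "poly_pair n b R" and S: "poly_pair n (star b) S"
      "\<And>\<phi> \<psi>. cinner \<phi> (blinfun_apply S \<psi>) = cinner (blinfun_apply R \<phi>) \<psi>"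
    for b and R S :: "('m, 's) l2_blinfun"
  proof -
    have S': "cinner (blinfun_apply S \<phi>) \<psi> = cinner \<phi> (blinfun_apply R \<psi>)" for \<phi> \<psi>
      by (metis S(2) cinner_commute)
    have "norm (S o\<^sub>L R) = norm (star b * b)"
      by (rule selfadjoint_poly_pair_isometric[OF poly_pair_mult[OF S(1) R]])
        (simp_all add: star_mult star_star S S')
    then have eq: "norm (S o\<^sub>L R) = (norm b)\<^sup>2" by (simp add: cstar_identity)
    have "(norm R)\<^sup>2 \<le> (norm b)\<^sup>2" using blinfun_cstar_le[of S R, OF S(2)] eq by simp
    then have "norm R \<le> norm b" by (rule power2_le_imp_le) simp
    then show ?thesis using eq norm_blinfun_compose[of S R] by simp
  qed
  obtain S where S: "poly_pair n (star a) S"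
    "\<And>\<phi> \<psi>. cinner \<phi> (blinfun_apply S \<psi>) = cinner (blinfun_apply T \<phi>) \<psi>"
    using poly_pair_adjoint[OF pp] by blast
  obtain R where R: "poly_pair n (star (star a)) R"
    "\<And>\<phi> \<psi>. cinner \<phi> (blinfun_apply R \<psi>) = cinner (blinfun_apply S \<phi>) \<psi>"
    using poly_pair_adjoint[OF S(1)] by blast
  have le: "norm T \<le> norm a" "(norm a)\<^sup>2 \<le> norm S * norm T" using *[OF pp S] by auto
  have "norm S \<le> norm a" using *[OF S(1) R] by simp
  then have "norm a * norm a \<le> norm a * norm T"
    using le(2) mult_right_mono[of "norm S" "norm a" "norm T"] by (simp add: power2_eq_square)
  then have "norm a \<le> norm T" using norm_ge_zero[of T] by (cases "a = 0") simp_all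
  with le(1) show ?thesis by simp
qed

text \<open>The extension to the whole algebra is obtained by closing this graph. Sums, products and
  scalar multiples are continuous in pairs and so pass to the closure, while isometry makes the
  closure single-valued and total.\<close>

definition poly_graph ::
    "('a \<times> (((int, 'm) vec, 's::{chilbert_space, euclidean_space}) l2 \<Rightarrow>\<^sub>L ((int, 'm) vec, 's) l2)) set" where
  "poly_graph = {(a, T). \<exists>n. poly_pair n a T}"

lemma poly_graph_isometric: "(a, T) \<in> closure poly_graph \<Longrightarrow> norm T = norm a"
proof -
  have "closure poly_graph \<subseteq> {q. norm (snd q) = norm (fst q)}"
    by (rule closure_minimal)
      (auto simp: poly_graph_def poly_pair_isometric intro!: closed_Collect_eq continuous_intros)
  then show "(a, T) \<in> closure poly_graph \<Longrightarrow> norm T = norm a" by auto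
qed

lemma poly_graph_unary:
  assumes f: "continuous_on UNIV f" and q: "q \<in> closure poly_graph"
    and step: "\<And>q. q \<in> poly_graph \<Longrightarrow> f q \<in> poly_graph"
  shows "f q \<in> closure poly_graph"
proof -
  have "f ` closure poly_graph \<subseteq> closure poly_graph"
    by (rule image_closure_subset)
      (use f in \<open>auto intro: continuous_on_subset intro!: subsetD[OF closure_subset] step\<close>)
  then show ?thesis using q by blast
qed

lemma poly_graph_binary:
  assumes f: "continuous_on UNIV f" and q: "q \<in> closure poly_graph" "r \<in> closure poly_graph"
    and step: "\<And>q r. q \<in> poly_graph \<Longrightarrow> r \<in> poly_graph \<Longrightarrow> f (q, r) \<in> poly_graph"
  shows "f (q, r) \<in> closure poly_graph"
proof -
  have "f ` closure (poly_graph \<times> poly_graph) \<subseteq> closure poly_graph"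
    by (rule image_closure_subset)
      (use f in \<open>auto intro: continuous_on_subset intro!: subsetD[OF closure_subset] step\<close>)
  then show ?thesis using q by (auto simp: closure_Times)
qed

lemma poly_graph_add:
  fixes T S :: "('m, 's::{chilbert_space, euclidean_space}) l2_blinfun"
  assumes "(a, T) \<in> closure poly_graph" "(b, S) \<in> closure poly_graph"
  shows "(a + b, T + S) \<in> closure poly_graph"
proof -
  have "(a + b, T + S) \<in> poly_graph" if "(a, T) \<in> poly_graph" "(b, S) \<in> poly_graph"
    for a b and T S :: "('m, 's) l2_blinfun"
  proof -
    from that obtain n k where "poly_pair n a T" "poly_pair k b S" by (auto simp: poly_graph_def)
    then have "poly_pair (max n k) (a + b) (T + S)"
      by (intro poly_pair_add) (auto elim: poly_pair_mono)
    then show ?thesis by (auto simp: poly_graph_def)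
  qed
  then have "(\<lambda>q. (fst (fst q) + fst (snd q), snd (fst q) + snd (snd q))) ((a, T), (b, S)) \<in> closure poly_graph"
    by (intro poly_graph_binary[OF _ assms]) (auto intro!: continuous_intros)
  then show ?thesis by simp
qed

lemma poly_graph_mult:
  fixes T S :: "('m, 's::{chilbert_space, euclidean_space}) l2_blinfun"
  assumes "(a, T) \<in> closure poly_graph" "(b, S) \<in> closure poly_graph"
  shows "(a * b, T o\<^sub>L S) \<in> closure poly_graph"
proof -
  have "(a * b, T o\<^sub>L S) \<in> poly_graph" if "(a, T) \<in> poly_graph" "(b, S) \<in> poly_graph"
    for a b and T S :: "('m, 's) l2_blinfun"
    using that poly_pair_mult unfolding poly_graph_def by blast
  then have "(\<lambda>q. (fst (fst q) * fst (snd q), snd (fst q) o\<^sub>L snd (snd q))) ((a, T), (b, S)) \<in> closure poly_graph"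
    by (intro poly_graph_binary[OF _ assms]) (auto intro!: continuous_intros)
  then show ?thesis by simp
qed

lemma poly_graph_scale:
  fixes T S :: "('m, 's::{chilbert_space, euclidean_space}) l2_blinfun"
  assumes "(a, T) \<in> closure poly_graph" "\<And>\<psi>. blinfun_apply S \<psi> = d *\<^sub>C blinfun_apply T \<psi>"
  shows "(d *\<^sub>C a, S) \<in> closure poly_graph"
proof -
  \<comment> \<open>Complex scaling of operators is written as composition with m, so that its
    continuity in T is that of composition.\<close>
  define m :: "('m, 's) l2_blinfun" where "m = Blinfun (scaleC d)"
  have m: "blinfun_apply m \<psi> = d *\<^sub>C \<psi>" for \<psi>
    by (simp add: m_def bounded_linear_Blinfun_apply bounded_linear_scaleC)
  have "(d *\<^sub>C a, m o\<^sub>L T) \<in> poly_graph" if "(a, T) \<in> poly_graph"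
    for a and T :: "('m, 's) l2_blinfun"
  proof -
    from that obtain n where "poly_pair n a T" by (auto simp: poly_graph_def)
    then have "poly_pair n (d *\<^sub>C a) (m o\<^sub>L T)" by (rule poly_pair_scale) (simp add: m)
    then show ?thesis by (auto simp: poly_graph_def)
  qed
  then have "(\<lambda>q. (d *\<^sub>C fst q, m o\<^sub>L snd q)) (a, T) \<in> closure poly_graph"
    by (intro poly_graph_unary[OF _ assms(1)])
      (auto intro!: continuous_intros bounded_linear.continuous_on[OF bounded_linear_scaleC])
  then have "(d *\<^sub>C a, m o\<^sub>L T) \<in> closure poly_graph" by simp
  moreover have "S = m o\<^sub>L T" by (rule blinfun_eqI) (simp add: m assms(2))
  ultimately show ?thesis by simp
qed

lemma poly_graph_diff:
  fixes T S :: "('m, 's::{chilbert_space, euclidean_space}) l2_blinfun"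
  assumes "(a, T) \<in> closure poly_graph" "(b, S) \<in> closure poly_graph"
  shows "(a - b, T - S) \<in> closure poly_graph"
proof -
  have "((-1) *\<^sub>C b, - S) \<in> closure poly_graph"
    by (rule poly_graph_scale[OF assms(2)]) (simp add: blinfun.minus_left complex_vector.scale_minus_left)
  from poly_graph_add[OF assms(1) this] show ?thesis by (simp add: complex_vector.scale_minus_left)
qed

lemma polynomial_in_graph:
  assumes "finite X"
  obtains T :: "('m, 's::{chilbert_space, euclidean_space}) l2_blinfun" where "((\<Sum>x\<in>X. p x *\<^sub>C u x), T) \<in> poly_graph"
proof -
  obtain n where n: "X \<subseteq> lattice_box n" using finite_subset_lattice_box[OF assms] .
  have eq: "(\<Sum>x\<in>X. p x *\<^sub>C u x) = (\<Sum>x\<in>lattice_box n. (if x \<in> X then p x else 0) *\<^sub>C u x)"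
    by (rule sum.mono_neutral_cong_left) (use n in auto)
  show ?thesis
    by (rule that[of "Blinfun (\<lambda>\<psi>. \<Sum>x\<in>lattice_box n. (if x \<in> X then p x else 0) *\<^sub>C W x \<psi>)"])
      (use poly_pairI[of n "\<lambda>x. if x \<in> X then p x else 0"] in \<open>auto simp: eq poly_graph_def\<close>)
qed

text \<open>Polynomials converging to a form a Cauchy sequence; by isometry so do their operators,
  whose limit is paired with a.\<close>

lemma poly_graph_total: "\<exists>T :: ('m, 's::{chilbert_space, euclidean_space}) l2_blinfun. (a, T) \<in> closure poly_graph"
proof -
  have "a \<in> closure {a. \<exists>p X. finite X \<and> a = (\<Sum>x\<in>X. p x *\<^sub>C u x)}" by (simp add: dense)
  then obtain b where b: "\<And>n. \<exists>p X. finite X \<and> b n = (\<Sum>x\<in>X. p x *\<^sub>C u x)" "b \<longlonglongrightarrow> a"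
    unfolding closure_sequential by blast
  have "\<exists>T :: ('m, 's) l2_blinfun. (b n, T) \<in> poly_graph" for n
    using b(1)[of n] polynomial_in_graph by metis
  then obtain T :: "nat \<Rightarrow> ('m, 's) l2_blinfun" where T: "\<And>n. (b n, T n) \<in> poly_graph" by metis
  have "norm (T m - T n) = norm (b m - b n)" for m n
    by (intro poly_graph_isometric poly_graph_diff subsetD[OF closure_subset T])
  moreover have "Cauchy b" using b(2) by (rule LIMSEQ_imp_Cauchy)
  ultimately have "Cauchy T" by (simp add: Cauchy_def dist_norm)
  then obtain S where "T \<longlonglongrightarrow> S" using Cauchy_convergent convergent_def by blast
  then have "(\<lambda>n. (b n, T n)) \<longlonglongrightarrow> (a, S)" using b(2) by (intro tendsto_Pair)
  then have "(a, S) \<in> closure poly_graph" 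
    unfolding closure_sequential using T by (intro exI[of _ "\<lambda>n. (b n, T n)"]) simp
  then show ?thesis ..
qed

section \<open>The extended representation and its algebraic properties\<close>

definition regular_rep ::
    "'a \<Rightarrow> ((int, 'm) vec, 's::{chilbert_space, euclidean_space}) l2 \<Rightarrow>\<^sub>L ((int, 'm) vec, 's) l2" where
  "regular_rep a = (SOME T. (a, T) \<in> closure poly_graph)"

lemma regular_rep_graph: "(a, regular_rep a) \<in> closure poly_graph"
  unfolding regular_rep_def by (rule someI_ex[OF poly_graph_total])

text \<open>Two operators paired with the same a differ by one paired with 0, which vanishes by
  isometry. Hence the choice in \<open>regular_rep\<close> is no choice, and every identity reduces
  to membership in the closed graph.\<close>

lemma regular_rep_eqI:
  fixes T :: "('m, 's::{chilbert_space, euclidean_space}) l2_blinfun"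
  assumes "(a, T) \<in> closure poly_graph" shows "regular_rep a = T"
  using poly_graph_isometric[OF poly_graph_diff[OF regular_rep_graph[of a] assms]] by simp

lemma norm_regular_rep: "norm (regular_rep a) = norm a"
  by (rule poly_graph_isometric[OF regular_rep_graph])

lemma regular_rep_add: "regular_rep (a + b) = regular_rep a + regular_rep b"
  by (rule regular_rep_eqI[OF poly_graph_add[OF regular_rep_graph regular_rep_graph]])

lemma regular_rep_mult: "regular_rep (a * b) = regular_rep a o\<^sub>L regular_rep b"
  by (rule regular_rep_eqI[OF poly_graph_mult[OF regular_rep_graph regular_rep_graph]])

lemma regular_rep_scaleC:
  fixes \<psi> :: "((int, 'm) vec, 's::{chilbert_space, euclidean_space}) l2"
  shows "blinfun_apply (regular_rep (d *\<^sub>C a)) \<psi> = d *\<^sub>C blinfun_apply (regular_rep a) \<psi>"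
proof -
  have b: "bounded_linear (\<lambda>\<psi> :: ((int, 'm) vec, 's) l2. d *\<^sub>C blinfun_apply (regular_rep a) \<psi>)"
    by (rule bounded_linear_compose[OF bounded_linear_scaleC blinfun.bounded_linear_right])
  have "regular_rep (d *\<^sub>C a) = Blinfun (\<lambda>\<psi> :: ((int, 'm) vec, 's) l2. d *\<^sub>C blinfun_apply (regular_rep a) \<psi>)"
    by (rule regular_rep_eqI[OF poly_graph_scale[OF regular_rep_graph]])
      (simp add: bounded_linear_Blinfun_apply[OF b])
  then show ?thesis by (simp add: bounded_linear_Blinfun_apply[OF b])
qed

lemma bounded_linear_regular_rep: "bounded_linear regular_rep"
  by (rule bounded_linear_intro[of _ 1])
    (auto intro!: blinfun_eqI simp: regular_rep_add norm_regular_rep regular_rep_scaleC scaleR_scaleC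
      scaleR_blinfun.rep_eq)

lemma regular_rep_u:
  "blinfun_apply (regular_rep (u x) :: ('m, 's::{chilbert_space, euclidean_space}) l2_blinfun) = W x"
proof -
  obtain n where "{x} \<subseteq> (lattice_box n :: (int, 'm) vec set)" by (rule finite_subset_lattice_box[of "{x}"]) simp
  then have "(u x, Blinfun (W x) :: ('m, 's) l2_blinfun) \<in> closure poly_graph"
    by (intro subsetD[OF closure_subset]) (auto simp: poly_graph_def intro: poly_pair_W)
  from regular_rep_eqI[OF this] show ?thesis
    by (simp add: bounded_linear_Blinfun_apply bounded_clinearD(1)[OF bounded_clinear_W])
qed

lemma dense_induct:
  assumes "closed {a. P a}" and "\<And>p X. finite X \<Longrightarrow> P (\<Sum>x\<in>X. p x *\<^sub>C u x)"
  shows "P a"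
proof -
  have "closure {a. \<exists>p X. finite X \<and> a = (\<Sum>x\<in>X. p x *\<^sub>C u x)} \<subseteq> {a. P a}"
    by (rule closure_minimal) (use assms in auto)
  then show ?thesis by (auto simp: dense)
qed

lemma linear_dense_eq:
  fixes f g :: "'a \<Rightarrow> 'b::complex_normed_vector"
  assumes f: "bounded_clinear f" and g: "bounded_clinear g" and eq: "\<And>x. f (u x) = g (u x)"
  shows "f = g"
proof
  fix a
  note F = bounded_clinearD[OF f] and G = bounded_clinearD[OF g]
  show "f a = g a"
  proof (induction a rule: dense_induct)
    show "closed {a. f a = g a}"
      by (intro closed_Collect_eq bounded_linear.continuous_on[OF F(1)]
          bounded_linear.continuous_on[OF G(1)] continuous_on_id)
    show "f (\<Sum>x\<in>X. p x *\<^sub>C u x) = g (\<Sum>x\<in>X. p x *\<^sub>C u x)" for p X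
      by (simp add: linear_sum[OF bounded_linear.linear[OF F(1)]]
          linear_sum[OF bounded_linear.linear[OF G(1)]] F G eq)
  qed
qed

lemma bounded_linear_regular_rep_left: "bounded_linear (\<lambda>a. blinfun_apply (regular_rep a) \<psi>)"
  by (rule bounded_linear_compose[OF blinfun.bounded_linear_left bounded_linear_regular_rep])

lemma regular_rep_sum:
  "blinfun_apply (regular_rep (\<Sum>x\<in>X. p x *\<^sub>C u x)) \<psi> = (\<Sum>x\<in>X. p x *\<^sub>C W x \<psi>)"
  by (simp add: linear_sum[OF bounded_linear.linear[OF bounded_linear_regular_rep_left]]
      regular_rep_scaleC regular_rep_u)

text \<open>Bounded operators of the type used here are only real linear a priori; complex linearity
  holds for polynomials in the shifts and survives limits.\<close>

lemma regular_rep_clinear: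
  "blinfun_apply (regular_rep a) (d *\<^sub>C \<psi>) = d *\<^sub>C blinfun_apply (regular_rep a) \<psi>"
proof (induction a rule: dense_induct)
  show "closed {a. blinfun_apply (regular_rep a) (d *\<^sub>C \<psi>) = d *\<^sub>C blinfun_apply (regular_rep a) \<psi>}"
    by (intro closed_Collect_eq bounded_linear.continuous_on[OF bounded_linear_scaleC]
        bounded_linear.continuous_on[OF bounded_linear_regular_rep_left] continuous_on_id)
  show "blinfun_apply (regular_rep (\<Sum>x\<in>X. p x *\<^sub>C u x)) (d *\<^sub>C \<psi>) =
      d *\<^sub>C blinfun_apply (regular_rep (\<Sum>x\<in>X. p x *\<^sub>C u x)) \<psi>" for p X
    by (simp add: regular_rep_sum bounded_clinearD[OF bounded_clinear_W]
        complex_vector.scale_sum_right scaleC_scaleC mult.commute)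
qed

lemma bounded_clinear_regular_rep:
  "bounded_clinear (blinfun_apply (regular_rep a :: ('m, 's::{chilbert_space, euclidean_space}) l2_blinfun))"
proof (rule bounded_clinearI[of _ "norm a"])
  show "norm (blinfun_apply (regular_rep a) \<psi>) \<le> norm a * norm \<psi>"
    for \<psi> :: "((int, 'm) vec, 's) l2"
    using norm_blinfun[of "regular_rep a" \<psi>] by (simp add: norm_regular_rep)
qed (simp_all add: blinfun.add_right regular_rep_clinear)

lemma regular_rep_star:
  fixes \<phi> \<psi> :: "((int, 'm) vec, 's::{chilbert_space, euclidean_space}) l2"
  shows
  "cinner \<phi> (blinfun_apply (regular_rep (star a)) \<psi>) = cinner (blinfun_apply (regular_rep a) \<phi>) \<psi>"
proof (induction a rule: dense_induct)
  show "closed {a. cinner \<phi> (blinfun_apply (regular_rep (star a)) \<psi>) =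
      cinner (blinfun_apply (regular_rep a) \<phi>) \<psi>}"
    by (intro closed_Collect_eq continuous_on_cinner continuous_on_const continuous_on_id
        bounded_linear.continuous_on[OF bounded_linear_regular_rep_left]
        bounded_linear.continuous_on[OF bounded_linear_star])
  fix p :: "(int, 'm) vec \<Rightarrow> complex" and X :: "(int, 'm) vec set" assume X: "finite X"
  let ?a = "\<Sum>x\<in>X. p x *\<^sub>C u x"
  obtain T :: "('m, 's) l2_blinfun" where "(?a, T) \<in> poly_graph"
    using polynomial_in_graph[OF X] .
  then obtain n where T: "poly_pair n ?a T" by (auto simp: poly_graph_def)
  obtain S where S: "poly_pair n (star ?a) S"
    "\<And>\<phi> \<psi>. cinner \<phi> (blinfun_apply S \<psi>) = cinner (blinfun_apply T \<phi>) \<psi>"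
    using poly_pair_adjoint[OF T] by blast
  have "regular_rep ?a = T" "regular_rep (star ?a) = S"
    using T S(1) by (auto intro!: regular_rep_eqI subsetD[OF closure_subset] simp: poly_graph_def)
  then show "cinner \<phi> (blinfun_apply (regular_rep (star ?a)) \<psi>) =
      cinner (blinfun_apply (regular_rep ?a) \<phi>) \<psi>" using S by simp
qed

end

section \<open>The canonical trace and the representation on the GNS space\<close>

context free_twisted_torus
begin

lemma ex_trace:
  "\<exists>\<tau> :: 'a \<Rightarrow> complex. bounded_clinear \<tau> \<and> (\<forall>x. \<tau> (u x) = (if x = 0 then 1 else 0))"
proof -
  \<comment> \<open>The multiplicity space is taken to be \<open>complex\<close>, so that the
    coordinate at the origin is already a scalar.\<close>
  let ?\<tau> = "\<lambda>a. l2_fun (blinfun_apply (regular_rep a) (l2_delta 0 (1::complex))) 0"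
  have "bounded_linear ?\<tau>"
    by (rule bounded_linear_compose[OF bounded_linear_l2_fun bounded_linear_regular_rep_left])
  then obtain K where K: "\<And>a. norm (?\<tau> a) \<le> norm a * K" by (auto dest: bounded_linear.bounded)
  have "bounded_clinear ?\<tau>"
    by (rule bounded_clinearI[of _ K])
      (simp_all add: regular_rep_add blinfun.add_left regular_rep_scaleC K mult.commute[of K])
  moreover have "?\<tau> (u x) = (if x = 0 then 1 else 0)" for x
    by (simp add: regular_rep_u W_delta l2_fun_tensor_delta)
  ultimately show ?thesis by (intro exI[of _ ?\<tau>]) blast
qed

text \<open>Worded like \<open>canonical_trace\<close>, with u in place of the monomials, so that
  the two agree by unfolding when u is \<open>monomial U\<close>.\<close>

definition torus_trace :: "'a \<Rightarrow> complex" where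
  "torus_trace = (THE \<tau>. bounded_clinear \<tau> \<and> (\<forall>x. \<tau> (u x) = (if x = 0 then 1 else 0)))"

lemma torus_trace: "bounded_clinear torus_trace" "torus_trace (u x) = (if x = 0 then 1 else 0)"
proof -
  have "\<exists>!\<tau> :: 'a \<Rightarrow> complex. bounded_clinear \<tau> \<and> (\<forall>x. \<tau> (u x) = (if x = 0 then 1 else 0))"
    by (rule ex_ex1I[OF ex_trace]) (rule linear_dense_eq; simp)
  from theI'[OF this] show "bounded_clinear torus_trace" "torus_trace (u x) = (if x = 0 then 1 else 0)"
    unfolding torus_trace_def by blast+
qed

lemma trace_star_u_mult: "torus_trace (star (u x) * u y) = (if x = y then 1 else 0)"
proof (cases "x = y")
  case True
  then show ?thesis using torus_trace(2)[of 0] by (simp add: u_zero unitaryD[OF unitary_u])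
next
  case False
  then show ?thesis
    by (simp add: star_u scaleC_mult_left u_mult scaleC_scaleC bounded_clinearD[OF torus_trace(1)]
        torus_trace(2) scaleC_complex_def)
qed

text \<open>Both sides are bounded and complex linear in a, so it suffices to compare them at the
  unitaries. The result identifies the GNS vector of a, tensored with \<xi>, with the image of the
  cyclic vector at the origin.\<close>

lemma l2_fun_regular_rep_delta:
  fixes \<xi> :: "'s::{chilbert_space, euclidean_space}"
  shows "l2_fun (blinfun_apply (regular_rep a) (l2_delta 0 \<xi>)) x = torus_trace (star (u x) * a) *\<^sub>C \<xi>"
proof -
  let ?f = "\<lambda>a. l2_fun (blinfun_apply (regular_rep a) (l2_delta 0 \<xi>)) x"
  let ?g = "\<lambda>a. torus_trace (star (u x) * a) *\<^sub>C \<xi>"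
  have f: "bounded_linear ?f"
    by (rule bounded_linear_compose[OF bounded_linear_l2_fun bounded_linear_regular_rep_left])
  then obtain K where K: "\<And>a. norm (?f a) \<le> norm a * K" by (auto dest: bounded_linear.bounded)
  have g: "bounded_linear ?g"
    by (rule bounded_linear_compose[OF bounded_bilinear.bounded_linear_left[OF bounded_bilinear_scaleC]
        bounded_linear_compose[OF bounded_clinearD(1)[OF torus_trace(1)] bounded_linear_mult_right]])
  then obtain K' where K': "\<And>a. norm (?g a) \<le> norm a * K'" by (auto dest: bounded_linear.bounded)
  have "?f = ?g"
  proof (rule linear_dense_eq)
    show "bounded_clinear ?f"
      by (rule bounded_clinearI[of _ K])
        (simp_all add: regular_rep_add blinfun.add_left regular_rep_scaleC K mult.commute[of K])
    show "bounded_clinear ?g"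
      by (rule bounded_clinearI[of _ K'])
        (simp_all add: distrib_left bounded_clinearD[OF torus_trace(1)] scaleC_add_left scaleC_mult_right
          scaleC_complex_def scaleC_scaleC K' mult.commute[of K'])
    show "?f (u y) = ?g (u y)" for y
      by (simp add: regular_rep_u W_delta l2_fun_tensor_delta trace_star_u_mult)
  qed
  then show ?thesis by (rule fun_cong)
qed

lemma l2_tensor_trace:
  fixes \<xi> :: "'s::{chilbert_space, euclidean_space}"
  shows "l2_tensor (\<lambda>x. torus_trace (star (u x) * b)) \<xi> = blinfun_apply (regular_rep b) (l2_delta 0 \<xi>)"
  unfolding l2_tensor_def[of "\<lambda>x. torus_trace (star (u x) * b)"] l2_fun_regular_rep_delta[symmetric]
  by (rule l2_fun_inverse)

text \<open>Existence in the description is multiplicativity of the regular representation. For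
  uniqueness, b = u x produces all vectors concentrated at x, and these determine a bounded
  operator.\<close>

lemma gns_rep_eq_regular_rep:
  "(THE T. bounded_clinear T \<and> (\<forall>b \<xi>. T (l2_tensor (\<lambda>x. torus_trace (star (u x) * b)) \<xi>) =
      l2_tensor (\<lambda>x. torus_trace (star (u x) * (a * b))) \<xi>)) =
    blinfun_apply (regular_rep a :: ('m, 's::{chilbert_space, euclidean_space}) l2_blinfun)"
  unfolding l2_tensor_trace
proof (rule the_equality)
  show "bounded_clinear (blinfun_apply (regular_rep a)) \<and>
    (\<forall>b (\<xi>::'s). blinfun_apply (regular_rep a) (blinfun_apply (regular_rep b) (l2_delta 0 \<xi>)) =
      blinfun_apply (regular_rep (a * b)) (l2_delta 0 \<xi>))"
    by (simp add: bounded_clinear_regular_rep regular_rep_mult)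
  fix T :: "((int, 'm) vec, 's) l2 \<Rightarrow> ((int, 'm) vec, 's) l2"
  assume T: "bounded_clinear T \<and> (\<forall>b (\<xi>::'s). T (blinfun_apply (regular_rep b) (l2_delta 0 \<xi>)) =
      blinfun_apply (regular_rep (a * b)) (l2_delta 0 \<xi>))"
  show "T = blinfun_apply (regular_rep a)"
  proof (rule bounded_linear_eq_if_deltas)
    show "bounded_linear T" using T by (simp add: bounded_clinear_def)
    show "bounded_linear (blinfun_apply (regular_rep a))" by (rule blinfun.bounded_linear_right)
    fix x and \<xi> :: 's
    have "l2_delta x \<xi> = blinfun_apply (regular_rep (u x)) (l2_delta 0 \<xi>)"
      by (simp add: regular_rep_u W_delta)
    then show "T (l2_delta x \<xi>) = blinfun_apply (regular_rep a) (l2_delta x \<xi>)"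
      using T by (simp add: regular_rep_mult)
  qed
qed

lemma faithful_unital_rep_regular_rep:
  "faithful_unital_rep (\<lambda>a. blinfun_apply (regular_rep a :: ('m, 's::{chilbert_space, euclidean_space}) l2_blinfun))"
  unfolding faithful_unital_rep_def
proof (intro conjI allI)
  show "inj (\<lambda>a. blinfun_apply (regular_rep a :: ('m, 's) l2_blinfun))"
  proof (rule injI)
    fix a b :: 'a
    assume "blinfun_apply (regular_rep a :: ('m, 's) l2_blinfun) = blinfun_apply (regular_rep b)"
    then have "regular_rep a = (regular_rep b :: ('m, 's) l2_blinfun)" by (simp add: blinfun_apply_inject)
    then have "norm (regular_rep (a - b) :: ('m, 's) l2_blinfun) = 0"
      by (simp add: linear_diff[OF bounded_linear.linear[OF bounded_linear_regular_rep]])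
    then show "a = b" by (simp add: norm_regular_rep)
  qed
  show "blinfun_apply (regular_rep 1) \<xi> = \<xi>" for \<xi> :: "((int, 'm) vec, 's) l2"
    using regular_rep_u[of 0, where 's = 's] by (simp add: u_zero)
qed (simp_all add: bounded_clinear_regular_rep regular_rep_add blinfun.add_left regular_rep_scaleC
    regular_rep_mult regular_rep_star)

end

text \<open>By \<open>u_mult\<close> and \<open>star_u\<close> the span is already a unital star
  subalgebra. Continuity of the operations carries this to its closure, which contains the
  generating set G.\<close>

lemma (in twisted_torus) closure_span_eq_UNIV:
  assumes gen: "generates G" and G: "G \<subseteq> range u"
  shows "closure (complex_vector.span (range u)) = UNIV"
proof -
  let ?P = "complex_vector.span (range u)"
  have un: "f x \<in> closure ?P" if "continuous_on UNIV f" "x \<in> closure ?P" "\<And>x. x \<in> ?P \<Longrightarrow> f x \<in> ?P"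
    for f :: "'a \<Rightarrow> 'a" and x
  proof -
    have "f ` closure ?P \<subseteq> closure ?P"
      by (rule image_closure_subset)
        (use that in \<open>auto intro: continuous_on_subset intro!: subsetD[OF closure_subset]\<close>)
    then show ?thesis using that by blast
  qed
  have bin: "f (x, y) \<in> closure ?P" if "continuous_on UNIV f" "x \<in> closure ?P" "y \<in> closure ?P"
    "\<And>x y. x \<in> ?P \<Longrightarrow> y \<in> ?P \<Longrightarrow> f (x, y) \<in> ?P" for f :: "'a \<times> 'a \<Rightarrow> 'a" and x y
  proof -
    have "f ` closure (?P \<times> ?P) \<subseteq> closure ?P"
      by (rule image_closure_subset)
        (use that in \<open>auto intro: continuous_on_subset intro!: subsetD[OF closure_subset]\<close>)
    then show ?thesis using that by (auto simp: closure_Times)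
  qed
  have mono_mult: "x * u k \<in> ?P" if "x \<in> ?P" for x k
    using that
  proof (induction rule: complex_vector.span_induct_alt)
    case base
    show ?case by (simp add: complex_vector.span_zero)
  next
    case (step d v w)
    then obtain l where "v = u l" by blast
    then have "(d *\<^sub>C v) * u k \<in> ?P"
      by (simp add: scaleC_mult_left u_mult complex_vector.span_scale complex_vector.span_base)
    then show ?case using step by (simp add: distrib_right complex_vector.span_add)
  qed
  have mult: "x * y \<in> ?P" if "x \<in> ?P" "y \<in> ?P" for x y
    using that(2)
  proof (induction rule: complex_vector.span_induct_alt)
    case base
    show ?case by (simp add: complex_vector.span_zero)
  next
    case (step d v w)
    then have "x * v \<in> ?P" using mono_mult that(1) by blast
    then show ?case
      using step by (simp add: distrib_left scaleC_mult_right complex_vector.span_add complex_vector.span_scale)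
  qed
  have star: "star x \<in> ?P" if "x \<in> ?P" for x
    using that
  proof (induction rule: complex_vector.span_induct_alt)
    case base
    show ?case by (simp add: complex_vector.span_zero)
  next
    case (step d v w)
    then obtain l where "v = u l" by blast
    then show ?case
      using step by (simp add: star_add star_scaleC star_u complex_vector.span_add
          complex_vector.span_scale complex_vector.span_base)
  qed
  have "G \<subseteq> closure ?P \<and> closed (closure ?P) \<and> 1 \<in> closure ?P \<and> complex_vector.subspace (closure ?P) \<and>
      (\<forall>x\<in>closure ?P. \<forall>y\<in>closure ?P. x * y \<in> closure ?P) \<and> (\<forall>x\<in>closure ?P. star x \<in> closure ?P)"
  proof (intro conjI ballI)
    show "G \<subseteq> closure ?P" using G closure_subset complex_vector.span_superset by blast
    show "1 \<in> closure ?P"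
      using u_zero by (metis closure_subset complex_vector.span_base rangeI subsetD)
    show "complex_vector.subspace (closure ?P)"
    proof (rule complex_vector.subspaceI)
      show "0 \<in> closure ?P" using closure_subset complex_vector.span_zero by blast
      show "x + y \<in> closure ?P" if "x \<in> closure ?P" "y \<in> closure ?P" for x y
        using bin[of "\<lambda>q. fst q + snd q" x y] that
        by (simp add: complex_vector.span_add continuous_intros)
      show "d *\<^sub>C x \<in> closure ?P" if "x \<in> closure ?P" for d x
        using un[of "scaleC d" x] that
        by (simp add: complex_vector.span_scale bounded_linear.continuous_on[OF bounded_linear_scaleC])
    qed
    show "x * y \<in> closure ?P" if "x \<in> closure ?P" "y \<in> closure ?P" for x y
      using bin[of "\<lambda>q. fst q * snd q" x y] that by (simp add: mult continuous_intros)
    show "star x \<in> closure ?P" if "x \<in> closure ?P" for x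
      using un[of star x] that by (simp add: star bounded_linear.continuous_on[OF bounded_linear_star])
  qed simp
  with gen show ?thesis unfolding generates_def by blast
qed

section \<open>The monomials as an instance of the abstract setting\<close>

lemma span_range_eq:
  "complex_vector.span (range f) = {a. \<exists>p X. finite X \<and> a = (\<Sum>x\<in>X. p x *\<^sub>C f x)}"
proof (intro equalityI subsetI)
  fix a assume "a \<in> complex_vector.span (range f)"
  then obtain t r where t: "finite t" "t \<subseteq> range f" "a = (\<Sum>b\<in>t. r b *\<^sub>C b)"
    unfolding complex_vector.span_explicit by blast
  \<comment> \<open>Since f may repeat values, the vectors occurring are lifted to indices on which
    f is injective before the sum is reindexed.\<close>
  then obtain X where X: "inj_on f X" "t = f ` X" by (auto simp: subset_image_inj)
  then have "a = (\<Sum>x\<in>X. r (f x) *\<^sub>C f x)" "finite X"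
    using t by (simp_all add: sum.reindex finite_image_iff)
  then show "a \<in> {a. \<exists>p X. finite X \<and> a = (\<Sum>x\<in>X. p x *\<^sub>C f x)}"
    by (intro CollectI exI[of _ "\<lambda>x. r (f x)"] exI[of _ X] conjI)
qed (auto intro!: complex_vector.span_sum complex_vector.span_scale intro: complex_vector.span_base)

definition twist :: "('m::{finite, linorder} \<Rightarrow> 'a::unital_cstar_algebra) \<Rightarrow> (int, 'm) vec \<Rightarrow> (int, 'm) vec \<Rightarrow> complex" where
  "twist U x y = (SOME c. cmod c = 1 \<and> monomial U x * monomial U y = c *\<^sub>C monomial U (x + y))"

lemma monomial_axis: "monomial U (axis j 1) = U j"
proof -
  have "prod_list (map (\<lambda>k. unitary_power (U k) (axis j 1 $ k)) ks) = (if j \<in> set ks then U j else 1)"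
    if "distinct ks" for ks
    using that by (induction ks) (auto simp: axis_def unitary_power_def)
  then show ?thesis by (simp add: monomial_def)
qed

lemma free_twisted_torus_monomial:
  fixes U :: "'m::{finite, linorder} \<Rightarrow> 'a::unital_cstar_algebra"
  assumes univ: "universal_nc_torus \<Theta> U"
  shows "free_twisted_torus (monomial U) (twist U)"
proof -
  have rel: "nc_torus_relations (cstar_of TYPE('a)) \<Theta> U" and gen: "generates (range U)"
    using univ by (simp_all add: universal_nc_torus_def)
  note R = nc_torus_relationsD[OF rel]
  have tw: "cmod (twist U x y) = 1 \<and> monomial U x * monomial U y = twist U x y *\<^sub>C monomial U (x + y)" for x y
    unfolding twist_def
    by (rule someI_ex) (use monomial_mult[of U x y] R in \<open>auto simp: phase_eq_def\<close>)
  interpret twisted_torus "monomial U" "twist U"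
  proof
    show "unitary (monomial U x)" for x by (rule unitary_monomial) (use R in auto)
    show "monomial U 0 = 1" by (rule monomial_zero) (use R in auto)
  qed (use tw in auto)
  show ?thesis
  proof
    fix X and z :: "(int, 'm) vec" and p :: "(int, 'm) vec \<Rightarrow> complex"
    assume "finite X" "z \<in> X"
    then show "cmod (p z) \<le> norm (\<Sum>x\<in>X. p x *\<^sub>C monomial U x)"
      using coefficient_le_norm[OF univ, of "X - {z}" z p] by (simp add: insert_absorb)
  next
    have "range U \<subseteq> range (monomial U)" by (metis image_subsetI monomial_axis rangeI)
    then show "closure {a. \<exists>p X. finite X \<and> a = (\<Sum>x\<in>X. p x *\<^sub>C monomial U x)} = UNIV"
      using closure_span_eq_UNIV[OF gen] by (simp add: span_range_eq)
  qed
qed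

lemma nc_torus_rep_eq_regular_rep:
  fixes U :: "'m::{finite, linorder} \<Rightarrow> 'a::unital_cstar_algebra"
  assumes univ: "universal_nc_torus \<Theta> U"
  shows "(nc_torus_rep U a :: ((int, 'm) vec, 's::{chilbert_space, euclidean_space}) l2 \<Rightarrow> _) =
    blinfun_apply (free_twisted_torus.regular_rep (monomial U) (twist U) a)"
proof -
  interpret free_twisted_torus "monomial U" "twist U"
    by (rule free_twisted_torus_monomial[OF univ])
  show ?thesis
    unfolding nc_torus_rep_def gns_vector_def canonical_trace_def
    using gns_rep_eq_regular_rep[of a, where 's = 's] unfolding torus_trace_def .
qed

section \<open>Selfadjoint endomorphisms\<close>

lemma selfadjoint_endoD:
  assumes "selfadjoint_endo T"
  shows "clinear T" "cinner \<xi> (T \<eta>) = cinner (T \<xi>) \<eta>"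
  using assms by (simp_all add: selfadjoint_endo_def)

lemma norm_add_sq: "(norm (x + y))\<^sup>2 = (norm x)\<^sup>2 + 2 * Re (cinner x y) + (norm y)\<^sup>2"
  for x y :: "'a::complex_inner"
proof -
  have "complex_of_real ((norm (x + y))\<^sup>2) =
      complex_of_real ((norm x)\<^sup>2) + (cinner x y + cnj (cinner x y)) + complex_of_real ((norm y)\<^sup>2)"
    unfolding cinner_self[symmetric] cinner_commute[of x y, symmetric]
    by (simp add: cinner_add_left cinner_add_right cinner_commute[of y x, symmetric] del: complex_cnj_cnj)
  from arg_cong[OF this, of Re] show ?thesis by (simp del: of_real_power)
qed

text \<open>A minimiser \<open>v\<close> of \<open>norm (T v)\<close> on the unit sphere, with minimum \<open>\<mu>\<close>, satisfies
  \<open>T\<^sup>2 v = \<mu>\<^sup>2 v\<close>, so \<open>\<mu>\<close> or \<open>-\<mu>\<close> is an eigenvalue.\<close>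

lemma norm_ge_if_spectrum_disjoint:
  fixes T :: "'s::{chilbert_space, euclidean_space} \<Rightarrow> 's"
  assumes T: "selfadjoint_endo T" and R: "0 < R"
    and spec: "spectrum T \<inter> complex_of_real ` {-R..R} = {}"
  shows "R * norm v \<le> norm (T v)"
proof -
  note lin = clinearD[OF selfadjoint_endoD(1)[OF T]] and sa = selfadjoint_endoD(2)[OF T]
  have linT: "linear T" by (rule clinear_imp_linear[OF selfadjoint_endoD(1)[OF T]])
  have scaleR: "T (r *\<^sub>R x) = r *\<^sub>R T x" for r x by (simp add: scaleR_scaleC lin)
  have eig: False if w: "w \<noteq> 0" "T w = complex_of_real r *\<^sub>C w" and r: "\<bar>r\<bar> \<le> R" for w r
  proof -
    have "T w - complex_of_real r *\<^sub>C w = T 0 - complex_of_real r *\<^sub>C 0" by (simp add: w lin)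
    then have "\<not> inj (\<lambda>\<xi>. T \<xi> - complex_of_real r *\<^sub>C \<xi>)" using w(1) unfolding inj_def by blast
    then have "complex_of_real r \<in> spectrum T" by (auto simp: spectrum_def bij_def)
    then show False using spec r by (auto simp: abs_le_iff)
  qed
  obtain v0 where v0: "norm v0 = 1" and min: "\<And>y. norm y = 1 \<Longrightarrow> norm (T v0) \<le> norm (T y)"
  proof -
    obtain e :: 's where e: "norm e = 1" using ex_unit_vector by blast
    have "\<exists>x\<in>sphere 0 1. \<forall>y\<in>sphere 0 1. norm (T x) \<le> norm (T y)"
    proof (rule continuous_attains_inf)
      show "sphere (0::'s) 1 \<noteq> {}" using e by auto
      show "continuous_on (sphere 0 1) (\<lambda>x. norm (T x))"
        by (intro continuous_intros linear_continuous_on linear_linear[THEN iffD2] linT)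
    qed simp
    then show ?thesis using that by auto
  qed
  define \<mu> where "\<mu> = norm (T v0)"
  have \<mu>: "0 \<le> \<mu>" by (simp add: \<mu>_def)
  have ge: "\<mu> * norm x \<le> norm (T x)" for x
  proof (cases "x = 0")
    case False
    then have "\<mu> \<le> norm (T (inverse (norm x) *\<^sub>R x))" unfolding \<mu>_def by (intro min) simp
    then show ?thesis using False by (simp add: scaleR field_simps)
  qed simp
  show ?thesis
  proof (cases "R \<le> \<mu>")
    case True
    then show ?thesis using ge[of v] mult_right_mono[OF True, of "norm v"] by simp
  next
    case False
    define w where "w = T (T v0) - complex_of_real (\<mu>\<^sup>2) *\<^sub>C v0"
    define C where "C = (norm (T w))\<^sup>2 - \<mu>\<^sup>2 * (norm w)\<^sup>2"
    have w2: "Re (cinner (T v0) (T w)) - \<mu>\<^sup>2 * Re (cinner v0 w) = (norm w)\<^sup>2"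
    proof -
      have "complex_of_real ((norm w)\<^sup>2) = cinner (T (T v0)) w - complex_of_real (\<mu>\<^sup>2) * cinner v0 w"
        unfolding cinner_self[symmetric]
        by (subst (1) w_def) (simp add: cinner_diff_left cinner_scaleC_left)
      from arg_cong[OF this, of Re] show ?thesis by (simp add: sa del: of_real_power)
    qed
    have q: "0 \<le> 2 * t * (norm w)\<^sup>2 + t\<^sup>2 * C" for t
    proof -
      have "(\<mu> * norm (v0 + t *\<^sub>R w))\<^sup>2 \<le> (norm (T (v0 + t *\<^sub>R w)))\<^sup>2"
        using \<mu> by (intro power_mono ge) simp
      moreover have "(norm (T (v0 + t *\<^sub>R w)))\<^sup>2 = \<mu>\<^sup>2 + 2 * t * Re (cinner (T v0) (T w)) + t\<^sup>2 * (norm (T w))\<^sup>2"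
        unfolding lin(1) scaleR norm_add_sq
        by (simp add: \<mu>_def scaleR_scaleC cinner_scaleC_right norm_scaleC power_mult_distrib)
      moreover have "(norm (v0 + t *\<^sub>R w))\<^sup>2 = 1 + 2 * t * Re (cinner v0 w) + t\<^sup>2 * (norm w)\<^sup>2"
        unfolding norm_add_sq
        by (simp add: v0 scaleR_scaleC cinner_scaleC_right norm_scaleC power_mult_distrib)
      ultimately show ?thesis
        unfolding w2[symmetric] C_def power_mult_distrib by (simp add: algebra_simps)
    qed
    have "w = 0"
    proof (rule ccontr)
      assume "w \<noteq> 0"
      define s where "s = 1 / (\<bar>C\<bar> + 1)"
      have N: "0 < (norm w)\<^sup>2" using \<open>w \<noteq> 0\<close> by simp
      define \<delta> where "\<delta> = s * (norm w)\<^sup>2"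
      have s: "0 < s" by (simp add: s_def add_nonneg_pos)
      have sC: "s * C \<le> 1" by (simp add: s_def field_simps add_nonneg_pos)
      have "0 \<le> 2 * (- \<delta>) * (norm w)\<^sup>2 + (- \<delta>)\<^sup>2 * C" by (rule q)
      also have "\<dots> = \<delta> * (norm w)\<^sup>2 * (s * C - 2)"
        by (simp add: \<delta>_def power2_eq_square algebra_simps)
      also have "\<dots> < 0" using N s sC by (intro mult_pos_neg) (simp_all add: \<delta>_def)
      finally show False by simp
    qed
    then have TT: "T (T v0) = complex_of_real (\<mu>\<^sup>2) *\<^sub>C v0" by (simp add: w_def)
    \<comment> \<open>From (T + \<mu>) (T - \<mu>) v0 = 0: either y is an eigenvector for - \<mu>,
      or y = 0 and v0 is one for \<mu>.\<close>
    define y where "y = T v0 - complex_of_real \<mu> *\<^sub>C v0"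
    have diff: "T (a - b) = T a - T b" for a b
      using linT by (simp add: linear_diff)
    have "T y = complex_of_real (- \<mu>) *\<^sub>C y"
      by (simp add: y_def diff lin TT complex_vector.scale_right_diff_distrib scaleC_scaleC
          complex_vector.scale_minus_left power2_eq_square)
    moreover have "T v0 = complex_of_real \<mu> *\<^sub>C v0" if "y = 0" using that by (simp add: y_def)
    moreover have "v0 \<noteq> 0" using v0 by auto
    ultimately show ?thesis using eig[of y "- \<mu>"] eig[of v0 \<mu>] False \<mu> by (cases "y = 0") auto
  qed
qed

text \<open>The two cross terms cancel by selfadjointness. So T - \<i> is bounded below by one,
  which gives the inverses of all F x - \<i> the common bound one.\<close>

lemma norm_selfadjoint_minus_ii:
  assumes T: "selfadjoint_endo T"
  shows "(norm (T v - \<i> *\<^sub>C v))\<^sup>2 = (norm (T v))\<^sup>2 + (norm v)\<^sup>2"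
proof -
  have "complex_of_real ((norm (T v - \<i> *\<^sub>C v))\<^sup>2) = cinner (T v) (T v) + cinner v v"
    unfolding cinner_self[symmetric]
    by (simp add: cinner_diff_left cinner_diff_right cinner_scaleC_left cinner_scaleC_right
        selfadjoint_endoD(2)[OF T, of v v] algebra_simps)
  then have "complex_of_real ((norm (T v - \<i> *\<^sub>C v))\<^sup>2) = complex_of_real ((norm (T v))\<^sup>2 + (norm v)\<^sup>2)"
    by (simp only: cinner_self of_real_add)
  then show ?thesis by (simp only: of_real_eq_iff)
qed

lemma selfadjoint_resolvent_ii:
  fixes T :: "'s::{chilbert_space, euclidean_space} \<Rightarrow> 's"
  assumes T: "selfadjoint_endo T"
  obtains G where "clinear G" "\<And>v. T (G v) - \<i> *\<^sub>C G v = v" "\<And>v. G (T v - \<i> *\<^sub>C v) = v"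
    "\<And>v. norm (G v) \<le> norm v"
proof -
  note lin = clinearD[OF selfadjoint_endoD(1)[OF T]]
  let ?f = "\<lambda>v. T v - \<i> *\<^sub>C v"
  have f: "linear ?f"
    by (rule linearI) (simp_all add: lin scaleC_add_right scaleR_scaleC scaleC_scaleC
        complex_vector.scale_right_diff_distrib mult.commute)
  have "v = 0" if "?f v = 0" for v
    using norm_selfadjoint_minus_ii[OF T, of v] that by (simp add: sum_power2_eq_zero_iff)
  then have inj: "inj ?f" using f linear_injective_0 by blast
  then have surj: "surj ?f" using f linear_injective_imp_surjective by blast
  define G where "G = inv_into UNIV ?f"
  have 1: "T (G v) - \<i> *\<^sub>C G v = v" for v using surj_f_inv_f[OF surj, of v] by (simp add: G_def)
  have 2: "G (T v - \<i> *\<^sub>C v) = v" for v using inv_f_f[OF inj, of v] by (simp add: G_def)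
  have "clinear G"
    unfolding Vector_Spaces.linear_iff
  proof (intro conjI allI complex_vector.vector_space_axioms)
    fix x y and c :: complex
    show "G (x + y) = G x + G y"
      using 2[of "G x + G y"] 1[of x] 1[of y] by (simp add: lin scaleC_add_right algebra_simps)
    have "T (c *\<^sub>C G x) - \<i> *\<^sub>C c *\<^sub>C G x = c *\<^sub>C (T (G x) - \<i> *\<^sub>C G x)"
      by (simp add: lin complex_vector.scale_right_diff_distrib scaleC_scaleC mult.commute)
    then show "G (c *\<^sub>C x) = c *\<^sub>C G x" using 2[of "c *\<^sub>C G x"] 1[of x] by simp
  qed
  moreover have "(norm v)\<^sup>2 = (norm (T (G v)))\<^sup>2 + (norm (G v))\<^sup>2" for v
    using norm_selfadjoint_minus_ii[OF T, of "G v"] 1[of v] by simp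
  then have "norm (G v) \<le> norm v" for v
    by (metis power2_le_imp_le le_add_same_cancel2 norm_ge_zero zero_le_power2)
  ultimately show ?thesis using 1 2 that by blast
qed

section \<open>Fourier multipliers\<close>

text \<open>A unit vector of the multiplicity space, placed at the points of X, gives linearly
  independent elements of the subsum, one for each point.\<close>

lemma finite_if_finite_dimensional_l2_subsum:
  assumes "finite_dimensional (l2_subsum X :: ('i, 's::{chilbert_space, euclidean_space}) l2 set)"
  shows "finite X"
proof -
  obtain e :: 's where e: "norm e = 1" using ex_unit_vector by blast
  let ?d = "\<lambda>x::'i. l2_delta x e"
  obtain B :: "('i, 's) l2 set" where B: "finite B" "l2_subsum X \<subseteq> complex_vector.span B"
    using assms by (auto simp: finite_dimensional_def)
  have inj: "inj ?d"
  proof (rule injI)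
    fix x y :: 'i
    assume "?d x = ?d y"
    then have "l2_fun (?d x) x = l2_fun (?d y) x" by simp
    then show "x = y" using e by (auto simp: l2_fun_tensor_delta split: if_splits)
  qed
  have "\<not> complex_vector.dependent (?d ` X)"
    unfolding complex_vector.dependent_def
  proof (rule notI, elim bexE imageE)
    fix a x
    assume x: "x \<in> X" and a: "a = ?d x" and sp: "a \<in> complex_vector.span (?d ` X - {a})"
    have "complex_vector.span (?d ` X - {a}) \<subseteq> {\<psi>. l2_fun \<psi> x = 0}"
    proof (rule complex_vector.span_minimal)
      show "?d ` X - {a} \<subseteq> {\<psi>. l2_fun \<psi> x = 0}" using a by (auto simp: l2_fun_tensor_delta)
      show "complex_vector.subspace {\<psi> :: ('i, 's) l2. l2_fun \<psi> x = 0}"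
        by (rule complex_vector.subspaceI) simp_all
    qed
    with sp a e show False by (auto simp: l2_fun_tensor_delta)
  qed
  moreover have "?d ` X \<subseteq> complex_vector.span B"
    using B(2) by (auto simp: l2_subsum_def l2_fun_tensor_delta subset_iff)
  ultimately have "finite (?d ` X)" using complex_vector.independent_span_bound[OF B(1)] by blast
  then show ?thesis using inj by (meson finite_imageD inj_on_subset subset_UNIV)
qed

lemma summable_finite_support:
  fixes f :: "'i \<Rightarrow> real"
  assumes "finite X" "\<And>x. x \<notin> X \<Longrightarrow> f x = 0" shows "f summable_on UNIV"
proof -
  have "f summable_on UNIV \<longleftrightarrow> f summable_on X"
    by (rule summable_on_cong_neutral) (use assms in auto)
  then show ?thesis using assms(1) by simp
qed

text \<open>A Minkowski sum of continuous images of closed balls of a finite-dimensional space. The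
  set will contain all finite truncations of the image of the unit ball under a resolvent.\<close>

lemma compact_l2_deltas:
  "finite X \<Longrightarrow> compact {\<Sum>x\<in>X. l2_delta x (f x) | f :: 'a \<Rightarrow> 'b::{chilbert_space, euclidean_space}. \<forall>x. norm (f x) \<le> C}"
proof (induction X rule: finite_induct)
  case empty
  have "{\<Sum>x\<in>{}. l2_delta x (f x) | f :: 'a \<Rightarrow> 'b. \<forall>x. norm (f x) \<le> C} \<subseteq> {0}" by auto
  then show ?case by (meson compact_eq_bounded_closed finite.emptyI finite.insertI finite_imp_compact finite_subset)
next
  case (insert y X)
  let ?K = "\<lambda>X. {\<Sum>x\<in>X. l2_delta x (f x) | f :: 'a \<Rightarrow> 'b. \<forall>x. norm (f x) \<le> C}"
  have "?K (insert y X) = {a + b | a b. a \<in> l2_delta y ` cball 0 C \<and> b \<in> ?K X}" (is "_ = ?R")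
  proof (intro equalityI subsetI)
    fix a assume "a \<in> ?K (insert y X)"
    then obtain f where f: "\<forall>x. norm (f x) \<le> C" "a = l2_delta y (f y) + (\<Sum>x\<in>X. l2_delta x (f x))"
      using insert.hyps by auto
    then have "l2_delta y (f y) \<in> l2_delta y ` cball 0 C" by auto
    with f show "a \<in> ?R" by blast
  next
    fix a assume "a \<in> ?R"
    then obtain v f where vf: "norm v \<le> C" "\<forall>x. norm (f x) \<le> C"
      "a = l2_delta y v + (\<Sum>x\<in>X. l2_delta x (f x))" by auto
    have "(\<Sum>x\<in>X. l2_delta x (f x)) = (\<Sum>x\<in>X. l2_delta x ((f(y := v)) x))"
      using insert.hyps by (intro sum.cong) auto
    then have "a = (\<Sum>x\<in>insert y X. l2_delta x ((f(y := v)) x))" using insert.hyps vf by simp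
    then show "a \<in> ?K (insert y X)" using vf by (intro CollectI exI[of _ "f(y := v)"]) auto
  qed
  moreover have "compact ?R"
    by (intro compact_sums insert.IH compact_continuous_image compact_cball
        bounded_linear.continuous_on[OF bounded_linear_l2_delta] continuous_on_id)
  ultimately show ?case by simp
qed

lemma norm_l2_mono:
  fixes f :: "('i, 'a::real_normed_vector) l2" and g :: "('i, 'b::real_normed_vector) l2"
  assumes "\<And>i. norm (l2_fun f i) \<le> norm (l2_fun g i)"
  shows "norm f \<le> norm g"
  by (rule norm_l2_le, rule order_trans[OF L2_set_mono L2_set_le_norm_l2]) (simp_all add: assms)

section \<open>Selfadjointness and resolvents of the multiplier\<close>

locale selfadjoint_multiplier =
  fixes F :: "'i::ab_group_add \<Rightarrow> 's::{chilbert_space, euclidean_space} \<Rightarrow> 's"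
  assumes F: "selfadjoint_endo (F x)"
begin

abbreviation D :: "('i, 's) l2 operator" where
  "D \<equiv> fourier_multiplier F"

lemmas F_linear = clinearD[OF selfadjoint_endoD(1)[OF F]]

lemma dom_iff: "\<psi> \<in> op_dom D \<longleftrightarrow> (\<lambda>x. (norm (F x (l2_fun \<psi> x)))\<^sup>2) summable_on UNIV"
  by (simp add: fourier_multiplier_def)

lemma l2_fun_D: "\<psi> \<in> op_dom D \<Longrightarrow> l2_fun (op_app D \<psi>) x = F x (l2_fun \<psi> x)"
  unfolding dom_iff by (simp add: fourier_multiplier_def l2_fun_Abs)

text \<open>Square summability is automatic once the fibrewise images are the coordinates of a known
  vector. Computing coordinates thus settles the domain and the value together.\<close>

lemma dom_if_l2: "(\<And>x. F x (l2_fun \<psi> x) = l2_fun \<phi> x) \<Longrightarrow> \<psi> \<in> op_dom D \<and> op_app D \<psi> = \<phi>"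
proof -
  assume *: "\<And>x. F x (l2_fun \<psi> x) = l2_fun \<phi> x"
  then have "\<psi> \<in> op_dom D" by (simp add: dom_iff l2_fun_summable)
  then show ?thesis using l2_fun_D * by (auto intro: l2_eqI)
qed

lemma dom_add: "\<psi> \<in> op_dom D \<Longrightarrow> \<phi> \<in> op_dom D \<Longrightarrow>
    \<psi> + \<phi> \<in> op_dom D \<and> op_app D (\<psi> + \<phi>) = op_app D \<psi> + op_app D \<phi>"
  by (rule dom_if_l2) (simp add: F_linear l2_fun_D)

lemma dom_scaleC: "\<psi> \<in> op_dom D \<Longrightarrow>
    c *\<^sub>C \<psi> \<in> op_dom D \<and> op_app D (c *\<^sub>C \<psi>) = c *\<^sub>C op_app D \<psi>"
  by (rule dom_if_l2) (simp add: F_linear l2_fun_D)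

lemma dom_zero: "0 \<in> op_dom D \<and> op_app D 0 = 0"
  by (rule dom_if_l2) (simp add: F_linear)

lemma truncate_dom: "finite X \<Longrightarrow> l2_truncate X \<psi> \<in> op_dom D"
  unfolding dom_iff by (rule summable_finite_support) (auto simp: l2_fun_truncate F_linear)

lemma densely_defined_D: "closure (op_dom D) = UNIV"
  by (rule closure_UNIV_if_truncations) (rule truncate_dom)

lemma selfadjoint_D: "selfadjoint_operator D"
  unfolding selfadjoint_operator_def
proof (intro conjI)
  have "complex_vector.subspace (op_dom D)"
    by (rule complex_vector.subspaceI) (simp_all add: dom_zero dom_add dom_scaleC)
  then show "linear_operator D" by (simp add: linear_operator_def dom_add dom_scaleC)
  show "densely_defined D" by (simp add: densely_defined_def densely_defined_D)
  show "adjoint_graph D = op_graph D"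
  proof (intro equalityI subrelI)
    fix \<eta> \<zeta> assume "(\<eta>, \<zeta>) \<in> adjoint_graph D"
    then have adj: "cinner \<eta> (op_app D \<xi>) = cinner \<zeta> \<xi>" if "\<xi> \<in> op_dom D" for \<xi>
      using that by (simp add: adjoint_graph_def)
    \<comment> \<open>Testing the adjoint relation on vectors concentrated at x fixes each
      coordinate, and \<zeta> being a vector puts \<eta> into the domain.\<close>
    have "F x (l2_fun \<eta> x) = l2_fun \<zeta> x" for x
    proof (rule cinner_eqI)
      fix v
      note d = fourier_multiplier_delta[of F x v, OF selfadjoint_endoD(1)[OF F]]
      have "cinner (l2_delta x (F x v)) \<eta> = cinner (l2_delta x v) \<zeta>"
        using adj[OF d(1)] unfolding d(2) by (metis cinner_commute)
      then show "cinner v (F x (l2_fun \<eta> x)) = cinner v (l2_fun \<zeta> x)"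
        by (simp add: cinner_l2_delta selfadjoint_endoD(2)[OF F])
    qed
    then show "(\<eta>, \<zeta>) \<in> op_graph D" using dom_if_l2 by (auto simp: op_graph_def)
  next
    fix \<eta> \<zeta> assume "(\<eta>, \<zeta>) \<in> op_graph D"
    then have \<eta>: "\<eta> \<in> op_dom D" "\<zeta> = op_app D \<eta>" by (auto simp: op_graph_def)
    have "cinner \<eta> (op_app D \<xi>) = cinner \<zeta> \<xi>" if "\<xi> \<in> op_dom D" for \<xi>
      unfolding cinner_l2_def \<eta>(2) by (simp add: l2_fun_D \<eta> that selfadjoint_endoD(2)[OF F])
    then show "(\<eta>, \<zeta>) \<in> adjoint_graph D" by (simp add: adjoint_graph_def)
  qed
qed

lemma compact_resolvent:
  assumes fin: "\<And>R::real. R > 0 \<Longrightarrow> finite {x. spectrum (F x) \<inter> complex_of_real ` {-R..R} \<noteq> {}}"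
    and res: "is_resolvent D z K"
  shows "compact_operator K"
proof -
  have K: "bounded_clinear K" and dom: "\<And>\<eta>. K \<eta> \<in> op_dom D"
    and eq: "\<And>\<eta>. op_app D (K \<eta>) - z *\<^sub>C K \<eta> = \<eta>"
    using res by (auto simp: is_resolvent_def)
  obtain C where C: "0 \<le> C" "\<And>\<eta>. norm (K \<eta>) \<le> norm \<eta> * C"
    using bounded_linear.nonneg_bounded[OF bounded_clinearD(1)[OF K]] by blast
  \<comment> \<open>A bound for the norm of \<eta> + z K \<eta>, which is D (K \<eta>), over the
    unit ball.\<close>
  define L where "L = 1 + cmod z * C"
  have L: "0 < L" using C(1) by (simp add: L_def add_pos_nonneg)
  have "\<exists>k. finite k \<and> closure (K ` cball 0 1) \<subseteq> (\<Union>x\<in>k. ball x e)" if e: "0 < e" for e :: real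
  proof -
    \<comment> \<open>Outside X every F y is bounded below by R, so the part of K \<eta> off X has
      norm at most L / R = e/4. The rest lies in a compact set covered by balls of radius
      e/4.\<close>
    define R where "R = 4 * L / e"
    have R: "0 < R" using L e by (simp add: R_def)
    define X where "X = {x. spectrum (F x) \<inter> complex_of_real ` {-R..R} \<noteq> {}}"
    have X: "finite X" unfolding X_def by (rule fin[OF R])
    let ?M = "{\<Sum>x\<in>X. l2_delta x (f x) | f :: 'i \<Rightarrow> 's. \<forall>x. norm (f x) \<le> C}"
    have "\<forall>e>0. \<exists>k. finite k \<and> ?M \<subseteq> (\<Union>x\<in>k. ball x e)"
      using compact_l2_deltas[OF X, of C] unfolding compact_eq_totally_bounded by blast
    then obtain k where k: "finite k" "?M \<subseteq> (\<Union>x\<in>k. ball x (e/4))" using e by (meson divide_pos_pos zero_less_numeral)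
    \<comment> \<open>Closed balls of radius e/2 = e/4 + e/4 make the finite union closed, so it
      also covers the closure; they fit into open balls of radius e.\<close>
    have "K \<eta> \<in> (\<Union>x\<in>k. cball x (e/2))" if \<eta>: "norm \<eta> \<le> 1" for \<eta>
    proof -
      have KC: "norm (K \<eta>) \<le> C" using C(2)[of \<eta>] mult_right_mono[OF \<eta> C(1)] by simp
      have "\<forall>x. norm (l2_fun (K \<eta>) x) \<le> C" by (intro allI order_trans[OF norm_l2_fun_le KC])
      then have "l2_truncate X (K \<eta>) \<in> ?M" unfolding l2_truncate_def by blast
      then obtain x where x: "x \<in> k" "dist x (l2_truncate X (K \<eta>)) < e/4" using k(2) by auto
      have "norm (K \<eta> - l2_truncate X (K \<eta>)) \<le> norm (inverse R *\<^sub>R (\<eta> + z *\<^sub>C K \<eta>))"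
      proof (rule norm_l2_mono)
        fix y
        show "norm (l2_fun (K \<eta> - l2_truncate X (K \<eta>)) y) \<le> norm (l2_fun (inverse R *\<^sub>R (\<eta> + z *\<^sub>C K \<eta>)) y)"
        proof (cases "y \<in> X")
          case True
          then show ?thesis by (simp add: l2_fun_truncate X)
        next
          case False
          have "F y (l2_fun (K \<eta>) y) = l2_fun (\<eta> + z *\<^sub>C K \<eta>) y"
            using l2_fun_D[OF dom, of \<eta> y] eq[of \<eta>] by (metis diff_add_cancel)
          then have "norm (l2_fun (inverse R *\<^sub>R (\<eta> + z *\<^sub>C K \<eta>)) y) = norm (F y (l2_fun (K \<eta>) y)) / R"
            unfolding l2_fun_simps(5) norm_scaleR using R by (simp add: divide_inverse mult.commute)
          moreover have "R * norm (l2_fun (K \<eta>) y) \<le> norm (F y (l2_fun (K \<eta>) y))"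
            by (rule norm_ge_if_spectrum_disjoint[OF F R]) (use False in \<open>simp add: X_def\<close>)
          ultimately show ?thesis using False R
            by (simp add: l2_fun_truncate X pos_le_divide_eq mult.commute del: l2_fun_simps(5))
        qed
      qed
      also have "\<dots> \<le> inverse R * (norm \<eta> + norm (z *\<^sub>C K \<eta>))"
        using R norm_triangle_ineq[of \<eta> "z *\<^sub>C K \<eta>"] by simp
      also have "\<dots> \<le> inverse R * L"
        unfolding L_def norm_scaleC using R \<eta> KC
        by (intro mult_left_mono add_mono) simp_all
      also have "\<dots> = e/4" using L by (simp add: R_def)
      finally have "dist (l2_truncate X (K \<eta>)) (K \<eta>) \<le> e/4" by (simp add: dist_norm norm_minus_commute)
      then have "dist x (K \<eta>) \<le> e/2"
        using x(2) dist_triangle[of x "K \<eta>" "l2_truncate X (K \<eta>)"] by simp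
      then show ?thesis using x(1) by auto
    qed
    then have "closure (K ` cball 0 1) \<subseteq> (\<Union>x\<in>k. cball x (e/2))"
      using k(1) by (intro closure_minimal closed_UN) auto
    also have "\<dots> \<subseteq> (\<Union>x\<in>k. ball x e)" using e by (intro UN_mono) auto
    finally show ?thesis using k(1) by blast
  qed
  moreover have "complete (closure (K ` cball 0 1))" by (simp add: complete_eq_closed)
  ultimately have "compact (closure (K ` cball 0 1))" unfolding compact_eq_totally_bounded by blast
  then show ?thesis using K by (simp add: compact_operator_def)
qed

lemma ex_resolvent: "\<exists>K. is_resolvent D \<i> K"
proof -
  have "\<forall>x. \<exists>G. clinear G \<and> (\<forall>v. F x (G v) - \<i> *\<^sub>C G v = v) \<and> (\<forall>v. G (F x v - \<i> *\<^sub>C v) = v) \<and>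
      (\<forall>v. norm (G v) \<le> 1 * norm v)"
    unfolding mult_1 using selfadjoint_resolvent_ii[OF F] by metis
  then obtain G where G: "\<And>x. clinear (G x)" "\<And>x v. F x (G x v) - \<i> *\<^sub>C G x v = v"
    "\<And>x v. G x (F x v - \<i> *\<^sub>C v) = v" "\<And>x v. norm (G x v) \<le> 1 * norm v"
    by metis
  \<comment> \<open>A shift by zero is a diagonal operator, here the fibrewise inverse of F x -
    \<i>.\<close>
  let ?K = "shift_op 0 G"
  have K: "l2_fun (?K \<eta>) x = G x (l2_fun \<eta> x)" for \<eta> x
    using l2_fun_shift_op[of 1 G 0 \<eta> x] G(4) by simp
  have "?K \<eta> \<in> op_dom D \<and> op_app D (?K \<eta>) = \<eta> + \<i> *\<^sub>C ?K \<eta>" for \<eta>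
    by (rule dom_if_l2) (use G(2) in \<open>simp add: K diff_eq_eq\<close>)
  moreover have "?K (op_app D \<xi> - \<i> *\<^sub>C \<xi>) = \<xi>" if "\<xi> \<in> op_dom D" for \<xi>
    by (rule l2_eqI) (simp add: K l2_fun_D[OF that] G(3))
  moreover have "bounded_clinear ?K" by (rule bounded_clinear_shift_op[OF _ G(4) G(1)]) simp
  ultimately have "is_resolvent D \<i> ?K" by (simp add: is_resolvent_def)
  then show ?thesis by (intro exI)
qed

end

section \<open>Commutators\<close>

lemma (in twisted_torus) commutator_W:
  fixes F :: "(int, 'm) vec \<Rightarrow> 's::{chilbert_space, euclidean_space} \<Rightarrow> 's"
  assumes F: "\<And>x. selfadjoint_endo (F x)" and M: "0 \<le> M"
    and bound: "\<And>x v. norm (F (x + z) v - F x v) \<le> M * norm v"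
  obtains B where "bounded_clinear B"
    "\<And>\<psi>. \<psi> \<in> op_dom (fourier_multiplier F) \<Longrightarrow> W z \<psi> \<in> op_dom (fourier_multiplier F) \<and>
      op_app (fourier_multiplier F) (W z \<psi>) = W z (op_app (fourier_multiplier F) \<psi>) + B \<psi>"
proof -
  interpret selfadjoint_multiplier F by standard (rule F)
  define A where "A x v = c z (x - z) *\<^sub>C (F x v - F (x - z) v)" for x v
  have A: "norm (A x v) \<le> M * norm v" for x v
    using bound[of "x - z" v] by (simp add: A_def norm_scaleC_c)
  have "clinear (A x)" for x
    unfolding Vector_Spaces.linear_iff
    by (intro conjI allI complex_vector.vector_space_axioms)
      (simp_all add: A_def F_linear scaleC_scaleC mult.commute algebra_simps scaleC_add_right
        complex_vector.scale_right_diff_distrib)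
  then have "bounded_clinear (shift_op z A)" by (rule bounded_clinear_shift_op[OF M A])
  \<comment> \<open>Writing F x as F (x - z) plus an increment splits the image of the shifted
    vector into coordinates of two vectors of the space; this also shows that the shift preserves
    the domain.\<close>
  moreover have "W z \<psi> \<in> op_dom D \<and> op_app D (W z \<psi>) = W z (op_app D \<psi>) + shift_op z A \<psi>"
    if "\<psi> \<in> op_dom D" for \<psi>
    by (rule dom_if_l2)
      (simp add: l2_fun_W l2_fun_shift_op[OF M A] l2_fun_D[OF that] F_linear A_def
        complex_vector.scale_right_diff_distrib)
  ultimately show ?thesis using that by blast
qed

lemma (in free_twisted_torus) polynomial_in_smooth_elements:
  fixes F :: "(int, 'm) vec \<Rightarrow> 's::{chilbert_space, euclidean_space} \<Rightarrow> 's"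
  assumes F: "\<And>x. selfadjoint_endo (F x)"
    and bound: "\<And>z. \<exists>M\<ge>0. \<forall>x v. norm (F (x + z) v - F x v) \<le> M * norm v" and X: "finite X"
  shows "(\<Sum>x\<in>X. p x *\<^sub>C u x) \<in> smooth_elements (\<lambda>a. blinfun_apply (regular_rep a)) (fourier_multiplier F)"
proof -
  interpret selfadjoint_multiplier F by standard (rule F)
  have "\<forall>z. \<exists>B. bounded_clinear B \<and> (\<forall>\<psi>\<in>op_dom D. W z \<psi> \<in> op_dom D \<and>
      op_app D (W z \<psi>) = W z (op_app D \<psi>) + B \<psi>)"
  proof
    fix z
    obtain M where "0 \<le> M" "\<And>x v. norm (F (x + z) v - F x v) \<le> M * norm v" using bound by blast
    then show "\<exists>B. bounded_clinear B \<and> (\<forall>\<psi>\<in>op_dom D. W z \<psi> \<in> op_dom D \<and>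
        op_app D (W z \<psi>) = W z (op_app D \<psi>) + B \<psi>)"
      by (rule commutator_W[OF F]) blast
  qed
  then obtain B where B: "\<And>z. bounded_clinear (B z)"
    "\<And>z \<psi>. \<psi> \<in> op_dom D \<Longrightarrow> W z \<psi> \<in> op_dom D \<and> op_app D (W z \<psi>) = W z (op_app D \<psi>) + B z \<psi>"
    by metis
  define BX where "BX \<psi> = (\<Sum>x\<in>X. p x *\<^sub>C B x \<psi>)" for \<psi>
  have "(\<Sum>x\<in>X. p x *\<^sub>C W x \<psi>) \<in> op_dom D \<and> op_app D (\<Sum>x\<in>X. p x *\<^sub>C W x \<psi>) =
      (\<Sum>x\<in>X. p x *\<^sub>C W x (op_app D \<psi>)) + (\<Sum>x\<in>X. p x *\<^sub>C B x \<psi>)" if "\<psi> \<in> op_dom D" for \<psi>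
    using X
  proof (induction X rule: finite_induct)
    case empty
    show ?case by (simp add: dom_zero)
  next
    case (insert x X)
    then show ?case using B(2)[OF that, of x] by (simp add: dom_add dom_scaleC scaleC_add_right)
  qed
  then have comm: "blinfun_apply (regular_rep (\<Sum>x\<in>X. p x *\<^sub>C u x)) \<psi> \<in> op_dom D \<and>
      op_app D (blinfun_apply (regular_rep (\<Sum>x\<in>X. p x *\<^sub>C u x)) \<psi>) =
      blinfun_apply (regular_rep (\<Sum>x\<in>X. p x *\<^sub>C u x)) (op_app D \<psi>) + BX \<psi>"
    if "\<psi> \<in> op_dom D" for \<psi>
    using that by (simp add: regular_rep_sum BX_def)
  have BXb: "bounded_linear BX"
    unfolding BX_def
    by (intro bounded_linear_sum bounded_linear_compose[OF bounded_linear_scaleC]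
        bounded_clinearD(1)[OF B(1)])
  then obtain K where K: "\<And>\<psi>. norm (BX \<psi>) \<le> norm \<psi> * K" by (auto dest: bounded_linear.bounded)
  have "bounded_clinear BX"
  proof (rule bounded_clinearI)
    show "BX (x + y) = BX x + BX y" for x y by (rule linear_add[OF bounded_linear.linear[OF BXb]])
    show "BX (d *\<^sub>C x) = d *\<^sub>C BX x" for d x
      by (simp add: BX_def bounded_clinearD(3)[OF B(1)] complex_vector.scale_sum_right
          scaleC_scaleC mult.commute[of "p _"])
    show "norm (BX x) \<le> K * norm x" for x using K[of x] by (simp add: mult.commute)
  qed
  \<comment> \<open>Polynomials preserve the domain of D, so the natural domain of the commutator is
    all of it and density is inherited.\<close>
  moreover have "op_dom (commutator D (blinfun_apply (regular_rep (\<Sum>x\<in>X. p x *\<^sub>C u x)))) = op_dom D"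
    using comm by (auto simp: commutator_def)
  ultimately show ?thesis
    unfolding smooth_elements_def densely_defined_def extends_to_bounded_def
    using densely_defined_D comm by (auto simp: commutator_def)
qed

theorem proposition4p1:
  fixes \<Theta> :: "((real, 'm::{finite, linorder}) vec, 'm) vec"
    and U :: "'m \<Rightarrow> 'a::unital_cstar_algebra"
    and F :: "(int, 'm) vec \<Rightarrow> 's::{chilbert_space, euclidean_space} \<Rightarrow> 's"
  assumes "CARD('m) \<ge> 2"
    and "transpose \<Theta> = - \<Theta>"
    and "universal_nc_torus \<Theta> U"
    and "\<And>x. selfadjoint_endo (F x)"
    and "\<And>R::real. R > 0 \<Longrightarrow> finite_dimensional
      (l2_subsum {x. spectrum (F x) \<inter> complex_of_real ` {-R..R} \<noteq> {}} :: ((int, 'm) vec, 's) l2 set)"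
    and "\<And>a. bdd_above (range (\<lambda>x. onorm (\<lambda>\<xi>. F (x + a) \<xi> - F x \<xi>)))"
  shows "spectral_triple
    (nc_torus_rep U :: 'a \<Rightarrow> ((int, 'm) vec, 's) l2 \<Rightarrow> ((int, 'm) vec, 's) l2) (fourier_multiplier F)"
proof -
  interpret free_twisted_torus "monomial U" "twist U"
    by (rule free_twisted_torus_monomial[OF assms(3)])
  interpret selfadjoint_multiplier F by standard (rule assms(4))
  have rep: "(nc_torus_rep U :: 'a \<Rightarrow> ((int, 'm) vec, 's) l2 \<Rightarrow> _) = (\<lambda>a. blinfun_apply (regular_rep a))"
    by (rule ext) (rule nc_torus_rep_eq_regular_rep[OF assms(3)])
  have bound: "\<exists>M\<ge>0. \<forall>x v. norm (F (x + z) v - F x v) \<le> M * norm v" for z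
  proof -
    obtain M where M: "\<And>x. onorm (\<lambda>\<xi>. F (x + z) \<xi> - F x \<xi>) \<le> M"
      using assms(6)[of z] by (auto simp: bdd_above_def)
    have bl: "bounded_linear (\<lambda>\<xi>. F (x + z) \<xi> - F x \<xi>)" for x
      by (intro bounded_linear_sub linear_linear[THEN iffD2] clinear_imp_linear
          selfadjoint_endoD(1) assms(4))
    have "norm (F (x + z) v - F x v) \<le> M * norm v" for x v
      using onorm[OF bl, of x v] mult_right_mono[OF M, of "norm v" x] by simp
    moreover have "0 \<le> M" using onorm_pos_le[OF bl] M order_trans by blast
    ultimately show ?thesis by blast
  qed
  have "a \<in> closure (smooth_elements (\<lambda>a. blinfun_apply (regular_rep a)) D)" for a
    by (rule dense_induct)
      (use polynomial_in_smooth_elements[of F, OF assms(4) bound] closure_subset in auto)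
  moreover have "has_compact_resolvent D"
    unfolding has_compact_resolvent_def
    using ex_resolvent compact_resolvent[OF finite_if_finite_dimensional_l2_subsum[OF assms(5)]] by blast
  ultimately show ?thesis
    unfolding spectral_triple_def rep
    using faithful_unital_rep_regular_rep selfadjoint_D by auto
qed

end
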